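(* Let $\mathcal{G}$ be a locally compact, $\sigma$-compact and étale groupoid. If $\mathcal{G}$ is amenable, then $C_r^*(\mathcal{G})=C_u^*(\mathcal{G})^{\mathcal{G}}=C_{uq}^*(\mathcal{G})^{\mathcal{G}}$ as subalgebras of $\mathcal{L}(L^2(\mathcal{G}))$, where $C_r^*(\mathcal{G})$ is identified with its image under the left regular representation $\Lambda$.
   Context: Locally compact spaces are assumed Hausdorff. A locally compact étale groupoid $\mathcal{G}$ is a topological groupoid with locally compact topology whose range map $\mathrm{r}$ (hence source map $\mathrm{s}$) is a local homeomorphism; $\mathcal{G}^{(0)}$ is its unit space and $\mathcal{G}_x=\mathrm{s}^{-1}(x)$ (discrete). For $A,B\subseteq\mathcal{G}$, $A\cdot B=\{\alpha\beta:\alpha\in A,\beta\in B,\mathrm{s}(\alpha)=\mathrm{r}(\beta)\}$. $C_b(\mathcal{G})$ is the set of bounded continuous complex functions. $\mathcal{G}$ is amenable if for any $\varepsilon>0$ and compact $K\subseteq\mathcal{G}$ there is a non-negative $f\in C_c(\mathcal{G})$ such that for all $\gamma\in K$: $|1-\sum_{\beta\in\mathcal{G}_{\mathrm{r}(\gamma)}}f(\beta)|<\varepsilon$ and $\sum_{\beta\in\mathcal{G}_{\mathrm{r}(\gamma)}}|f(\beta)-f(\beta\gamma)|<\varepsilon$. $L^2(\mathcal{G})$ is the Hilbert $C_0(\mathcal{G}^{(0)})$-module obtained by completing $C_c(\mathcal{G})$ for $\langle\eta,\xi\rangle(x)=\sum_{\gamma\in\mathcal{G}_x}\overline{\eta(\gamma)}\xi(\gamma)$,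 with $(\xi f)(\gamma)=\xi(\gamma)f(\mathrm{s}(\gamma))$; its elements are regarded as functions in $C_0(\mathcal{G})$. $\mathcal{L}(L^2(\mathcal{G}))$ is the $C^*$-algebra of adjointable operators. $g\in C_b(\mathcal{G})$ acts on $L^2(\mathcal{G})$ by pointwise multiplication, also denoted $g$. The left regular representation $\Lambda:C_c(\mathcal{G})\to\mathcal{L}(L^2(\mathcal{G}))$ is $(\Lambda(f)\xi)(\gamma)=\sum_{\alpha\in\mathcal{G}_{\mathrm{s}(\gamma)}}f(\gamma\alpha^{-1})\xi(\alpha)$; $C_r^*(\mathcal{G})$ is the completion of $C_c(\mathcal{G})$ for $\|f\|_r=\|\Lambda(f)\|$, so it is identified with the norm closure of $\Lambda(C_c(\mathcal{G}))$. For $g\in C_c(\mathcal{G})$, $\rho(g)$ is the bounded linear operator on the Banach space $L^2(\mathcal{G})$ given by $(\rho(g)\xi)(\gamma)=\sum_{\beta\in\mathcal{G}_{\mathrm{s}(\gamma)}}g(\beta)\xi(\gamma\beta^{-1})$. $T\in\mathcal{L}(L^2(\mathcal{G}))$ is $\mathcal{G}$-equivariant if $T\rho(g)=\rho(g)T$ for all $g\in C_c(\mathcal{G})$. For $K\subseteq\mathcal{G}$, $f,g\in C_b(\mathcal{G})$ are $K$-separated if $(K\cdot\mathrm{supp}(f))\cap\mathrm{supp}(g)=\emptyset$ and $\mathrm{supp}(f)\cap(K\cdot\mathrm{supp}(g))=\emptyset$. $T\in\mathcal{L}(L^2(\mathcal{G}))$ is compactly supported if there is a compact $K\subseteq\mathcal{G}$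 with $gTf=0$ for all $K$-separated $f,g\in C_b(\mathcal{G})$; $T$ is quasi-local if for any $\varepsilon>0$ there is a compact $K\subseteq\mathcal{G}$ such that $\|gTf\|<\varepsilon\|g\|_\infty\|f\|_\infty$ (read as $\le$ when $f=0$ or $g=0$) for all $K$-separated $f,g\in C_b(\mathcal{G})$. $C_u^*(\mathcal{G})$ (uniform Roe algebra) is the norm closure in $\mathcal{L}(L^2(\mathcal{G}))$ of the set of compactly supported operators; $C_{uq}^*(\mathcal{G})$ (uniform quasi-local algebra) is the $C^*$-algebra of quasi-local operators; $C_u^*(\mathcal{G})^{\mathcal{G}}$ and $C_{uq}^*(\mathcal{G})^{\mathcal{G}}$ are the subalgebras of their $\mathcal{G}$-equivariant elements. *)

theory Defs
  imports "HOL-Analysis.Analysis"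
begin

section \<open>Locally compact etale groupoids\<close>

text \<open>
  The arrows of a groupoid are all the elements of a Hausdorff topological type, and a unit is
  identified with its identity arrow. The product \<open>gmult G \<alpha> \<beta>\<close> is meaningful only if
  \<open>gsource G \<alpha> = grange G \<beta>\<close>; its other values are unspecified and never used.
\<close>

record 'a groupoid_data =
  grange :: "'a \<Rightarrow> 'a"
  gsource :: "'a \<Rightarrow> 'a"
  gmult :: "'a \<Rightarrow> 'a \<Rightarrow> 'a"
  ginv :: "'a \<Rightarrow> 'a"

definition units :: "'a groupoid_data \<Rightarrow> 'a set" where
  "units G = range (grange G)"

definition composable :: "'a groupoid_data \<Rightarrow> ('a \<times> 'a) set" where
  "composable G = {(\<alpha>, \<beta>). gsource G \<alpha> = grange G \<beta>}"

definition source_fibre :: "'a groupoid_data \<Rightarrow> 'a \<Rightarrow> 'a set" where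
  "source_fibre G x = {\<gamma>. gsource G \<gamma> = x}"

definition set_mult :: "'a groupoid_data \<Rightarrow> 'a set \<Rightarrow> 'a set \<Rightarrow> 'a set" where
  "set_mult G A B = {gmult G \<alpha> \<beta> | \<alpha> \<beta>. \<alpha> \<in> A \<and> \<beta> \<in> B \<and> gsource G \<alpha> = grange G \<beta>}"

definition is_groupoid :: "'a groupoid_data \<Rightarrow> bool" where
  "is_groupoid G \<longleftrightarrow>
     (\<forall>\<gamma>. grange G (grange G \<gamma>) = grange G \<gamma> \<and> gsource G (grange G \<gamma>) = grange G \<gamma> \<and>
          grange G (gsource G \<gamma>) = gsource G \<gamma> \<and> gsource G (gsource G \<gamma>) = gsource G \<gamma>) \<and>
     (\<forall>\<alpha> \<beta>. gsource G \<alpha> = grange G \<beta> \<longrightarrow>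
          grange G (gmult G \<alpha> \<beta>) = grange G \<alpha> \<and> gsource G (gmult G \<alpha> \<beta>) = gsource G \<beta>) \<and>
     (\<forall>\<alpha> \<beta> \<gamma>. gsource G \<alpha> = grange G \<beta> \<and> gsource G \<beta> = grange G \<gamma> \<longrightarrow>
          gmult G (gmult G \<alpha> \<beta>) \<gamma> = gmult G \<alpha> (gmult G \<beta> \<gamma>)) \<and>
     (\<forall>\<gamma>. gmult G (grange G \<gamma>) \<gamma> = \<gamma> \<and> gmult G \<gamma> (gsource G \<gamma>) = \<gamma>) \<and>
     (\<forall>\<gamma>. grange G (ginv G \<gamma>) = gsource G \<gamma> \<and> gsource G (ginv G \<gamma>) = grange G \<gamma> \<and>
          gmult G \<gamma> (ginv G \<gamma>) = grange G \<gamma> \<and> gmult G (ginv G \<gamma>) \<gamma> = gsource G \<gamma>)"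

text \<open>
  Continuity of the range and source maps follows from
  \<open>grange G \<gamma> = gmult G \<gamma> (ginv G \<gamma>)\<close> and \<open>gsource G \<gamma> = gmult G (ginv G \<gamma>) \<gamma>\<close>.
\<close>

definition topological_groupoid :: "'a::topological_space groupoid_data \<Rightarrow> bool" where
  "topological_groupoid G \<longleftrightarrow>
     is_groupoid G \<and>
     continuous_on (composable G) (\<lambda>(\<alpha>, \<beta>). gmult G \<alpha> \<beta>) \<and>
     continuous_on UNIV (ginv G)"

definition local_homeomorphism ::
  "'a::topological_space set \<Rightarrow> 'b::topological_space set \<Rightarrow> ('a \<Rightarrow> 'b) \<Rightarrow> bool" where
  "local_homeomorphism S T f \<longleftrightarrow>
     f ` S \<subseteq> T \<and>
     (\<forall>x\<in>S. \<exists>U. openin (top_of_set S) U \<and> x \<in> U \<and> openin (top_of_set T) (f ` U) \<and>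
                (\<exists>g. homeomorphism U (f ` U) f g))"

definition locally_compact_etale_groupoid :: "'a::t2_space groupoid_data \<Rightarrow> bool" where
  "locally_compact_etale_groupoid G \<longleftrightarrow>
     topological_groupoid G \<and>
     locally_compact_space (euclidean :: 'a topology) \<and>
     local_homeomorphism UNIV (units G) (grange G)"

definition sigma_compact :: "'a::topological_space set \<Rightarrow> bool" where
  "sigma_compact S \<longleftrightarrow> (\<exists>K :: nat \<Rightarrow> 'a set. (\<forall>n. compact (K n)) \<and> (\<Union>n. K n) = S)"


section \<open>Function spaces and amenability\<close>

definition supp :: "('a::topological_space \<Rightarrow> complex) \<Rightarrow> 'a set" where
  "supp f = closure {x. f x \<noteq> 0}"

definition Cc :: "('a::topological_space \<Rightarrow> complex) set" where
  "Cc = {f. continuous_on UNIV f \<and> compact (supp f)}"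

definition Cb :: "('a::topological_space \<Rightarrow> complex) set" where
  "Cb = {f. continuous_on UNIV f \<and> bounded (range f)}"

definition sup_norm :: "('a \<Rightarrow> complex) \<Rightarrow> real" where
  "sup_norm f = (SUP x. cmod (f x))"

text \<open>
  The sums over fibres below have only finitely many nonzero terms, since the fibres
  of an etale groupoid are closed and discrete.
\<close>

definition amenable :: "'a::t2_space groupoid_data \<Rightarrow> bool" where
  "amenable G \<longleftrightarrow>
     (\<forall>\<epsilon>>0. \<forall>K. compact K \<longrightarrow>
       (\<exists>f\<in>Cc. range f \<subseteq> \<real>\<^sub>\<ge>\<^sub>0 \<and>
         (\<forall>\<gamma>\<in>K.
            cmod (1 - (\<Sum>\<^sub>\<infinity>\<beta>\<in>source_fibre G (grange G \<gamma>). f \<beta>)) < \<epsilon> \<and>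
            (\<Sum>\<^sub>\<infinity>\<beta>\<in>source_fibre G (grange G \<gamma>). cmod (f \<beta> - f (gmult G \<beta> \<gamma>))) < \<epsilon>)))"


section \<open>The Hilbert module and its adjointable operators\<close>

definition L2_inner :: "'a groupoid_data \<Rightarrow> ('a \<Rightarrow> complex) \<Rightarrow> ('a \<Rightarrow> complex) \<Rightarrow> 'a \<Rightarrow> complex" where
  "L2_inner G \<eta> \<xi> x = (\<Sum>\<^sub>\<infinity>\<gamma>\<in>source_fibre G x. cnj (\<eta> \<gamma>) * \<xi> \<gamma>)"

definition L2_norm :: "'a groupoid_data \<Rightarrow> ('a \<Rightarrow> complex) \<Rightarrow> real" where
  "L2_norm G \<xi> = sqrt (SUP x\<in>units G. cmod (L2_inner G \<xi> \<xi> x))"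

definition fibrewise_l2 :: "'a groupoid_data \<Rightarrow> ('a \<Rightarrow> complex) set" where
  "fibrewise_l2 G =
     {\<xi>. (\<forall>x\<in>units G. (\<lambda>\<gamma>. (cmod (\<xi> \<gamma>))\<^sup>2) summable_on source_fibre G x) \<and>
         bdd_above ((\<lambda>x. \<Sum>\<^sub>\<infinity>\<gamma>\<in>source_fibre G x. (cmod (\<xi> \<gamma>))\<^sup>2) ` units G)}"

text \<open>
  With \<open>L2_norm G\<close>, the set \<open>fibrewise_l2 G\<close> is a Banach space, namely the bounded
  sections of the Hilbert spaces \<open>\<ell>\<^sup>2(source_fibre G x)\<close>. The completion of \<open>Cc\<close> is
  therefore realised, as a space of functions, by the closure of \<open>Cc\<close> in it. Since
  \<open>L2_norm G\<close> dominates the supremum norm, these functions are continuous and vanish at infinity.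
\<close>

definition L2 :: "'a::topological_space groupoid_data \<Rightarrow> ('a \<Rightarrow> complex) set" where
  "L2 G = {\<xi>\<in>fibrewise_l2 G. \<forall>\<epsilon>>0. \<exists>\<eta>\<in>Cc. L2_norm G (\<lambda>\<gamma>. \<xi> \<gamma> - \<eta> \<gamma>) < \<epsilon>}"

text \<open>
  An operator on \<open>L2 G\<close> is a function that takes the value zero outside \<open>L2 G\<close>; this makes
  equality of operators the same as equality on \<open>L2 G\<close>.
\<close>

type_synonym 'a operator = "('a \<Rightarrow> complex) \<Rightarrow> ('a \<Rightarrow> complex)"

definition zero_operator :: "'a operator" where
  "zero_operator = (\<lambda>\<xi> \<gamma>. 0)"

definition operator_on_L2 ::
  "'a::topological_space groupoid_data \<Rightarrow> 'a operator \<Rightarrow> 'a operator" where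
  "operator_on_L2 G T = (\<lambda>\<xi>. if \<xi> \<in> L2 G then T \<xi> else (\<lambda>\<gamma>. 0))"

text \<open>
  As usual for Hilbert modules, possession of an adjoint is the whole definition;
  linearity over scalars and over the coefficient algebra, and boundedness, are consequences.
\<close>

definition adjointable_operators :: "'a::topological_space groupoid_data \<Rightarrow> 'a operator set" where
  "adjointable_operators G =
     {T. T ` L2 G \<subseteq> L2 G \<and> (\<forall>\<xi>. \<xi> \<notin> L2 G \<longrightarrow> T \<xi> = (\<lambda>\<gamma>. 0)) \<and>
         (\<exists>S. S ` L2 G \<subseteq> L2 G \<and>
              (\<forall>\<xi>\<in>L2 G. \<forall>\<eta>\<in>L2 G. \<forall>x\<in>units G. L2_inner G (T \<xi>) \<eta> x = L2_inner G \<xi> (S \<eta>) x))}"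

definition operator_norm :: "'a::topological_space groupoid_data \<Rightarrow> 'a operator \<Rightarrow> real" where
  "operator_norm G T = (SUP \<xi>\<in>{\<xi>\<in>L2 G. L2_norm G \<xi> \<le> 1}. L2_norm G (T \<xi>))"

definition norm_closure ::
  "'a::topological_space groupoid_data \<Rightarrow> 'a operator set \<Rightarrow> 'a operator set" where
  "norm_closure G A =
     {T\<in>adjointable_operators G. \<forall>\<epsilon>>0. \<exists>S\<in>A. operator_norm G (\<lambda>\<xi> \<gamma>. T \<xi> \<gamma> - S \<xi> \<gamma>) < \<epsilon>}"

definition mult_operator ::
  "'a::topological_space groupoid_data \<Rightarrow> ('a \<Rightarrow> complex) \<Rightarrow> 'a operator" where
  "mult_operator G g = operator_on_L2 G (\<lambda>\<xi> \<gamma>. g \<gamma> * \<xi> \<gamma>)"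


section \<open>The reduced, uniform Roe and uniform quasi-local algebras\<close>

definition left_regular ::
  "'a::topological_space groupoid_data \<Rightarrow> ('a \<Rightarrow> complex) \<Rightarrow> 'a operator" where
  "left_regular G f = operator_on_L2 G
     (\<lambda>\<xi> \<gamma>. \<Sum>\<^sub>\<infinity>\<alpha>\<in>source_fibre G (gsource G \<gamma>). f (gmult G \<gamma> (ginv G \<alpha>)) * \<xi> \<alpha>)"

definition reduced_algebra :: "'a::topological_space groupoid_data \<Rightarrow> 'a operator set" where
  "reduced_algebra G = norm_closure G (left_regular G ` Cc)"

definition right_conv ::
  "'a::topological_space groupoid_data \<Rightarrow> ('a \<Rightarrow> complex) \<Rightarrow> 'a operator" where
  "right_conv G g = operator_on_L2 G
     (\<lambda>\<xi> \<gamma>. \<Sum>\<^sub>\<infinity>\<beta>\<in>source_fibre G (gsource G \<gamma>). g \<beta> * \<xi> (gmult G \<gamma> (ginv G \<beta>)))"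

definition equivariant_part ::
  "'a::topological_space groupoid_data \<Rightarrow> 'a operator set \<Rightarrow> 'a operator set" where
  "equivariant_part G A = {T\<in>A. \<forall>g\<in>Cc. T \<circ> right_conv G g = right_conv G g \<circ> T}"

definition separated ::
  "'a::topological_space groupoid_data \<Rightarrow> 'a set \<Rightarrow> ('a \<Rightarrow> complex) \<Rightarrow> ('a \<Rightarrow> complex) \<Rightarrow> bool" where
  "separated G K f g \<longleftrightarrow>
     set_mult G K (supp f) \<inter> supp g = {} \<and> supp f \<inter> set_mult G K (supp g) = {}"

definition compactly_supported_operators ::
  "'a::topological_space groupoid_data \<Rightarrow> 'a operator set" where
  "compactly_supported_operators G =
     {T\<in>adjointable_operators G. \<exists>K. compact K \<and>
        (\<forall>f\<in>Cb. \<forall>g\<in>Cb. separated G K f g \<longrightarrow>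
           mult_operator G g \<circ> T \<circ> mult_operator G f = zero_operator)}"

definition uniform_Roe_algebra :: "'a::topological_space groupoid_data \<Rightarrow> 'a operator set" where
  "uniform_Roe_algebra G = norm_closure G (compactly_supported_operators G)"

text \<open>The strict inequality is unattainable when \<open>f\<close> or \<open>g\<close> vanishes, hence the case distinction.\<close>

definition uniform_quasi_local_algebra ::
  "'a::topological_space groupoid_data \<Rightarrow> 'a operator set" where
  "uniform_quasi_local_algebra G =
     {T\<in>adjointable_operators G. \<forall>\<epsilon>>0. \<exists>K. compact K \<and>
        (\<forall>f\<in>Cb. \<forall>g\<in>Cb. separated G K f g \<longrightarrow>
           (let N = operator_norm G (mult_operator G g \<circ> T \<circ> mult_operator G f);
                B = \<epsilon> * sup_norm g * sup_norm f
            in if f = (\<lambda>\<gamma>. 0) \<or> g = (\<lambda>\<gamma>. 0) then N \<le> B else N < B))}"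

end

theory Submission
  imports Defs
begin

text \<open>
  An equivariant operator \<open>T\<close> is convolution by a continuous kernel \<open>k\<close>, namely \<open>k \<gamma> = T e \<gamma>\<close> for a
  bump function \<open>e\<close> on the unit space with \<open>e (s \<gamma>) = 1\<close>. Amenability provides compactly supported
  positive definite functions \<open>\<phi>\<close> close to 1 on any compact set, so \<open>\<phi> * k\<close> lies in \<open>Cc\<close>, and the point is
  that convolution by \<open>k - \<phi> * k\<close> is small in norm when \<open>T\<close> is quasi-local. Fibre by fibre this concerns
  finite matrices. Level sets of the functions given by amenability split almost all the mass of a
  vector into clusters of bounded size that are far apart. The blocks joining different clusters
  are small, uniformly in the number of clusters, since their sum is an average over random
  bipartitions of the clusters. The blocks within a cluster are small because \<open>\<phi>\<close> is close to 1 there.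
\<close>

section \<open>Etale groupoids\<close>

text \<open>The obstacle is that quasi-locality bounds a matrix only between separated sets of rows
  and columns. Far entries of \<open>k\<close> become small, but nothing makes them summable, so the
  error of a cut-off cannot be estimated entry by entry; and estimating the blocks between clusters
  one at a time would cost a factor growing with their number. A bipartition of the clusters is a
  single separated pair, which is why averaging keeps the bound. The passage to finite matrices
  rests on two facts: norms are suprema of finite sums over fibres, and a finite vector on one fibre
  extends to a function in \<open>Cc\<close> of no larger norm. Amenability enters twice, with
  different tolerances: through an almost invariant density \<open>p\<close> whose level sets are
  the clusters (the Namioka trick), and through a function \<open>h\<close>, essentially the square
  root of another such density, whose coefficient is the multiplier. Positive definiteness makes
  multiplication by this coefficient act on matrices with norm at most 2, however large its support
  is, so that both boundedness and quasi-locality survive the subtraction of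
  \<open>\<phi> * k\<close>.\<close>

lemma Hausdorff_space_euclidean_t2: "Hausdorff_space (euclidean :: 'a::t2_space topology)"
  unfolding Hausdorff_space_def disjnt_def using hausdorff by simp blast

section \<open>Supports and functions of compact support\<close>

lemma suppI: "f x \<noteq> 0 \<Longrightarrow> x \<in> supp f"
  unfolding supp_def by (rule closure_subset[THEN subsetD]) simp

lemma supp_outside: "x \<notin> supp f \<Longrightarrow> f x = 0"
  using suppI by metis

lemma supp_subset_closed: "closed C \<Longrightarrow> (\<And>x. f x \<noteq> 0 \<Longrightarrow> x \<in> C) \<Longrightarrow> supp f \<subseteq> C"
  unfolding supp_def by (rule closure_minimal) auto

lemma closed_supp [simp]: "closed (supp f)"
  unfolding supp_def by simp

lemma CcI:
  fixes f :: "'a::t2_space \<Rightarrow> complex"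
  assumes "continuous_on UNIV f" "compact C" "\<And>x. f x \<noteq> 0 \<Longrightarrow> x \<in> C"
  shows "f \<in> Cc"
proof -
  have "supp f \<subseteq> C"
    using assms compact_imp_closed supp_subset_closed by blast
  then have "supp f = C \<inter> supp f" by auto
  then have "compact (supp f)"
    using assms(2) closed_supp compact_Int_closed by metis
  with assms(1) show ?thesis unfolding Cc_def by simp
qed

lemma Cc_cont: "f \<in> Cc \<Longrightarrow> continuous_on UNIV f"
  and Cc_compact: "f \<in> Cc \<Longrightarrow> compact (supp f)"
  unfolding Cc_def by auto

lemma Cc_bounded:
  assumes "f \<in> Cc"
  obtains B where "0 \<le> B" "\<And>x. cmod (f x) \<le> B"
proof -
  have "compact (f ` supp f)"
    using assms Cc_cont Cc_compact
    by (intro compact_continuous_image) (auto intro: continuous_on_subset)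
  then have "bounded (f ` supp f)" by (rule compact_imp_bounded)
  then obtain B where B: "\<And>x. x \<in> supp f \<Longrightarrow> cmod (f x) \<le> B"
    unfolding bounded_iff by auto
  have "cmod (f x) \<le> max B 0" for x
    using B[of x] suppI[of f x] by (cases "f x = 0") auto
  then show ?thesis using that[of "max B 0"] by auto
qed

lemma Cc_imp_Cb:
  assumes "f \<in> Cc"
  shows "f \<in> Cb"
proof -
  obtain B where "\<And>x. cmod (f x) \<le> B" using Cc_bounded[OF assms] by blast
  then show ?thesis using Cc_cont[OF assms] unfolding Cb_def bounded_iff by auto
qed

lemma Cc_add: "f \<in> Cc \<Longrightarrow> g \<in> Cc \<Longrightarrow> (\<lambda>x. f x + g x) \<in> Cc" for f g :: "'a::t2_space \<Rightarrow> complex"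
  by (rule CcI[of _ "supp f \<union> supp g"])
    (auto simp: Cc_cont Cc_compact compact_Un supp_outside intro: continuous_on_add,
      metis add_0 supp_outside)

lemma Cc_mult: "f \<in> Cc \<Longrightarrow> continuous_on UNIV g \<Longrightarrow> (\<lambda>x. g x * f x) \<in> Cc"
  for f g :: "'a::t2_space \<Rightarrow> complex"
  by (rule CcI[of _ "supp f"])
    (auto simp: Cc_cont Cc_compact intro: continuous_on_mult suppI)

lemma Cc_scale: "f \<in> Cc \<Longrightarrow> (\<lambda>x. c * f x) \<in> Cc" for f :: "'a::t2_space \<Rightarrow> complex"
  by (rule Cc_mult) auto

lemma Cc_zero: "(\<lambda>x. 0) \<in> (Cc :: ('a::t2_space \<Rightarrow> complex) set)"
  by (rule CcI[of _ "{}"]) auto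

lemma Cc_sum: "finite I \<Longrightarrow> (\<And>i. i \<in> I \<Longrightarrow> f i \<in> Cc) \<Longrightarrow> (\<lambda>x. \<Sum>i\<in>I. f i x) \<in> Cc"
  for f :: "'i \<Rightarrow> 'a::t2_space \<Rightarrow> complex"
  by (induction I rule: finite_induct) (auto simp: Cc_zero intro: Cc_add)

text \<open>Complete regularity alone gives no compact support. Finitely many open sets, each inside
  a compact subset of \<open>U\<close>, cover \<open>C\<close>; letting \<open>e\<close> vanish off
  their union \<open>W\<close> confines its support to the compact set \<open>L\<close>.\<close>

lemma locally_compact_Urysohn:
  fixes C :: "'a::t2_space set"
  assumes lc: "locally_compact_space (euclidean :: 'a topology)"
    and "compact C" "open U" "C \<subseteq> U"
  obtains e :: "'a \<Rightarrow> real" where "continuous_on UNIV e" "\<And>x. 0 \<le> e x" "\<And>x. e x \<le> 1"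
    "\<And>x. x \<in> C \<Longrightarrow> e x = 1" "(\<lambda>x. complex_of_real (e x)) \<in> Cc"
    "supp (\<lambda>x. complex_of_real (e x)) \<subseteq> U"
proof -
  have reg: "regular_space (euclidean :: 'a topology)"
    using lc locally_compact_Hausdorff_imp_regular_space Hausdorff_space_euclidean_t2 by blast
  then have nb: "neighbourhood_base_of (\<lambda>C. compactin euclidean C \<and> closedin euclidean C) (euclidean :: 'a topology)"
    using lc locally_compact_regular_space_neighbourhood_base by blast
  have cr: "completely_regular_space (euclidean :: 'a topology)"
    using lc reg locally_compact_regular_imp_completely_regular_space by blast
  have "\<exists>V K. open V \<and> compact K \<and> x \<in> V \<and> V \<subseteq> K \<and> K \<subseteq> U" if "x \<in> C" for x
  proof -
    have "x \<in> U" using that assms(4) by auto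
    with nb \<open>open U\<close> show ?thesis
      unfolding neighbourhood_base_of by auto (metis)
  qed
  then obtain V K where VK: "\<And>x. x \<in> C \<Longrightarrow> open (V x) \<and> compact (K x) \<and> x \<in> V x \<and> V x \<subseteq> K x \<and> K x \<subseteq> U"
    by metis
  obtain D where D: "D \<subseteq> C" "finite D" "C \<subseteq> (\<Union>x\<in>D. V x)"
    using compactE_image[OF \<open>compact C\<close>, of C V] VK by blast
  define W where "W = (\<Union>x\<in>D. V x)"
  define L where "L = (\<Union>x\<in>D. K x)"
  have W: "open W" "C \<subseteq> W" "W \<subseteq> L" and L: "compact L" "L \<subseteq> U"
    using VK D unfolding W_def L_def by (auto intro!: compact_UN) 
  obtain e where e: "continuous_map euclidean (top_of_set {0..1::real}) e" "e ` (- W) \<subseteq> {0}" "e ` C \<subseteq> {1}"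
    using Urysohn_completely_regular_compact_closed[of 0 1 "euclidean :: 'a topology" C "- W"]
      cr W \<open>compact C\<close> by (auto simp: disjnt_def)
  have cont: "continuous_on UNIV e" and e01: "\<And>x. 0 \<le> e x \<and> e x \<le> 1"
    using e(1) by (auto simp: continuous_map_in_subtopology)
  have inL: "x \<in> L" if "complex_of_real (e x) \<noteq> 0" for x
    using that e(2) W(3) by auto
  have supp: "supp (\<lambda>x. complex_of_real (e x)) \<subseteq> U"
    using supp_subset_closed[of L] inL L compact_imp_closed by (metis (no_types, lifting) subset_trans)
  show ?thesis
  proof (rule that[of e])
    show "(\<lambda>x. complex_of_real (e x)) \<in> Cc"
      by (rule CcI[OF _ L(1) inL]) (auto intro!: continuous_intros cont)
  qed (use cont e01 e(3) supp in auto)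
qed

text \<open>Later the finite set is the part of a fibre inside a compact set, or carries a finite
  vector on a fibre.\<close>

lemma finite_disjoint_neighbourhoods:
  fixes A :: "'a::t2_space set"
  assumes "finite A"
  shows "\<exists>V. \<forall>a\<in>A. open (V a) \<and> a \<in> V a \<and> (\<forall>b\<in>A. a \<noteq> b \<longrightarrow> V a \<inter> V b = {})"
  using assms
proof (induction A)
  case (insert x A)
  then obtain V where V: "\<And>a. a \<in> A \<Longrightarrow> open (V a) \<and> a \<in> V a \<and> (\<forall>b\<in>A. a \<noteq> b \<longrightarrow> V a \<inter> V b = {})"
    by blast
  have "\<forall>a\<in>A. \<exists>P Q. open P \<and> open Q \<and> a \<in> P \<and> x \<in> Q \<and> P \<inter> Q = {}"
    using insert hausdorff by metis
  then obtain P Q where PQ: "\<And>a. a \<in> A \<Longrightarrow> open (P a) \<and> open (Q a) \<and> a \<in> P a \<and> x \<in> Q a \<and> P a \<inter> Q a = {}"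
    by metis
  define W where "W a = (if a = x then \<Inter>b\<in>A. Q b else V a \<inter> P a)" for a
  have "\<forall>a\<in>insert x A. open (W a) \<and> a \<in> W a \<and> (\<forall>b\<in>insert x A. a \<noteq> b \<longrightarrow> W a \<inter> W b = {})"
    using V PQ insert(1,2) unfolding W_def by (auto intro!: open_INT) blast+
  then show ?case by blast
qed simp

section \<open>Algebra of arrows and continuity of the structure maps\<close>

locale etale_groupoid =
  fixes G :: "'a::t2_space groupoid_data"
  assumes etale: "locally_compact_etale_groupoid G"
begin

abbreviation rg where "rg \<equiv> grange G"
abbreviation sc where "sc \<equiv> gsource G"
abbreviation mlt (infixl "\<cdot>" 75) where "a \<cdot> b \<equiv> gmult G a b"
abbreviation iv where "iv \<equiv> ginv G"
abbreviation fib where "fib \<equiv> source_fibre G"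

lemma groupoid: "is_groupoid G"
  using etale unfolding locally_compact_etale_groupoid_def topological_groupoid_def by simp

lemma locally_compact: "locally_compact_space (euclidean :: 'a topology)"
  using etale unfolding locally_compact_etale_groupoid_def by simp

lemma rg_rg [simp]: "rg (rg a) = rg a" and sc_rg [simp]: "sc (rg a) = rg a"
  and rg_sc [simp]: "rg (sc a) = sc a" and sc_sc [simp]: "sc (sc a) = sc a"
  and rg_mult [simp]: "sc a = rg b \<Longrightarrow> rg (a \<cdot> b) = rg a"
  and sc_mult [simp]: "sc a = rg b \<Longrightarrow> sc (a \<cdot> b) = sc b"
  and mult_assoc: "sc a = rg b \<Longrightarrow> sc b = rg c \<Longrightarrow> a \<cdot> b \<cdot> c = a \<cdot> (b \<cdot> c)"
  and rg_mult_self [simp]: "rg a \<cdot> a = a" and mult_sc_self [simp]: "a \<cdot> sc a = a"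
  and rg_iv [simp]: "rg (iv a) = sc a" and sc_iv [simp]: "sc (iv a) = rg a"
  and mult_iv [simp]: "a \<cdot> iv a = rg a" and iv_mult [simp]: "iv a \<cdot> a = sc a"
  using groupoid unfolding is_groupoid_def by blast+

lemma mult_iv_cancel: "sc a = rg b \<Longrightarrow> a \<cdot> b \<cdot> iv b = a"
  by (metis mult_assoc mult_iv mult_sc_self rg_iv)

lemma iv_mult_cancel: "sc a = rg b \<Longrightarrow> iv a \<cdot> (a \<cdot> b) = b"
  by (metis mult_assoc iv_mult rg_mult_self sc_iv)

lemma div_mult_cancel: "sc a = sc b \<Longrightarrow> a \<cdot> iv b \<cdot> b = a"
  by (metis mult_assoc iv_mult mult_sc_self rg_iv sc_iv)

lemma iv_iv [simp]: "iv (iv a) = a"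
  by (metis div_mult_cancel iv_mult iv_mult_cancel mult_sc_self rg_iv sc_iv)

lemma iv_distrib: "sc a = rg b \<Longrightarrow> iv (a \<cdot> b) = iv b \<cdot> iv a"
  by (smt (verit) iv_mult_cancel mult_iv_cancel rg_iv rg_mult sc_iv sc_mult)

lemma iv_div [simp]: "sc a = sc b \<Longrightarrow> iv (a \<cdot> iv b) = b \<cdot> iv a"
  by (simp add: iv_distrib)

lemma div_mult_div [simp]: "sc a = sc b \<Longrightarrow> sc b = sc c \<Longrightarrow> a \<cdot> iv b \<cdot> (b \<cdot> iv c) = a \<cdot> iv c"
  by (metis div_mult_cancel mult_assoc rg_iv rg_mult sc_iv sc_mult)

lemma div_inj: "sc a = sc c \<Longrightarrow> sc b = sc c \<Longrightarrow> a \<cdot> iv c = b \<cdot> iv c \<Longrightarrow> a = b"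
  by (metis div_mult_cancel)

lemma unit_iff: "x \<in> units G \<longleftrightarrow> rg x = x" "x \<in> units G \<longleftrightarrow> sc x = x"
  unfolding units_def by (metis rangeE rangeI rg_rg, metis rangeE rangeI rg_sc sc_rg)

lemma rg_unit [simp]: "rg x \<in> units G" and sc_unit [simp]: "sc x \<in> units G"
  by (auto simp: unit_iff)

lemma in_fib [simp]: "a \<in> fib x \<longleftrightarrow> sc a = x"
  unfolding source_fibre_def by simp

text \<open>This makes functions supported on the units act as diagonal matrices.\<close>

lemma div_unit: "sc a = sc b \<Longrightarrow> a \<cdot> iv b \<in> units G \<longleftrightarrow> a = b"
  by (metis div_mult_cancel mult_iv rg_iv rg_mult rg_mult_self rg_unit sc_iv sc_mult unit_iff)

text \<open>Right translation is the change of variable behind the identities between fibre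
  sums.\<close>

lemma fib_right_mult: "bij_betw (\<lambda>b. b \<cdot> c) (fib (rg c)) (fib (sc c))"
  by (rule bij_betwI[where g = "\<lambda>a. a \<cdot> iv c"])
    (auto simp: mult_iv_cancel div_mult_cancel)

lemma cont_iv: "continuous_on S iv"
  using etale unfolding locally_compact_etale_groupoid_def topological_groupoid_def
  by (meson continuous_on_subset top_greatest)

lemma cont_mult:
  assumes "continuous_on S f" "continuous_on S g" "\<And>x. x \<in> S \<Longrightarrow> sc (f x) = rg (g x)"
  shows "continuous_on S (\<lambda>x. f x \<cdot> g x)"
proof -
  have "continuous_on (composable G) (\<lambda>(a, b). a \<cdot> b)"
    using etale unfolding locally_compact_etale_groupoid_def topological_groupoid_def by simp
  then have "continuous_on S (\<lambda>x. (\<lambda>(a, b). a \<cdot> b) (f x, g x))"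
    by (rule continuous_on_compose2) (use assms in \<open>auto simp: composable_def intro!: continuous_on_Pair\<close>)
  then show ?thesis by simp
qed

lemma cont_rg: "continuous_on S rg"
  using cont_mult[of S "\<lambda>x. x" iv] cont_iv by (simp add: continuous_on_id)

lemma cont_sc: "continuous_on S sc"
  using cont_mult[of S iv "\<lambda>x. x"] cont_iv by (simp add: continuous_on_id)

lemmas cont_intros = continuous_intros continuous_on_compose2[OF cont_iv[of UNIV] _ subset_UNIV]
  continuous_on_compose2[OF cont_rg[of UNIV] _ subset_UNIV]
  continuous_on_compose2[OF cont_sc[of UNIV] _ subset_UNIV]

section \<open>Local sections of the source map and finiteness of fibres\<close>

lemma rg_local_section:
  obtains U where "open U" "a \<in> U" "openin (top_of_set (units G)) (rg ` U)"
    "\<exists>g. homeomorphism U (rg ` U) rg g"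
proof -
  have "local_homeomorphism UNIV (units G) rg"
    using etale unfolding locally_compact_etale_groupoid_def by simp
  then have "\<exists>U. open U \<and> a \<in> U \<and> openin (top_of_set (units G)) (rg ` U) \<and>
      (\<exists>g. homeomorphism U (rg ` U) rg g)"
    unfolding local_homeomorphism_def by simp
  then show thesis using that by blast
qed

text \<open>For an arrow \<open>y\<close> near a unit, both \<open>y\<close> and \<open>rg y\<close>
  lie in a set where the range map is injective. They have the same range, so
  \<open>y = rg y\<close>.\<close>

lemma open_units: "open (units G)"
proof (subst open_subopen, rule ballI)
  fix x assume x: "x \<in> units G"
  obtain U g where U: "open U" "x \<in> U" "homeomorphism U (rg ` U) rg g"
    using rg_local_section by metis
  have inj: "y = z" if "y \<in> U" "z \<in> U" "rg y = rg z" for y z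
    using U(3) that unfolding homeomorphism_def by metis
  have "open (U \<inter> rg -` U)"
    using U(1) cont_rg by (intro open_Int open_vimage)
  moreover have "x \<in> U \<inter> rg -` U" using x U by (simp add: unit_iff)
  moreover have "U \<inter> rg -` U \<subseteq> units G"
    using inj by (auto simp: unit_iff)
  ultimately show "\<exists>T. open T \<and> x \<in> T \<and> T \<subseteq> units G" by blast
qed

text \<open>Only the source map is inverted, because all sums run over source fibres; the customary
  notion treats the range map alike. The continuous section \<open>g\<close> is what turns a fibre
  sum locally into a finite sum of continuous functions.\<close>

definition bisection :: "'a set \<Rightarrow> bool" where
  "bisection U \<longleftrightarrow> open U \<and> open (sc ` U) \<and> (\<exists>g. continuous_on (sc ` U) g \<and> (\<forall>a\<in>U. g (sc a) = a))"

lemma bisection_inj: "bisection U \<Longrightarrow> inj_on sc U"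
  unfolding bisection_def by (metis inj_onI)

lemma bisection_open: "bisection U \<Longrightarrow> open U"
  unfolding bisection_def by simp

text \<open>The definition of an etale groupoid speaks of the range map; inversion carries its local
  sections over to the source map.\<close>

lemma ex_bisection: "\<exists>U. bisection U \<and> a \<in> U"
proof -
  obtain V g where V: "open V" "iv a \<in> V" "openin (top_of_set (units G)) (rg ` V)"
    and g: "homeomorphism V (rg ` V) rg g"
    using rg_local_section[of "iv a"] by metis
  define U where "U = iv -` V"
  have "sc ` U = rg ` V"
  proof (intro subset_antisym image_subsetI)
    fix b assume "b \<in> V" 
    then show "rg b \<in> sc ` U" unfolding U_def by (intro image_eqI[of _ _ "iv b"]) auto
  next
    fix b assume "b \<in> U"
    then show "sc b \<in> rg ` V" unfolding U_def by (intro image_eqI[of _ _ "iv b"]) auto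
  qed
  moreover have "open (rg ` V)" using V(3) open_units by (metis openin_open_eq)
  moreover have "continuous_on (rg ` V) (\<lambda>x. iv (g x))"
    using g unfolding homeomorphism_def by (auto intro!: cont_intros)
  moreover have "\<forall>b\<in>U. iv (g (sc b)) = b"
    unfolding U_def using g unfolding homeomorphism_def by (metis iv_iv rg_iv vimageE)
  moreover have "open U"
    unfolding U_def using V(1) cont_iv by (rule open_vimage)
  ultimately have "bisection U" unfolding bisection_def by metis
  moreover have "a \<in> U" using V unfolding U_def by simp
  ultimately show ?thesis by blast
qed

lemma bisection_subset:
  assumes "bisection U" "open V" "V \<subseteq> U"
  shows "bisection V"
proof -
  obtain g where g: "continuous_on (sc ` U) g" "\<forall>a\<in>U. g (sc a) = a" and o: "open (sc ` U)"
    using assms(1) unfolding bisection_def by auto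
  have "sc ` V = sc ` U \<inter> g -` V"
    using g(2) assms(3) by force
  then have "open (sc ` V)"
    using g(1) o assms(2) continuous_on_open_vimage[OF o] by (metis inf_commute)
  moreover have "continuous_on (sc ` V) g"
    using g(1) assms(3) by (meson continuous_on_subset image_mono)
  ultimately show ?thesis using assms g unfolding bisection_def by (metis subsetD)
qed

text \<open>A fibre meets each bisection at most once, so the number of bisections covering
  \<open>C\<close> serves for all fibres. This uniformity in \<open>x\<close> makes every matrix
  estimate below uniform over the unit space.\<close>

lemma compact_fib_card:
  assumes "compact C"
  obtains N :: nat where "\<And>x. finite (fib x \<inter> C)" "\<And>x. card (fib x \<inter> C) \<le> N"
proof -
  obtain U where U: "\<And>a. bisection (U a)" "\<And>a. a \<in> U a"
    using ex_bisection by metis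
  obtain D where D: "D \<subseteq> C" "finite D" "C \<subseteq> (\<Union>x\<in>D. U x)"
    using compactE_image[OF \<open>compact C\<close>, of C U] U bisection_open by blast
  have fin: "finite (fib x \<inter> U a) \<and> card (fib x \<inter> U a) \<le> 1" for x a
  proof -
    have "fib x \<inter> U a \<subseteq> {b}" if "b \<in> fib x \<inter> U a" for b
      using bisection_inj[OF U(1)[of a]] that by (auto dest: inj_onD)
    then have "fib x \<inter> U a = {} \<or> (\<exists>b. fib x \<inter> U a = {b})" by blast
    then show ?thesis by auto
  qed
  have sub: "fib x \<inter> C \<subseteq> (\<Union>a\<in>D. fib x \<inter> U a)" for x using D by auto
  have "finite (fib x \<inter> C)" for x
    using sub finite_subset D(2) fin by (metis (no_types, lifting) finite_UN_I)
  moreover have "card (fib x \<inter> C) \<le> card D" for x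
  proof -
    have "card (fib x \<inter> C) \<le> card (\<Union>a\<in>D. fib x \<inter> U a)"
      by (rule card_mono[OF finite_UN_I]) (use sub D(2) fin in blast)+
    also have "\<dots> \<le> (\<Sum>a\<in>D. card (fib x \<inter> U a))" by (rule card_UN_le[OF D(2)])
    also have "\<dots> \<le> (\<Sum>a\<in>D. 1)" using fin by (intro sum_mono) auto
    finally show ?thesis by simp
  qed
  ultimately show thesis using that by blast
qed

lemma finite_fib: "compact C \<Longrightarrow> finite (fib x \<inter> C)"
  using compact_fib_card by metis

section \<open>Fibre sums and products of compact sets\<close>

lemma infsum_fib:
  fixes h :: "'a \<Rightarrow> 'b::{t2_space,topological_comm_monoid_add}"
  assumes "finite F" "F \<subseteq> fib x" "\<And>a. sc a = x \<Longrightarrow> a \<notin> F \<Longrightarrow> h a = 0"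
  shows "infsum h (fib x) = sum h F"
proof -
  have "infsum h (fib x) = infsum h F"
    by (rule infsum_cong_neutral) (use assms in auto)
  then show ?thesis using assms(1) by simp
qed

lemma infsum_fib_right_mult: "infsum h (fib (sc c)) = infsum (\<lambda>b. h (b \<cdot> c)) (fib (rg c))"
  using infsum_reindex_bij_betw[OF fib_right_mult, of h c] by simp

lemma Cc_fib_sum:
  assumes "f \<in> Cc"
  shows "infsum f (fib x) = sum f (fib x \<inter> supp f)"
  by (rule infsum_fib) (use assms finite_fib Cc_compact supp_outside in auto)

lemma compact_iv: "compact C \<Longrightarrow> compact (iv ` C)"
  using cont_iv compact_continuous_image by blast

lemma compact_set_mult:
  assumes "compact A" "compact B"
  shows "compact (set_mult G A B)"
proof -
  have "closed {p::'a\<times>'a. sc (fst p) = rg (snd p)}"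
    by (rule closed_Collect_eq) (auto intro!: cont_intros)
  then have "compact (A \<times> B \<inter> {p. sc (fst p) = rg (snd p)})"
    using assms by (intro compact_Int_closed compact_Times)
  then have "compact ((\<lambda>p. fst p \<cdot> snd p) ` (A \<times> B \<inter> {p. sc (fst p) = rg (snd p)}))"
    by (rule compact_continuous_image[rotated]) (auto intro!: cont_mult cont_intros)
  moreover have "(\<lambda>p. fst p \<cdot> snd p) ` (A \<times> B \<inter> {p. sc (fst p) = rg (snd p)}) = set_mult G A B"
    unfolding set_mult_def by force
  ultimately show ?thesis by simp
qed

lemma set_multI: "a \<in> A \<Longrightarrow> b \<in> B \<Longrightarrow> sc a = rg b \<Longrightarrow> a \<cdot> b \<in> set_mult G A B"
  unfolding set_mult_def by blast

text \<open>
  Near a given point the fibre sum is a finite sum over local sections of the source map.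
\<close>

lemma cont_fibre_sum:
  fixes F :: "'a \<Rightarrow> 'a \<Rightarrow> complex"
  assumes "compact C"
    and F0: "\<And>c a. sc a = sc c \<Longrightarrow> a \<notin> C \<Longrightarrow> F c a = 0"
    and F: "continuous_on {p. sc (fst p) = sc (snd p)} (\<lambda>p. F (fst p) (snd p))"
  shows "continuous_on UNIV (\<lambda>c. infsum (F c) (fib (sc c)))"
proof (rule continuous_at_imp_continuous_on, rule)
  fix c0 :: 'a
  define A where "A = fib (sc c0) \<inter> C"
  have fA: "finite A" unfolding A_def using assms finite_fib by blast
  obtain U where U: "\<And>a. bisection (U a)" "\<And>a. a \<in> U a"
    using ex_bisection by metis
  have "\<exists>V. \<forall>a\<in>A. open (V a) \<and> a \<in> V a \<and> (\<forall>b\<in>A. a \<noteq> b \<longrightarrow> V a \<inter> V b = {})"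
    by (rule finite_disjoint_neighbourhoods[OF fA])
  then obtain V where V: "\<And>a. a \<in> A \<Longrightarrow> open (V a) \<and> a \<in> V a \<and> (\<forall>b\<in>A. a \<noteq> b \<longrightarrow> V a \<inter> V b = {})"
    by blast
  define B where "B a = U a \<inter> V a" for a
  have B: "bisection (B a)" "a \<in> B a" if "a \<in> A" for a
    using U V[OF that] bisection_subset[OF U(1)[of a], of "U a \<inter> V a"] bisection_open
    unfolding B_def by (auto simp: open_Int)
  have Bdisj: "B a \<inter> B b = {}" if "a \<in> A" "b \<in> A" "a \<noteq> b" for a b
    using V that unfolding B_def by blast
  have "\<forall>a\<in>A. \<exists>g. continuous_on (sc ` B a) g \<and> (\<forall>b\<in>B a. g (sc b) = b)"
    using B unfolding bisection_def by blast
  then obtain g where g: "\<And>a. a \<in> A \<Longrightarrow> continuous_on (sc ` B a) (g a)"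
    "\<And>a b. a \<in> A \<Longrightarrow> b \<in> B a \<Longrightarrow> g a (sc b) = b" by metis
  \<comment> \<open>What remains of \<open>C\<close> outside the chosen bisections is compact and
    misses the fibre of \<open>c0\<close>. Its closed image under \<open>sc\<close> can therefore be
    avoided near \<open>c0\<close>, and there every nonzero term lies on one of the local
    sections.\<close>
  define D where "D = C - (\<Union>a\<in>A. B a)"
  have "compact D" unfolding D_def using assms(1) B bisection_open by (intro compact_diff) auto
  then have "closed (sc ` D)"
    using cont_sc compact_continuous_image compact_imp_closed by blast
  moreover have "sc c0 \<notin> sc ` D" unfolding D_def A_def using B(2) A_def by auto
  ultimately have oW: "open ((\<Inter>a\<in>A. sc ` B a) \<inter> - sc ` D)" 
    using fA B unfolding bisection_def by (intro open_Int open_INT) auto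
  define W where "W = sc -` ((\<Inter>a\<in>A. sc ` B a) \<inter> - sc ` D)"
  have W: "open W" unfolding W_def using oW cont_sc by (rule open_vimage)
  have c0W: "c0 \<in> W" 
    unfolding W_def using \<open>sc c0 \<notin> sc ` D\<close> B(2) by (auto simp: A_def image_iff) metis
  have eq: "infsum (F c) (fib (sc c)) = (\<Sum>a\<in>A. F c (g a (sc c)))" if "c \<in> W" for c
  proof -
    have in_B: "g a (sc c) \<in> B a \<and> sc (g a (sc c)) = sc c" if a: "a \<in> A" for a
    proof -
      obtain b where "b \<in> B a" "sc c = sc b" using \<open>c \<in> W\<close> a unfolding W_def by auto
      then show ?thesis using g(2)[OF a, of b] by simp
    qed
    have inj: "inj_on (\<lambda>a. g a (sc c)) A"
      by (rule inj_onI) (metis in_B Bdisj IntI empty_iff)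
    have "infsum (F c) (fib (sc c)) = sum (F c) ((\<lambda>a. g a (sc c)) ` A)"
    proof (rule infsum_fib)
      fix a assume a: "sc a = sc c" "a \<notin> (\<lambda>a. g a (sc c)) ` A"
      have "a \<notin> C"
      proof
        assume "a \<in> C"
        moreover have "sc a \<notin> sc ` D" using a \<open>c \<in> W\<close> unfolding W_def by auto
        ultimately obtain b where "b \<in> A" "a \<in> B b" unfolding D_def by blast
        then show False using a g(2) by (metis image_eqI)
      qed
      then show "F c a = 0" using F0 a by auto
    qed (use fA in_B in auto)
    also have "\<dots> = (\<Sum>a\<in>A. F c (g a (sc c)))" using inj by (simp add: sum.reindex)
    finally show ?thesis .
  qed
  have "continuous_on W (\<lambda>c. F c (g a (sc c)))" if a: "a \<in> A" for a
  proof -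
    have sub: "sc ` W \<subseteq> sc ` B a" using a unfolding W_def by auto
    have "continuous_on W (\<lambda>c. g a (sc c))"
      by (rule continuous_on_compose2[OF g(1)[OF a] cont_sc sub])
    then have "continuous_on W (\<lambda>c. (c, g a (sc c)))" by (intro continuous_intros)
    moreover have "(\<lambda>c. (c, g a (sc c))) ` W \<subseteq> {p. sc (fst p) = sc (snd p)}"
      using g(2)[OF a] sub by force
    ultimately have "continuous_on W (\<lambda>c. (\<lambda>p. F (fst p) (snd p)) (c, g a (sc c)))"
      using continuous_on_compose2[OF F] by blast
    then show ?thesis by simp
  qed
  then have "continuous_on W (\<lambda>c. \<Sum>a\<in>A. F c (g a (sc c)))" by (intro continuous_intros)
  then have "continuous_on W (\<lambda>c. infsum (F c) (fib (sc c)))"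
    using eq by (simp cong: continuous_on_cong)
  then show "isCont (\<lambda>c. infsum (F c) (fib (sc c))) c0"
    using W c0W continuous_on_eq_continuous_at by blast
qed

end

section \<open>Finite matrices that are small away from a relation\<close>

definition l2n :: "('a \<Rightarrow> complex) \<Rightarrow> 'a set \<Rightarrow> real" where
  "l2n u A = L2_set (\<lambda>x. cmod (u x)) A"

text \<open>Bilinear rather than sesquilinear: only bounds for all \<open>u\<close> and
  \<open>v\<close> matter, and this avoids conjugates.\<close>

definition bform :: "('a \<Rightarrow> 'a \<Rightarrow> complex) \<Rightarrow> 'a set \<Rightarrow> ('a \<Rightarrow> complex) \<Rightarrow> ('a \<Rightarrow> complex) \<Rightarrow> complex" where
  "bform a F u v = (\<Sum>x\<in>F. \<Sum>y\<in>F. u x * a x y * v y)"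

section \<open>Elementary l2 estimates and the Schur test\<close>

lemma l2n_nonneg [simp]: "0 \<le> l2n u A"
  unfolding l2n_def by simp

lemma l2n_sq: "(l2n u A)\<^sup>2 = (\<Sum>x\<in>A. (cmod (u x))\<^sup>2)"
  unfolding l2n_def L2_set_def by (simp add: sum_nonneg)

lemma l2n_le_sqrt: "(\<Sum>x\<in>A. (cmod (u x))\<^sup>2) \<le> C \<Longrightarrow> l2n u A \<le> sqrt C"
  unfolding l2n_def L2_set_def by simp

lemma l2n_mono: "(\<And>x. x \<in> A \<Longrightarrow> cmod (u x) \<le> cmod (v x)) \<Longrightarrow> l2n u A \<le> l2n v A"
  unfolding l2n_def by (rule L2_set_mono) auto

lemma l2n_subset: "finite B \<Longrightarrow> A \<subseteq> B \<Longrightarrow> l2n u A \<le> l2n u B"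
  unfolding l2n_def L2_set_def by (simp add: sum_mono2)

lemma l2n_cong: "(\<And>x. x \<in> A \<Longrightarrow> u x = v x) \<Longrightarrow> l2n u A = l2n v A"
  unfolding l2n_def by (rule L2_set_cong) auto

lemma l2n_triangle: "l2n (\<lambda>x. u x + v x) A \<le> l2n u A + l2n v A"
proof -
  have "l2n (\<lambda>x. u x + v x) A \<le> L2_set (\<lambda>x. cmod (u x) + cmod (v x)) A"
    unfolding l2n_def by (rule L2_set_mono) (auto intro: norm_triangle_ineq)
  also have "\<dots> \<le> l2n u A + l2n v A" unfolding l2n_def by (rule L2_set_triangle_ineq)
  finally show ?thesis .
qed

lemma l2n_scale: "l2n (\<lambda>x. c * u x) A = cmod c * l2n u A"
  unfolding l2n_def by (simp add: norm_mult L2_set_right_distrib)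

lemma l2n_cauchy_schwarz: "(\<Sum>x\<in>A. cmod (u x) * cmod (v x)) \<le> l2n u A * l2n v A"
  using L2_set_mult_ineq[of "\<lambda>x. cmod (u x)" "\<lambda>x. cmod (v x)" A] unfolding l2n_def by simp

lemma l2n_cauchy_schwarz_sum: "cmod (\<Sum>x\<in>A. u x * v x) \<le> l2n u A * l2n v A"
proof -
  have "cmod (\<Sum>x\<in>A. u x * v x) \<le> (\<Sum>x\<in>A. cmod (u x) * cmod (v x))"
    by (rule order_trans[OF norm_sum]) (simp add: norm_mult)
  then show ?thesis using l2n_cauchy_schwarz order_trans by blast
qed

lemma bform_add_left: "bform a F (\<lambda>x. u x + u' x) v = bform a F u v + bform a F u' v"
  and bform_add_right: "bform a F u (\<lambda>x. v x + v' x) = bform a F u v + bform a F u v'"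
  unfolding bform_def by (simp_all add: algebra_simps sum.distrib)

text \<open>Cauchy-Schwarz on the set \<open>P\<close> of related pairs: each row and each column
  occurs at most \<open>N\<close> times, which costs \<open>sqrt N\<close> for either
  vector.\<close>

lemma schur_bound:
  assumes "finite A" "finite B"
    and 1: "\<And>x. x \<in> A \<Longrightarrow> card {y\<in>B. S x y} \<le> N" and 2: "\<And>y. y \<in> B \<Longrightarrow> card {x\<in>A. S x y} \<le> N"
  shows "(\<Sum>x\<in>A. \<Sum>y\<in>B. of_bool (S x y) * (cmod (u x) * cmod (v y))) \<le> real N * (l2n u A * l2n v B)"
proof -
  define P where "P = {p \<in> A \<times> B. S (fst p) (snd p)}"
  have eq1: "(\<Sum>x\<in>A. \<Sum>y\<in>B. of_bool (S x y) * h x y) = (\<Sum>p\<in>P. h (fst p) (snd p))"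
    for h :: "_ \<Rightarrow> _ \<Rightarrow> real"
    unfolding sum.cartesian_product using assms(1,2)
    by (intro sum.mono_neutral_cong_right) (auto simp: P_def)
  have "(\<Sum>x\<in>A. \<Sum>y\<in>B. of_bool (S x y) * (cmod (u x) * cmod (v y))) =
      (\<Sum>p\<in>P. cmod (u (fst p)) * cmod (v (snd p)))"
    by (rule eq1)
  also have "\<dots> \<le> l2n (\<lambda>p. u (fst p)) P * l2n (\<lambda>p. v (snd p)) P"
    by (rule l2n_cauchy_schwarz)
  finally have *: "(\<Sum>x\<in>A. \<Sum>y\<in>B. of_bool (S x y) * (cmod (u x) * cmod (v y))) \<le> l2n (\<lambda>p. u (fst p)) P * l2n (\<lambda>p. v (snd p)) P" .
  have u: "l2n (\<lambda>p. u (fst p)) P \<le> sqrt (real N) * l2n u A"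
  proof -
    have "(\<Sum>p\<in>P. (cmod (u (fst p)))\<^sup>2) = (\<Sum>x\<in>A. \<Sum>y\<in>B. of_bool (S x y) * (cmod (u x))\<^sup>2)"
      by (rule eq1[symmetric])
    also have "\<dots> = (\<Sum>x\<in>A. real (card {y\<in>B. S x y}) * (cmod (u x))\<^sup>2)"
      using assms(2) by (intro sum.cong refl) (simp flip: sum_distrib_right add: Int_def)
    also have "\<dots> \<le> (\<Sum>x\<in>A. real N * (cmod (u x))\<^sup>2)"
      using 1 by (intro sum_mono mult_right_mono) auto
    also have "\<dots> = real N * (l2n u A)\<^sup>2" by (simp add: l2n_sq sum_distrib_left)
    finally show ?thesis using l2n_le_sqrt by (fastforce simp: real_sqrt_mult)
  qed
  have v: "l2n (\<lambda>p. v (snd p)) P \<le> sqrt (real N) * l2n v B"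
  proof -
    have "(\<Sum>p\<in>P. (cmod (v (snd p)))\<^sup>2) = (\<Sum>x\<in>A. \<Sum>y\<in>B. of_bool (S x y) * (cmod (v y))\<^sup>2)"
      by (rule eq1[symmetric])
    also have "\<dots> = (\<Sum>y\<in>B. \<Sum>x\<in>A. of_bool (S x y) * (cmod (v y))\<^sup>2)"
      by (rule sum.swap)
    also have "\<dots> = (\<Sum>y\<in>B. real (card {x\<in>A. S x y}) * (cmod (v y))\<^sup>2)"
      using assms(1) by (intro sum.cong refl) (simp flip: sum_distrib_right add: Int_def)
    also have "\<dots> \<le> (\<Sum>y\<in>B. real N * (cmod (v y))\<^sup>2)"
      using 2 by (intro sum_mono mult_right_mono) auto
    also have "\<dots> = real N * (l2n v B)\<^sup>2" by (simp add: l2n_sq sum_distrib_left)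
    finally show ?thesis using l2n_le_sqrt by (fastforce simp: real_sqrt_mult)
  qed
  have "l2n (\<lambda>p. u (fst p)) P * l2n (\<lambda>p. v (snd p)) P \<le> (sqrt (real N) * l2n u A) * (sqrt (real N) * l2n v B)"
    by (rule mult_mono[OF u v]) auto
  also have "\<dots> = (sqrt (real N) * sqrt (real N)) * (l2n u A * l2n v B)" by (simp only: mult_ac)
  finally show ?thesis using * by simp
qed

text \<open>Greedy peeling. A set \<open>E\<close> from \<open>ex\<close> is removed and those of
  its points related to the rest are discarded; by symmetry of \<open>R\<close> nothing kept in
  \<open>E\<close> is related to what follows. The successive sets \<open>E\<close> are disjoint, so
  their losses \<open>c * sum w E\<close> add up to at most \<open>c * sum w F\<close>.\<close>

lemma sparsification:
  fixes w :: "'a \<Rightarrow> real"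
  assumes "finite F" "0 \<le> c" and w: "\<And>x. 0 \<le> w x"
    and sym: "\<And>x y. R x y \<Longrightarrow> R y x"
    and ex: "\<And>F'. F' \<subseteq> F \<Longrightarrow> 0 < sum w F' \<Longrightarrow>
      \<exists>E\<subseteq>F'. E \<noteq> {} \<and> (\<forall>x\<in>E. \<forall>y\<in>E. Q x y) \<and> sum w {x\<in>E. \<exists>y\<in>F'-E. R x y} \<le> c * sum w E"
  shows "\<exists>O' l. O' \<subseteq> F \<and> (\<forall>x\<in>O'. \<forall>y\<in>O'. R x y \<longrightarrow> l x = (l y::nat)) \<and>
    (\<forall>x\<in>O'. \<forall>y\<in>O'. l x = l y \<longrightarrow> Q x y) \<and> sum w (F - O') \<le> c * sum w F"
  using assms(1) ex
proof (induction F rule: finite_psubset_induct)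
  case (psubset F)
  show ?case
  proof (cases "sum w F > 0")
    case False
    then have "sum w F = 0" using w by (simp add: sum_nonneg order.antisym not_less)
    then show ?thesis by (intro exI[of _ "{}"]) auto
  next
    case True
    then obtain E where E: "E \<subseteq> F" "E \<noteq> {}" "\<And>x y. x \<in> E \<Longrightarrow> y \<in> E \<Longrightarrow> Q x y"
      and Ew: "sum w {x\<in>E. \<exists>y\<in>F-E. R x y} \<le> c * sum w E"
      using psubset.prems[of F] by blast
    have sub: "F - E \<subset> F" using E by auto
    have "\<exists>O' l. O' \<subseteq> F - E \<and> (\<forall>x\<in>O'. \<forall>y\<in>O'. R x y \<longrightarrow> l x = (l y::nat)) \<and>
        (\<forall>x\<in>O'. \<forall>y\<in>O'. l x = l y \<longrightarrow> Q x y) \<and> sum w (F - E - O') \<le> c * sum w (F - E)"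
    proof (rule psubset.IH[OF sub])
      fix F' assume "F' \<subseteq> F - E" "0 < sum w F'"
      then show "\<exists>E\<subseteq>F'. E \<noteq> {} \<and> (\<forall>x\<in>E. \<forall>y\<in>E. Q x y) \<and> sum w {x\<in>E. \<exists>y\<in>F'-E. R x y} \<le> c * sum w E"
        by (intro psubset.prems) auto
    qed
    then obtain W l where W: "W \<subseteq> F - E" "\<forall>x\<in>W. \<forall>y\<in>W. R x y \<longrightarrow> l x = (l y::nat)"
      "\<forall>x\<in>W. \<forall>y\<in>W. l x = l y \<longrightarrow> Q x y" and Ww: "sum w (F - E - W) \<le> c * sum w (F - E)"
      by (elim exE conjE) (rule that)
    define D where "D = {x\<in>E. \<exists>y\<in>F-E. R x y}"
    define V where "V = (E - D) \<union> W"
    \<comment> \<open>The label 0 is new, as all labels from the remainder are shifted by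
      one.\<close>
    define m where "m x = (if x \<in> E then 0 else Suc (l x))" for x
    have "V \<subseteq> F" unfolding V_def using E W by auto
    moreover have "m x = m y" if "x \<in> V" "y \<in> V" "R x y" for x y
      using that W sym[of x y] unfolding V_def D_def m_def by auto
    moreover have "Q x y" if "x \<in> V" "y \<in> V" "m x = m y" for x y
      using that W E(3) unfolding V_def D_def m_def by (auto split: if_splits)
    moreover have "sum w (F - V) \<le> c * sum w F"
    proof -
      have "F - V = D \<union> (F - E - W)" unfolding V_def D_def using E W(1) by auto
      moreover have "finite D" "D \<inter> (F - E - W) = {}"
        using psubset.hyps E(1) unfolding D_def by (auto intro: finite_subset)
      ultimately have "sum w (F - V) = sum w D + sum w (F - E - W)"
        using psubset.hyps by (simp add: sum.union_disjoint)
      also have "\<dots> \<le> c * (sum w E + sum w (F - E))"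
        using Ew Ww unfolding D_def by (simp add: algebra_simps)
      also have "sum w E + sum w (F - E) = sum w F"
        using E(1) psubset.hyps by (metis add.commute sum.subset_diff)
      finally show ?thesis .
    qed
    ultimately show ?thesis by (intro exI[of _ V] exI[of _ m] conjI ballI impI)
  qed
qed

text \<open>Membership is prescribed for \<open>i\<close> and for \<open>j\<close> and free
  elsewhere, so two binary choices are fixed.\<close>

lemma card_separating_subsets:
  assumes "finite L" "i \<in> L" "j \<in> L" "i \<noteq> j"
  shows "4 * card {A \<in> Pow L. i \<in> A \<and> j \<notin> A} = card (Pow L)"
proof -
  have eq: "{A \<in> Pow L. i \<in> A \<and> j \<notin> A} = insert i ` Pow (L - {i, j})"
  proof (intro subset_antisym subsetI)
    fix A assume "A \<in> {A \<in> Pow L. i \<in> A \<and> j \<notin> A}"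
    then have "A = insert i (A - {i})" "A - {i} \<in> Pow (L - {i, j})" by auto
    then show "A \<in> insert i ` Pow (L - {i, j})" by blast
  qed (use assms in auto)
  have "inj_on (insert i) (Pow (L - {i, j}))"
    by (auto simp: inj_on_def)
  then have "card {A \<in> Pow L. i \<in> A \<and> j \<notin> A} = 2 ^ card (L - {i, j})"
    unfolding eq using assms(1) by (simp add: card_image card_Pow)
  moreover have "card L = card (L - {i, j}) + 2"
    using assms card_mono[of L "{i, j}"] by (simp add: card_Diff_subset)
  ultimately show ?thesis using assms(1) by (simp add: card_Pow power_add)
qed

text \<open>
  The off-diagonal blocks are four times the average, over all subsets \<open>A\<close> of the labels, of the
  corners cut out by \<open>A\<close> and its complement. This bound does not depend on the number of labels.
\<close>

lemma off_diagonal_blocks: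
  fixes p q :: "'a \<Rightarrow> nat"
  assumes "finite F"
    and bd: "\<And>A. cmod (bform a F (\<lambda>x. of_bool (p x \<in> A) * u x) (\<lambda>y. of_bool (q y \<notin> A) * v y)) \<le> C"
  shows "cmod (\<Sum>x\<in>F. \<Sum>y\<in>F. of_bool (p x \<noteq> q y) * (u x * a x y * v y)) \<le> 4 * C"
proof -
  define L where "L = p ` F \<union> q ` F"
  have L: "finite L" "\<And>x. x \<in> F \<Longrightarrow> p x \<in> L" "\<And>x. x \<in> F \<Longrightarrow> q x \<in> L"
    unfolding L_def using assms by auto
  define S where "S = (\<Sum>x\<in>F. \<Sum>y\<in>F. of_bool (p x \<noteq> q y) * (u x * a x y * v y))"
  have "4 * (\<Sum>A\<in>Pow L. bform a F (\<lambda>x. of_bool (p x \<in> A) * u x) (\<lambda>y. of_bool (q y \<notin> A) * v y)) =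
      4 * (\<Sum>x\<in>F. \<Sum>y\<in>F. \<Sum>A\<in>Pow L. of_bool (p x \<in> A \<and> q y \<notin> A) * (u x * a x y * v y))"
    unfolding bform_def
    by (subst sum.swap, rule arg_cong[where f = "\<lambda>z. 4 * z"], rule sum.cong[OF refl], subst sum.swap)
      (auto intro!: sum.cong simp: of_bool_def)
  also have "\<dots> = (\<Sum>x\<in>F. \<Sum>y\<in>F. 4 * of_nat (card {A\<in>Pow L. p x \<in> A \<and> q y \<notin> A}) * (u x * a x y * v y))"
    using L(1) by (simp add: sum_distrib_left sum_distrib_right[symmetric] mult.assoc Int_def)
  also have "\<dots> = (\<Sum>x\<in>F. \<Sum>y\<in>F. of_nat (card (Pow L)) * (of_bool (p x \<noteq> q y) * (u x * a x y * v y)))"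
  proof (intro sum.cong refl)
    fix x y assume xy: "x \<in> F" "y \<in> F"
    \<comment> \<open>For equal labels both sides vanish; for different ones exactly a quarter of
      the subsets separate them in the required order.\<close>
    have "4 * complex_of_nat (card {A\<in>Pow L. p x \<in> A \<and> q y \<notin> A}) = of_nat (card (Pow L)) * of_bool (p x \<noteq> q y)"
    proof (cases "p x = q y")
      case False
      have "4 * complex_of_nat (card {A\<in>Pow L. p x \<in> A \<and> q y \<notin> A}) = of_nat (4 * card {A\<in>Pow L. p x \<in> A \<and> q y \<notin> A})"
        by simp
      then show ?thesis
        using card_separating_subsets[OF L(1) L(2)[OF xy(1)] L(3)[OF xy(2)] False] False
        by (simp only:) simp
    qed simp
    then show "4 * of_nat (card {A\<in>Pow L. p x \<in> A \<and> q y \<notin> A}) * (u x * a x y * v y) =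
      of_nat (card (Pow L)) * (of_bool (p x \<noteq> q y) * (u x * a x y * v y))"
      by (simp add: mult.assoc)
  qed
  also have "\<dots> = of_nat (card (Pow L)) * S" unfolding S_def by (simp add: sum_distrib_left)
  finally have "cmod (4 * (\<Sum>A\<in>Pow L. bform a F (\<lambda>x. of_bool (p x \<in> A) * u x) (\<lambda>y. of_bool (q y \<notin> A) * v y)))
      = cmod (of_nat (card (Pow L)) * S)" by (rule arg_cong)
  then have "real (card (Pow L)) * cmod S =
      4 * cmod (\<Sum>A\<in>Pow L. bform a F (\<lambda>x. of_bool (p x \<in> A) * u x) (\<lambda>y. of_bool (q y \<notin> A) * v y))"
    unfolding norm_mult by simp
  also have "\<dots> \<le> 4 * (real (card (Pow L)) * C)"
    by (rule mult_left_mono, rule order_trans[OF norm_sum], rule sum_bounded_above) (auto intro: bd)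
  finally have "real (card (Pow L)) * cmod S \<le> real (card (Pow L)) * (4 * C)" by simp
  moreover have "card (Pow L) > 0" using L(1) by (simp add: card_Pow)
  ultimately show ?thesis unfolding S_def by simp
qed

text \<open>
  The clusters of \<open>O'\<close>, given by the labels \<open>l\<close>, are far apart. The four contributions come from
  \<open>u\<close> outside \<open>O'\<close>, from \<open>v\<close> far from \<open>O'\<close>, from pairs with different labels, and from pairs with
  equal labels.
\<close>

lemma localised_bound:
  fixes a :: "'a \<Rightarrow> 'a \<Rightarrow> complex"
  assumes fin: "finite F"
    and nonneg: "0 \<le> M" "0 \<le> d" "0 \<le> t"
    and bdd: "\<And>u v. cmod (bform a F u v) \<le> M * (l2n u F * l2n v F)"
    and ql: "\<And>u v. (\<And>x y. x \<in> F \<Longrightarrow> y \<in> F \<Longrightarrow> u x \<noteq> 0 \<Longrightarrow> v y \<noteq> 0 \<Longrightarrow> \<not> R x y) \<Longrightarrow>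
        cmod (bform a F u v) \<le> d * (l2n u F * l2n v F)"
    and sym: "\<And>x y. R x y \<Longrightarrow> R y x"
    and sparse: "O' \<subseteq> F" "\<And>x y z. x \<in> O' \<Longrightarrow> y \<in> O' \<Longrightarrow> z \<in> F \<Longrightarrow> R x z \<Longrightarrow> R z y \<Longrightarrow> l x = (l y::nat)"
      "\<And>x y. x \<in> O' \<Longrightarrow> y \<in> O' \<Longrightarrow> l x = l y \<Longrightarrow> Q x y"
      "sum (\<lambda>x. (cmod (u x))\<^sup>2) (F - O') \<le> c * sum (\<lambda>x. (cmod (u x))\<^sup>2) F"
    and small: "\<And>x y z. x \<in> F \<Longrightarrow> y \<in> F \<Longrightarrow> z \<in> F \<Longrightarrow> Q x z \<Longrightarrow> R z y \<Longrightarrow> S x y"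
      "\<And>x y. x \<in> F \<Longrightarrow> y \<in> F \<Longrightarrow> S x y \<Longrightarrow> cmod (a x y) \<le> t"
    and N: "\<And>x. x \<in> F \<Longrightarrow> card {y\<in>F. S x y} \<le> N" "\<And>y. y \<in> F \<Longrightarrow> card {x\<in>F. S x y} \<le> N"
  shows "cmod (bform a F u v) \<le> (M * sqrt c + 5 * d + t * N) * (l2n u F * l2n v F)"
proof -
  define B where "B = l2n u F * l2n v F"
  have B0: "0 \<le> B" unfolding B_def by simp
  define N' where "N' = {y\<in>F. \<exists>x\<in>O'. R x y}"
  \<comment> \<open>The label of a point of \<open>O'\<close> near \<open>y\<close>. The choice is
    immaterial: two points of \<open>O'\<close> with a common neighbour have equal labels by
    \<open>sparse(2)\<close>.\<close>
  define m where "m y = l (SOME x. x \<in> O' \<and> R x y)" for y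
  have m: "m y = l x" if "x \<in> O'" "R x y" "y \<in> F" for x y
  proof -
    have "(SOME x. x \<in> O' \<and> R x y) \<in> O' \<and> R (SOME x. x \<in> O' \<and> R x y) y"
      by (rule someI[of _ x]) (use that in auto)
    then show ?thesis unfolding m_def using sparse(2) sym that by blast
  qed
  define u1 where "u1 x = of_bool (x \<in> O') * u x" for x
  define u2 where "u2 x = of_bool (x \<notin> O') * u x" for x
  define v1 where "v1 x = of_bool (x \<in> N') * v x" for x
  define v2 where "v2 x = of_bool (x \<notin> N') * v x" for x
  have le: "l2n (\<lambda>x. of_bool (P x) * w x) F \<le> l2n w F" for P and w :: "'a \<Rightarrow> complex"
    by (rule l2n_mono) (auto simp: norm_mult)
  have u1: "l2n u1 F \<le> l2n u F" and v1: "l2n v1 F \<le> l2n v F" and v2: "l2n v2 F \<le> l2n v F"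
    unfolding u1_def v1_def v2_def by (rule le)+
  have "u = (\<lambda>x. u2 x + u1 x)" "v = (\<lambda>x. v2 x + v1 x)"
    unfolding u1_def u2_def v1_def v2_def by auto
  then have "bform a F u v = bform a F u2 v + bform a F u1 v" "bform a F u1 v = bform a F u1 v2 + bform a F u1 v1"
    by (metis bform_add_left, metis bform_add_right)
  then have split: "bform a F u v = bform a F u2 v + bform a F u1 v2 + bform a F u1 v1" by simp
  have "l2n u2 F \<le> sqrt c * l2n u F"
  proof -
    have "(\<Sum>x\<in>F. (cmod (u2 x))\<^sup>2) = (\<Sum>x\<in>F - O'. (cmod (u x))\<^sup>2)"
      using fin by (intro sum.mono_neutral_cong_right) (auto simp: u2_def)
    then have "(\<Sum>x\<in>F. (cmod (u2 x))\<^sup>2) \<le> c * (l2n u F)\<^sup>2" using sparse(4) by (simp add: l2n_sq)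
    then show ?thesis using l2n_le_sqrt by (fastforce simp: real_sqrt_mult)
  qed
  then have "M * (l2n u2 F * l2n v F) \<le> M * (sqrt c * l2n u F * l2n v F)"
    using nonneg by (intro mult_left_mono mult_right_mono) auto
  then have b1: "cmod (bform a F u2 v) \<le> M * sqrt c * B"
    unfolding B_def using bdd[of u2 v] by (simp add: mult.assoc)
  have "d * (l2n u1 F * l2n v2 F) \<le> d * B"
    unfolding B_def using u1 v2 nonneg by (intro mult_left_mono mult_mono) auto
  moreover have "cmod (bform a F u1 v2) \<le> d * (l2n u1 F * l2n v2 F)"
    by (rule ql) (auto simp: u1_def v2_def N'_def)
  ultimately have b2: "cmod (bform a F u1 v2) \<le> d * B" by linarith
  have b3: "cmod (\<Sum>x\<in>F. \<Sum>y\<in>F. of_bool (l x \<noteq> m y) * (u1 x * a x y * v1 y)) \<le> 4 * (d * B)"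
  proof (rule off_diagonal_blocks[OF fin])
    fix A
    let ?u = "\<lambda>x. of_bool (l x \<in> A) * u1 x" and ?v = "\<lambda>y. of_bool (m y \<notin> A) * v1 y"
    \<comment> \<open>If \<open>x\<close> in \<open>O'\<close> and \<open>y\<close> are related then
      \<open>m y = l x\<close>, so a set of labels and its complement separate the two
      vectors.\<close>
    have "cmod (bform a F ?u ?v) \<le> d * (l2n ?u F * l2n ?v F)"
      by (rule ql) (use m in \<open>auto simp: u1_def v1_def\<close>)
    also have "\<dots> \<le> d * B"
      unfolding B_def using nonneg
      by (intro mult_left_mono mult_mono order_trans[OF le u1] order_trans[OF le v1]) auto
    finally show "cmod (bform a F ?u ?v) \<le> d * B" .
  qed
  have b4: "cmod (\<Sum>x\<in>F. \<Sum>y\<in>F. of_bool (l x = m y) * (u1 x * a x y * v1 y)) \<le> t * N * B"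
  proof -
    have "cmod (\<Sum>x\<in>F. \<Sum>y\<in>F. of_bool (l x = m y) * (u1 x * a x y * v1 y)) \<le>
        (\<Sum>x\<in>F. \<Sum>y\<in>F. cmod (of_bool (l x = m y) * (u1 x * a x y * v1 y)))"
      by (intro order_trans[OF norm_sum] sum_mono norm_sum)
    also have "\<dots> \<le> (\<Sum>x\<in>F. \<Sum>y\<in>F. t * (of_bool (S x y) * (cmod (u x) * cmod (v y))))"
    proof (intro sum_mono)
      fix x y assume xy: "x \<in> F" "y \<in> F"
      show "cmod (of_bool (l x = m y) * (u1 x * a x y * v1 y)) \<le> t * (of_bool (S x y) * (cmod (u x) * cmod (v y)))"
      proof (cases "l x = m y \<and> x \<in> O' \<and> y \<in> N'")
        case True
        \<comment> \<open>\<open>z\<close> is a point of \<open>O'\<close> related to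
          \<open>y\<close>, so its label is \<open>m y\<close>. It lies in the cluster of
          \<open>x\<close>, and one further step of \<open>R\<close> leads to \<open>y\<close>,
          whence \<open>S x y\<close>.\<close>
        then obtain z where z: "z \<in> O'" "R z y" unfolding N'_def by auto
        then have "Q x z" using m sparse(3) True xy by metis
        then have S: "S x y" using small(1) xy z sparse(1) by blast
        have "cmod (a x y) * (cmod (u x) * cmod (v y)) \<le> t * (cmod (u x) * cmod (v y))"
          by (rule mult_right_mono) (use small(2) xy S in auto)
        then show ?thesis using True S by (simp add: u1_def v1_def norm_mult mult_ac)
      next
        case False
        then have zero: "of_bool (l x = m y) * (u1 x * a x y * v1 y) = 0" by (auto simp: u1_def v1_def)
        show ?thesis unfolding zero using nonneg by simp
      qed
    qed
    also have "\<dots> = t * (\<Sum>x\<in>F. \<Sum>y\<in>F. of_bool (S x y) * (cmod (u x) * cmod (v y)))"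
      by (simp add: sum_distrib_left)
    also have "\<dots> \<le> t * (N * B)" unfolding B_def
      by (rule mult_left_mono[OF schur_bound]) (use fin N nonneg in auto)
    finally show ?thesis by simp
  qed
  have "bform a F u1 v1 = (\<Sum>x\<in>F. \<Sum>y\<in>F. of_bool (l x \<noteq> m y) * (u1 x * a x y * v1 y)) +
      (\<Sum>x\<in>F. \<Sum>y\<in>F. of_bool (l x = m y) * (u1 x * a x y * v1 y))"
    unfolding bform_def by (simp flip: sum.distrib) (intro sum.cong refl, auto)
  then have "cmod (bform a F u1 v1) \<le> 4 * (d * B) + t * N * B"
    using b3 b4 by (simp only:) (intro norm_triangle_le add_mono)
  then have "cmod (bform a F u v) \<le> M * sqrt c * B + d * B + (4 * (d * B) + t * N * B)"
    unfolding split using b1 b2 by (intro norm_triangle_le add_mono) auto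
  also have "\<dots> = (M * sqrt c + 5 * d + t * N) * B" by (simp add: algebra_simps)
  finally show ?thesis unfolding B_def .
qed

section \<open>The Hilbert module\<close>

context etale_groupoid
begin

section \<open>Norms through finite subsets of fibres\<close>

abbreviation nrm where "nrm \<equiv> L2_norm G"
abbreviation inn where "inn \<equiv> L2_inner G"

lemma units_nonempty: "units G \<noteq> {}"
  unfolding units_def by simp

lemma inn_self: "inn \<xi> \<xi> x = of_real (\<Sum>\<^sub>\<infinity>a\<in>fib x. (cmod (\<xi> a))\<^sup>2)"
proof -
  have eq: "cnj (\<xi> a) * \<xi> a = complex_of_real ((cmod (\<xi> a))\<^sup>2)" for a
    using complex_norm_square[of "\<xi> a"] by (simp add: mult.commute)
  show ?thesis
  proof (cases "(\<lambda>a. (cmod (\<xi> a))\<^sup>2) summable_on fib x")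
    case True
    then show ?thesis unfolding L2_inner_def eq
      by (metis has_sum_infsum has_sum_of_real infsumI)
  next
    \<comment> \<open>Both infinite sums then have the default value 0.\<close>
    case False
    moreover have "\<not> (\<lambda>a. complex_of_real ((cmod (\<xi> a))\<^sup>2)) summable_on fib x"
      using False summable_on_Re by fastforce
    ultimately show ?thesis unfolding L2_inner_def eq by (simp add: infsum_not_exists)
  qed
qed

lemma nrm_eq: "nrm \<xi> = sqrt (SUP x\<in>units G. \<Sum>\<^sub>\<infinity>a\<in>fib x. (cmod (\<xi> a))\<^sup>2)"
  unfolding L2_norm_def inn_self by (simp add: infsum_nonneg)

lemma infsum_le_nrm:
  assumes "\<xi> \<in> fibrewise_l2 G" "x \<in> units G"
  shows "(\<Sum>\<^sub>\<infinity>a\<in>fib x. (cmod (\<xi> a))\<^sup>2) \<le> (nrm \<xi>)\<^sup>2"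
proof -
  have *: "(\<Sum>\<^sub>\<infinity>a\<in>fib x. (cmod (\<xi> a))\<^sup>2) \<le> (SUP x\<in>units G. \<Sum>\<^sub>\<infinity>a\<in>fib x. (cmod (\<xi> a))\<^sup>2)"
    using assms unfolding fibrewise_l2_def by (intro cSUP_upper) auto
  moreover have "0 \<le> (\<Sum>\<^sub>\<infinity>a\<in>fib x. (cmod (\<xi> a))\<^sup>2)" by (simp add: infsum_nonneg)
  ultimately show ?thesis unfolding nrm_eq by simp
qed

lemma nrm_nonneg: "\<xi> \<in> fibrewise_l2 G \<Longrightarrow> 0 \<le> nrm \<xi>"
proof -
  assume a: "\<xi> \<in> fibrewise_l2 G"
  obtain x where x: "x \<in> units G" using units_nonempty by auto
  have "0 \<le> (\<Sum>\<^sub>\<infinity>a\<in>fib x. (cmod (\<xi> a))\<^sup>2)" by (simp add: infsum_nonneg)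
  also have "\<dots> \<le> (SUP x\<in>units G. \<Sum>\<^sub>\<infinity>a\<in>fib x. (cmod (\<xi> a))\<^sup>2)"
    using a x unfolding fibrewise_l2_def by (intro cSUP_upper) auto
  finally show "0 \<le> nrm \<xi>" unfolding nrm_eq by simp
qed

lemma l2n_le_nrm:
  assumes "\<xi> \<in> fibrewise_l2 G" "finite F" "F \<subseteq> fib x"
  shows "l2n \<xi> F \<le> nrm \<xi>"
proof (cases "F = {}")
  case True
  then show ?thesis using nrm_nonneg[OF assms(1)] by (simp add: l2n_def)
next
  case False
  then obtain a where "a \<in> F" by blast
  then have "sc a = x" using assms(3) in_fib by blast
  then have x: "x \<in> units G" using sc_unit by blast
  have "(l2n \<xi> F)\<^sup>2 \<le> (\<Sum>\<^sub>\<infinity>a\<in>fib x. (cmod (\<xi> a))\<^sup>2)"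
    unfolding l2n_sq using assms x unfolding fibrewise_l2_def
    by (intro finite_sum_le_infsum) auto
  also have "\<dots> \<le> (nrm \<xi>)\<^sup>2" using infsum_le_nrm assms x by blast
  finally show ?thesis using nrm_nonneg[OF assms(1)] power2_le_imp_le by blast
qed

text \<open>This is where an estimate for finite matrices becomes one for operators: membership and
  norm are both read off from finite subsets of fibres. The empty set already forces
  \<open>C\<close> to be nonnegative.\<close>

lemma nrm_bound:
  assumes "\<And>x F. finite F \<Longrightarrow> F \<subseteq> fib x \<Longrightarrow> l2n \<xi> F \<le> C"
  shows "\<xi> \<in> fibrewise_l2 G" "nrm \<xi> \<le> C"
proof -
  have C: "0 \<le> C" using assms[of "{}"] by (simp add: l2n_def)
  have le: "(\<Sum>a\<in>F. (cmod (\<xi> a))\<^sup>2) \<le> C\<^sup>2" if "finite F" "F \<subseteq> fib x" for F x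
    using assms[OF that] power_mono[of "l2n \<xi> F" C 2] by (simp add: l2n_sq)
  have s: "(\<lambda>a. (cmod (\<xi> a))\<^sup>2) summable_on fib x" for x
    by (rule nonneg_bdd_above_summable_on) (use le in \<open>auto intro!: bdd_aboveI[of _ "C\<^sup>2"]\<close>)
  have i: "(\<Sum>\<^sub>\<infinity>a\<in>fib x. (cmod (\<xi> a))\<^sup>2) \<le> C\<^sup>2" for x
    using infsum_le_finite_sums[OF s] le by blast
  show "\<xi> \<in> fibrewise_l2 G" unfolding fibrewise_l2_def
    using s i by (auto intro!: bdd_aboveI[of _ "C\<^sup>2"])
  have "(SUP x\<in>units G. \<Sum>\<^sub>\<infinity>a\<in>fib x. (cmod (\<xi> a))\<^sup>2) \<le> C\<^sup>2"
    using i units_nonempty by (intro cSUP_least)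
  then have "nrm \<xi> \<le> sqrt (C\<^sup>2)" unfolding nrm_eq by (rule real_sqrt_le_mono)
  then show "nrm \<xi> \<le> C" using C by simp
qed

lemma cmod_le_nrm: "\<xi> \<in> fibrewise_l2 G \<Longrightarrow> cmod (\<xi> a) \<le> nrm \<xi>"
  using l2n_le_nrm[of \<xi> "{a}" "sc a"] by (simp add: l2n_def)

lemma fl2_add:
  assumes "\<xi> \<in> fibrewise_l2 G" "\<eta> \<in> fibrewise_l2 G"
  shows "(\<lambda>a. \<xi> a + \<eta> a) \<in> fibrewise_l2 G" "nrm (\<lambda>a. \<xi> a + \<eta> a) \<le> nrm \<xi> + nrm \<eta>"
proof -
  have le: "l2n (\<lambda>a. \<xi> a + \<eta> a) F \<le> nrm \<xi> + nrm \<eta>" if "finite F" "F \<subseteq> fib x" for F x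
    using l2n_triangle[of \<xi> \<eta> F] l2n_le_nrm[OF assms(1) that] l2n_le_nrm[OF assms(2) that] by linarith
  show "(\<lambda>a. \<xi> a + \<eta> a) \<in> fibrewise_l2 G" "nrm (\<lambda>a. \<xi> a + \<eta> a) \<le> nrm \<xi> + nrm \<eta>"
    by (rule nrm_bound(1)[OF le], assumption+) (rule nrm_bound(2)[OF le])
qed

lemma fl2_mult:
  assumes "\<xi> \<in> fibrewise_l2 G" "\<And>a. cmod (g a) \<le> C"
  shows "(\<lambda>a. g a * \<xi> a) \<in> fibrewise_l2 G" "nrm (\<lambda>a. g a * \<xi> a) \<le> C * nrm \<xi>"
proof -
  have C: "0 \<le> C" using assms(2) norm_ge_zero order_trans by blast
  have le: "l2n (\<lambda>a. g a * \<xi> a) F \<le> C * nrm \<xi>" if "finite F" "F \<subseteq> fib x" for F x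
  proof -
    have "l2n (\<lambda>a. g a * \<xi> a) F \<le> l2n (\<lambda>a. of_real C * \<xi> a) F"
      using assms(2) C by (intro l2n_mono) (auto simp: norm_mult intro: mult_right_mono)
    also have "\<dots> = C * l2n \<xi> F" using C by (simp add: l2n_scale)
    also have "\<dots> \<le> C * nrm \<xi>" using l2n_le_nrm[OF assms(1) that] C by (rule mult_left_mono)
    finally show ?thesis .
  qed
  show "(\<lambda>a. g a * \<xi> a) \<in> fibrewise_l2 G" "nrm (\<lambda>a. g a * \<xi> a) \<le> C * nrm \<xi>"
    by (rule nrm_bound(1)[OF le], assumption+) (rule nrm_bound(2)[OF le])
qed

lemma nrm_scale:
  assumes "\<xi> \<in> fibrewise_l2 G"
  shows "nrm (\<lambda>a. c * \<xi> a) = cmod c * nrm \<xi>"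
proof (cases "c = 0")
  case True
  have "nrm (\<lambda>a. 0) \<le> 0" by (rule nrm_bound) (simp add: l2n_def L2_set_def)
  moreover have "0 \<le> nrm (\<lambda>a. 0)" by (rule nrm_nonneg, rule nrm_bound[of _ 0]) (simp add: l2n_def L2_set_def)
  ultimately show ?thesis using True by simp
next
  case False
  have 1: "nrm (\<lambda>a. c * \<xi> a) \<le> cmod c * nrm \<xi>" by (rule fl2_mult(2)[OF assms]) simp
  have "nrm (\<lambda>a. inverse c * (c * \<xi> a)) \<le> cmod (inverse c) * nrm (\<lambda>a. c * \<xi> a)"
    by (rule fl2_mult(2)[OF fl2_mult(1)[OF assms, of _ "cmod c"]]) simp_all
  moreover have "(\<lambda>a. inverse c * (c * \<xi> a)) = \<xi>" using False by auto
  ultimately have "nrm \<xi> \<le> inverse (cmod c) * nrm (\<lambda>a. c * \<xi> a)" by (simp add: norm_inverse)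
  then have "cmod c * nrm \<xi> \<le> nrm (\<lambda>a. c * \<xi> a)" using False by (simp add: field_simps)
  with 1 show ?thesis by simp
qed

lemma fl2_scale: "\<xi> \<in> fibrewise_l2 G \<Longrightarrow> (\<lambda>a. c * \<xi> a) \<in> fibrewise_l2 G"
  by (rule fl2_mult(1)) auto

lemma fl2_diff:
  assumes "\<xi> \<in> fibrewise_l2 G" "\<eta> \<in> fibrewise_l2 G"
  shows "(\<lambda>a. \<xi> a - \<eta> a) \<in> fibrewise_l2 G" "nrm (\<lambda>a. \<xi> a - \<eta> a) \<le> nrm \<xi> + nrm \<eta>"
  using fl2_add[OF assms(1) fl2_scale[OF assms(2), of "-1"]] nrm_scale[OF assms(2), of "-1"] by auto

lemma nrm_triangle_diff:
  assumes "\<xi> \<in> fibrewise_l2 G" "\<eta> \<in> fibrewise_l2 G" "\<zeta> \<in> fibrewise_l2 G"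
  shows "nrm (\<lambda>a. \<xi> a - \<zeta> a) \<le> nrm (\<lambda>a. \<xi> a - \<eta> a) + nrm (\<lambda>a. \<eta> a - \<zeta> a)"
  using fl2_add(2)[OF fl2_diff(1)[OF assms(1,2)] fl2_diff(1)[OF assms(2,3)]] by simp

lemma Cc_fl2:
  assumes "\<xi> \<in> Cc"
  shows "\<xi> \<in> fibrewise_l2 G"
proof -
  obtain B where B: "0 \<le> B" "\<And>a. cmod (\<xi> a) \<le> B" using Cc_bounded[OF assms] by metis
  obtain N where N: "\<And>x. finite (fib x \<inter> supp \<xi>)" "\<And>x. card (fib x \<inter> supp \<xi>) \<le> N"
    using compact_fib_card[OF Cc_compact[OF assms]] by metis
  show ?thesis
  proof (rule nrm_bound(1))
    fix F x assume F: "finite F" "F \<subseteq> fib x"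
    have "(\<Sum>a\<in>F. (cmod (\<xi> a))\<^sup>2) = (\<Sum>a\<in>F \<inter> supp \<xi>. (cmod (\<xi> a))\<^sup>2)"
      using F supp_outside[of _ \<xi>] by (intro sum.mono_neutral_right) auto
    also have "\<dots> \<le> (\<Sum>a\<in>fib x \<inter> supp \<xi>. (cmod (\<xi> a))\<^sup>2)"
      using N(1) F by (intro sum_mono2) auto
    also have "\<dots> \<le> real (card (fib x \<inter> supp \<xi>)) * B\<^sup>2"
      using B by (intro sum_bounded_above power_mono) auto
    also have "\<dots> \<le> real N * B\<^sup>2" using N(2) by (intro mult_right_mono) auto
    finally show "l2n \<xi> F \<le> sqrt (real N * B\<^sup>2)" by (rule l2n_le_sqrt)
  qed
qed

section \<open>The closure of \<open>Cc\<close> as a complete space of continuous functions\<close>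

lemma L2_fl2: "\<xi> \<in> L2 G \<Longrightarrow> \<xi> \<in> fibrewise_l2 G"
  unfolding L2_def by simp

lemma Cc_L2: "\<xi> \<in> Cc \<Longrightarrow> \<xi> \<in> L2 G"
  unfolding L2_def using Cc_fl2 nrm_scale[of \<xi> 0] by (auto intro!: bexI[of _ \<xi>])

lemma L2_zero: "(\<lambda>a. 0) \<in> L2 G"
  by (rule Cc_L2[OF Cc_zero])

lemma nrm_zero [simp]: "nrm (\<lambda>a. 0) = 0"
  using nrm_scale[OF L2_fl2[OF L2_zero], of 0] by simp

lemma L2_approx:
  assumes "\<xi> \<in> L2 G" "0 < e"
  obtains \<eta> where "\<eta> \<in> Cc" "nrm (\<lambda>a. \<xi> a - \<eta> a) < e"
  using assms unfolding L2_def by auto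

text \<open>The closure is idempotent, so approximants may come from \<open>L2 G\<close> instead of
  \<open>Cc\<close>.\<close>

lemma L2I:
  assumes "\<xi> \<in> fibrewise_l2 G" "\<And>e. 0 < e \<Longrightarrow> \<exists>\<eta>\<in>L2 G. nrm (\<lambda>a. \<xi> a - \<eta> a) < e"
  shows "\<xi> \<in> L2 G"
proof -
  have "\<exists>\<eta>\<in>Cc. nrm (\<lambda>a. \<xi> a - \<eta> a) < e" if e: "0 < e" for e
  proof -
    obtain \<eta> where \<eta>: "\<eta> \<in> L2 G" "nrm (\<lambda>a. \<xi> a - \<eta> a) < e / 2"
      using assms(2)[of "e / 2"] e by auto
    obtain \<zeta> where \<zeta>: "\<zeta> \<in> Cc" "nrm (\<lambda>a. \<eta> a - \<zeta> a) < e / 2"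
      using L2_approx[OF \<eta>(1), of "e / 2"] e by auto
    have "nrm (\<lambda>a. \<xi> a - \<zeta> a) < e"
      using nrm_triangle_diff[OF assms(1) L2_fl2[OF \<eta>(1)] Cc_fl2[OF \<zeta>(1)]] \<eta>(2) \<zeta>(2) by linarith
    then show ?thesis using \<zeta>(1) by (intro bexI[of _ \<zeta>])
  qed
  then show ?thesis using assms(1) unfolding L2_def by simp
qed

lemma L2_add:
  assumes "\<xi> \<in> L2 G" "\<eta> \<in> L2 G"
  shows "(\<lambda>a. \<xi> a + \<eta> a) \<in> L2 G"
proof (rule L2I)
  show "(\<lambda>a. \<xi> a + \<eta> a) \<in> fibrewise_l2 G" by (intro fl2_add L2_fl2 assms)
  fix e :: real assume e: "0 < e"
  obtain \<xi>' where 1: "\<xi>' \<in> Cc" "nrm (\<lambda>a. \<xi> a - \<xi>' a) < e / 2"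
    using L2_approx[OF assms(1), of "e / 2"] e by auto
  obtain \<eta>' where 2: "\<eta>' \<in> Cc" "nrm (\<lambda>a. \<eta> a - \<eta>' a) < e / 2"
    using L2_approx[OF assms(2), of "e / 2"] e by auto
  have "nrm (\<lambda>a. (\<xi> a - \<xi>' a) + (\<eta> a - \<eta>' a)) < e"
    using fl2_add(2)[OF fl2_diff(1)[OF L2_fl2[OF assms(1)] Cc_fl2[OF 1(1)]] fl2_diff(1)[OF L2_fl2[OF assms(2)] Cc_fl2[OF 2(1)]]]
      1(2) 2(2) by linarith
  moreover have "(\<lambda>a. (\<xi> a - \<xi>' a) + (\<eta> a - \<eta>' a)) = (\<lambda>a. \<xi> a + \<eta> a - (\<xi>' a + \<eta>' a))" by auto
  ultimately show "\<exists>\<zeta>\<in>L2 G. nrm (\<lambda>a. \<xi> a + \<eta> a - \<zeta> a) < e"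
    using Cc_L2[OF Cc_add[OF 1(1) 2(1)]] by (intro bexI[of _ "\<lambda>a. \<xi>' a + \<eta>' a"]) auto
qed

lemma L2_mult:
  assumes "\<xi> \<in> L2 G" "continuous_on UNIV g" "\<And>a. cmod (g a) \<le> C"
  shows "(\<lambda>a. g a * \<xi> a) \<in> L2 G"
proof (rule L2I)
  have C: "0 \<le> C" using assms(3) norm_ge_zero order_trans by blast
  show "(\<lambda>a. g a * \<xi> a) \<in> fibrewise_l2 G" by (rule fl2_mult(1)[OF L2_fl2[OF assms(1)] assms(3)])
  fix e :: real assume e: "0 < e"
  obtain \<eta> where \<eta>: "\<eta> \<in> Cc" "nrm (\<lambda>a. \<xi> a - \<eta> a) < e / (C + 1)"
    using L2_approx[OF assms(1), of "e / (C + 1)"] e C by auto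
  have "nrm (\<lambda>a. g a * (\<xi> a - \<eta> a)) \<le> C * nrm (\<lambda>a. \<xi> a - \<eta> a)"
    using fl2_mult(2)[OF fl2_diff(1)[OF L2_fl2[OF assms(1)] Cc_fl2[OF \<eta>(1)]] assms(3)] .
  also have "\<dots> \<le> C * (e / (C + 1))" using \<eta>(2) C by (intro mult_left_mono) auto
  also have "\<dots> < e" using C e by (simp add: field_simps)
  finally show "\<exists>\<zeta>\<in>L2 G. nrm (\<lambda>a. g a * \<xi> a - \<zeta> a) < e"
    using Cc_L2[OF Cc_mult[OF \<eta>(1) assms(2)]]
    by (intro bexI[of _ "\<lambda>a. g a * \<eta> a"]) (auto simp: algebra_simps)
qed

lemma L2_scale: "\<xi> \<in> L2 G \<Longrightarrow> (\<lambda>a. c * \<xi> a) \<in> L2 G"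
  by (rule L2_mult[where C = "cmod c"]) auto

lemma L2_diff: "\<xi> \<in> L2 G \<Longrightarrow> \<eta> \<in> L2 G \<Longrightarrow> (\<lambda>a. \<xi> a - \<eta> a) \<in> L2 G"
  using L2_add[OF _ L2_scale[of \<eta> "-1"], of \<xi>] by simp

text \<open>The norm dominates every value, so approximation by \<open>Cc\<close> is uniform.
  Applied to images of bump functions, this yields the continuity of truncated kernels.\<close>

lemma L2_continuous:
  assumes "\<xi> \<in> L2 G"
  shows "continuous_on UNIV \<xi>"
proof -
  have "\<exists>\<eta>\<in>Cc. nrm (\<lambda>a. \<xi> a - \<eta> a) < inverse (real (Suc n))" for n
    using assms unfolding L2_def by auto
  then obtain h where h: "\<And>n. h n \<in> Cc" "\<And>n. nrm (\<lambda>a. \<xi> a - h n a) < inverse (real (Suc n))"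
    by metis
  have "uniform_limit UNIV h \<xi> sequentially"
  proof (rule uniform_limitI)
    fix e :: real assume "0 < e"
    then obtain n0 where n0: "inverse (real (Suc n0)) < e" using reals_Archimedean by blast
    have "dist (h n a) (\<xi> a) < e" if "n0 \<le> n" for n a
    proof -
      have "cmod (\<xi> a - h n a) \<le> nrm (\<lambda>a. \<xi> a - h n a)"
        using cmod_le_nrm[OF fl2_diff(1)[OF L2_fl2[OF assms] Cc_fl2[OF h(1)]]] .
      also have "\<dots> < inverse (real (Suc n))" by (rule h)
      also have "\<dots> \<le> inverse (real (Suc n0))" using that by (intro le_imp_inverse_le) auto
      finally show ?thesis using n0 by (simp add: dist_norm norm_minus_commute)
    qed
    then show "\<forall>\<^sub>F n in sequentially. \<forall>a\<in>UNIV. dist (h n a) (\<xi> a) < e"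
      unfolding eventually_sequentially by blast
  qed
  then show ?thesis
    by (rule uniform_limit_theorem[rotated]) (simp_all add: Cc_cont[OF h(1)])
qed

text \<open>The rate is that of the gliding hump below. Values converge because the norm dominates
  them, and bounds on finite subsets of fibres survive the pointwise limit. The constant 4/3 is the
  sum of the powers of 1/4.\<close>

lemma L2_complete:
  assumes p: "\<And>n. p n \<in> L2 G" and step: "\<And>n. nrm (\<lambda>a. p (Suc n) a - p n a) \<le> (1/4) ^ n"
  obtains \<eta> where "\<eta> \<in> L2 G" "\<And>n. nrm (\<lambda>a. \<eta> a - p n a) \<le> 4/3 * (1/4) ^ n"
proof -
  have fp: "p n \<in> fibrewise_l2 G" for n using p L2_fl2 by blast
  have tail: "nrm (\<lambda>a. p (n + m) a - p n a) \<le> 4/3 * (1/4) ^ n" for n m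
  proof -
    have "nrm (\<lambda>a. p (n + m) a - p n a) \<le> 4/3 * (1/4) ^ n * (1 - (1/4) ^ m)"
    proof (induction m)
      case (Suc m)
      have "nrm (\<lambda>a. p (n + Suc m) a - p n a) \<le> nrm (\<lambda>a. p (Suc (n + m)) a - p (n + m) a) + nrm (\<lambda>a. p (n + m) a - p n a)"
        using nrm_triangle_diff[OF fp fp fp] by simp
      also have "\<dots> \<le> (1/4) ^ (n + m) + 4/3 * (1/4) ^ n * (1 - (1/4) ^ m)"
        by (intro add_mono step Suc)
      also have "\<dots> = 4/3 * (1/4) ^ n * (1 - (1/4) ^ Suc m)"
        unfolding power_add power_Suc by algebra
      finally show ?case .
    qed simp
    also have "\<dots> \<le> 4/3 * (1/4) ^ n * 1" by (intro mult_left_mono) auto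
    finally show ?thesis by simp
  qed
  have lim0: "(\<lambda>n. 4/3 * (1/4::real) ^ n) \<longlonglongrightarrow> 0"
    by (intro tendsto_mult_right_zero LIMSEQ_power_zero) simp
  have "Cauchy (\<lambda>n. p n a)" for a
  proof (rule CauchyI')
    fix e :: real assume "0 < e"
    then obtain n0 where n0: "\<And>n. n0 \<le> n \<Longrightarrow> 4/3 * (1/4::real) ^ n < e"
      using order_tendstoD(2)[OF lim0] unfolding eventually_sequentially by blast
    show "\<exists>M. \<forall>m\<ge>M. \<forall>n>m. dist (p m a) (p n a) < e"
    proof (intro exI allI impI)
      fix m n assume mn: "n0 \<le> m" "m < n"
      have "norm (p (m + (n - m)) a - p m a) \<le> 4/3 * (1/4) ^ m"
        by (rule order_trans[OF cmod_le_nrm[OF fl2_diff(1)[OF fp fp]] tail])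
      then have "norm (p n a - p m a) \<le> 4/3 * (1/4) ^ m" using mn by simp
      then show "dist (p m a) (p n a) < e" using n0[OF mn(1)] by (simp add: dist_norm norm_minus_commute)
    qed
  qed
  then have "\<forall>a. \<exists>z. (\<lambda>n. p n a) \<longlonglongrightarrow> z" using Cauchy_convergent_iff convergent_def by blast
  then obtain \<eta> where \<eta>: "\<And>a. (\<lambda>n. p n a) \<longlonglongrightarrow> \<eta> a" by metis
  have fin: "l2n (\<lambda>a. \<eta> a - p n a) F \<le> 4/3 * (1/4) ^ n" if F: "finite F" "F \<subseteq> fib x" for F x n
  proof -
    have "(\<lambda>m. p (n + m) a) \<longlonglongrightarrow> \<eta> a" for a
      using LIMSEQ_ignore_initial_segment[OF \<eta>[of a], of n] by (simp add: add.commute)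
    then have "(\<lambda>m. l2n (\<lambda>a. p (n + m) a - p n a) F) \<longlonglongrightarrow> l2n (\<lambda>a. \<eta> a - p n a) F"
      unfolding l2n_def L2_set_def by (intro tendsto_intros)
    moreover have "l2n (\<lambda>a. p (n + m) a - p n a) F \<le> 4/3 * (1/4) ^ n" for m
      using order_trans[OF l2n_le_nrm[OF fl2_diff(1)[OF fp fp] F] tail] .
    ultimately show ?thesis using LIMSEQ_le_const2 by blast
  qed
  have d: "(\<lambda>a. \<eta> a - p n a) \<in> fibrewise_l2 G" "nrm (\<lambda>a. \<eta> a - p n a) \<le> 4/3 * (1/4) ^ n" for n
    by (rule nrm_bound(1)[OF fin], assumption+) (rule nrm_bound(2)[OF fin])
  have "\<eta> \<in> L2 G"
  proof (rule L2I)
    show "\<eta> \<in> fibrewise_l2 G" using fl2_add(1)[OF d(1)[of 0] fp[of 0]] by simp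
    fix e :: real assume "0 < e"
    then obtain n where "4/3 * (1/4::real) ^ n < e"
      using order_tendstoD(2)[OF lim0] unfolding eventually_sequentially by blast
    then have "nrm (\<lambda>a. \<eta> a - p n a) < e" using d(2)[of n] by linarith
    then show "\<exists>\<zeta>\<in>L2 G. nrm (\<lambda>a. \<eta> a - \<zeta> a) < e" by (intro bexI[of _ "p n"] p)
  qed
  then show thesis using that d(2) by blast
qed

section \<open>The inner product\<close>

lemma inn_summable:
  assumes "\<xi> \<in> fibrewise_l2 G" "\<eta> \<in> fibrewise_l2 G"
  shows "(\<lambda>a. cnj (\<xi> a) * \<eta> a) summable_on fib x"
proof (rule abs_summable_summable, rule nonneg_bdd_above_summable_on)
  show "bdd_above (sum (\<lambda>a. norm (cnj (\<xi> a) * \<eta> a)) ` {F. F \<subseteq> fib x \<and> finite F})"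
  proof (rule bdd_aboveI2)
    fix F assume "F \<in> {F. F \<subseteq> fib x \<and> finite F}"
    then have F: "finite F" "F \<subseteq> fib x" by auto
    have "(\<Sum>a\<in>F. norm (cnj (\<xi> a) * \<eta> a)) \<le> l2n \<xi> F * l2n \<eta> F"
      using l2n_cauchy_schwarz[of \<xi> \<eta> F] by (simp add: norm_mult)
    also have "\<dots> \<le> nrm \<xi> * nrm \<eta>"
      using l2n_le_nrm[OF assms(1) F] l2n_le_nrm[OF assms(2) F] nrm_nonneg[OF assms(1)] by (intro mult_mono) auto
    finally show "(\<Sum>a\<in>F. norm (cnj (\<xi> a) * \<eta> a)) \<le> nrm \<xi> * nrm \<eta>" .
  qed
qed simp

lemma inn_bound:
  assumes "\<xi> \<in> fibrewise_l2 G" "\<eta> \<in> fibrewise_l2 G"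
  shows "cmod (inn \<xi> \<eta> x) \<le> nrm \<xi> * nrm \<eta>"
proof -
  have "((\<lambda>F. \<Sum>a\<in>F. cnj (\<xi> a) * \<eta> a) \<longlongrightarrow> inn \<xi> \<eta> x) (finite_subsets_at_top (fib x))"
    unfolding L2_inner_def by (rule infsum_tendsto[OF inn_summable[OF assms]])
  then show ?thesis
  proof (rule Lim_norm_ubound[rotated])
    show "\<forall>\<^sub>F F in finite_subsets_at_top (fib x). cmod (\<Sum>a\<in>F. cnj (\<xi> a) * \<eta> a) \<le> nrm \<xi> * nrm \<eta>"
    proof (rule eventually_finite_subsets_at_top_weakI)
      fix F assume F: "finite F" "F \<subseteq> fib x"
      have "cmod (\<Sum>a\<in>F. cnj (\<xi> a) * \<eta> a) \<le> l2n (\<lambda>a. cnj (\<xi> a)) F * l2n \<eta> F"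
        by (rule l2n_cauchy_schwarz_sum)
      also have "l2n (\<lambda>a. cnj (\<xi> a)) F = l2n \<xi> F" by (simp add: l2n_def)
      also have "l2n \<xi> F * l2n \<eta> F \<le> nrm \<xi> * nrm \<eta>"
        using l2n_le_nrm[OF assms(1) F] l2n_le_nrm[OF assms(2) F] nrm_nonneg[OF assms(1)] by (intro mult_mono) auto
      finally show "cmod (\<Sum>a\<in>F. cnj (\<xi> a) * \<eta> a) \<le> nrm \<xi> * nrm \<eta>" .
    qed
  qed simp
qed

lemma inn_add_right:
  assumes "\<xi> \<in> fibrewise_l2 G" "\<eta> \<in> fibrewise_l2 G" "\<zeta> \<in> fibrewise_l2 G"
  shows "inn \<xi> (\<lambda>a. \<eta> a + \<zeta> a) x = inn \<xi> \<eta> x + inn \<xi> \<zeta> x"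
  unfolding L2_inner_def using infsum_add[OF inn_summable[OF assms(1,2)] inn_summable[OF assms(1,3)]]
  by (simp add: distrib_left)

lemma inn_scale_right: "inn \<xi> (\<lambda>a. c * \<eta> a) x = c * inn \<xi> \<eta> x"
  unfolding L2_inner_def using infsum_cmult_right'[of c "\<lambda>a. cnj (\<xi> a) * \<eta> a" "fib x"] by (simp add: mult_ac)

lemma inn_commute: "inn \<eta> \<xi> x = cnj (inn \<xi> \<eta> x)"
  unfolding L2_inner_def by (simp flip: infsum_cnj add: mult.commute)

lemma inn_diff_right:
  assumes "\<xi> \<in> fibrewise_l2 G" "\<eta> \<in> fibrewise_l2 G" "\<zeta> \<in> fibrewise_l2 G"
  shows "inn \<xi> (\<lambda>a. \<eta> a - \<zeta> a) x = inn \<xi> \<eta> x - inn \<xi> \<zeta> x"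
  using inn_add_right[OF assms(1,2) fl2_scale[OF assms(3), of "-1"]] inn_scale_right[of \<xi> "-1" \<zeta>] by simp

lemma inn_add_left:
  assumes "\<xi> \<in> fibrewise_l2 G" "\<eta> \<in> fibrewise_l2 G" "\<zeta> \<in> fibrewise_l2 G"
  shows "inn (\<lambda>a. \<eta> a + \<zeta> a) \<xi> x = inn \<eta> \<xi> x + inn \<zeta> \<xi> x"
  using inn_add_right[OF assms] by (metis complex_cnj_add inn_commute)

lemma inn_scale_left: "inn (\<lambda>a. c * \<eta> a) \<xi> x = cnj c * inn \<eta> \<xi> x"
  using inn_scale_right by (metis complex_cnj_mult inn_commute)

lemma inn_diff_left:
  assumes "\<xi> \<in> fibrewise_l2 G" "\<eta> \<in> fibrewise_l2 G" "\<zeta> \<in> fibrewise_l2 G"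
  shows "inn (\<lambda>a. \<eta> a - \<zeta> a) \<xi> x = inn \<eta> \<xi> x - inn \<zeta> \<xi> x"
  using inn_diff_right[OF assms] by (metis complex_cnj_diff inn_commute)

lemma inn_self_zero:
  assumes "\<xi> \<in> fibrewise_l2 G" "\<And>x. x \<in> units G \<Longrightarrow> inn \<xi> \<xi> x = 0"
  shows "\<xi> = (\<lambda>a. 0)"
proof
  fix a
  have "(SUP x\<in>units G. cmod (inn \<xi> \<xi> x)) = (SUP x\<in>units G. 0)"
    using assms(2) by (intro SUP_cong) auto
  then have "nrm \<xi> = 0" unfolding L2_norm_def using units_nonempty by simp
  then show "\<xi> a = 0" using cmod_le_nrm[OF assms(1), of a] by simp
qed

text \<open>Testing with the difference of the two vectors suffices. Linearity of adjointable
  operators rests on this.\<close>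

lemma inn_L2_ext:
  assumes "\<xi> \<in> L2 G" "\<eta> \<in> L2 G" "\<And>\<zeta> x. \<zeta> \<in> L2 G \<Longrightarrow> x \<in> units G \<Longrightarrow> inn \<xi> \<zeta> x = inn \<eta> \<zeta> x"
  shows "\<xi> = \<eta>"
proof -
  have "(\<lambda>a. \<xi> a - \<eta> a) = (\<lambda>a. 0)"
    by (rule inn_self_zero[OF fl2_diff(1)])
      (use assms L2_fl2 inn_diff_left L2_diff in auto)
  then show ?thesis by (simp add: fun_eq_iff)
qed

text \<open>A class that also contains right convolutions. Those are bounded and linear, but in
  general not linear over the coefficient algebra, hence not always adjointable. Values outside
  \<open>L2 G\<close> are left free.\<close>

definition bop :: "'a operator \<Rightarrow> bool" where
  "bop T \<longleftrightarrow> (\<forall>\<xi>\<in>L2 G. T \<xi> \<in> L2 G) \<and>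
     (\<forall>\<xi>\<in>L2 G. \<forall>\<eta>\<in>L2 G. T (\<lambda>a. \<xi> a + \<eta> a) = (\<lambda>a. T \<xi> a + T \<eta> a)) \<and>
     (\<forall>\<xi>\<in>L2 G. \<forall>c. T (\<lambda>a. c * \<xi> a) = (\<lambda>a. c * T \<xi> a)) \<and>
     (\<exists>M. \<forall>\<xi>\<in>L2 G. nrm (T \<xi>) \<le> M * nrm \<xi>)"

lemma bop_L2: "bop T \<Longrightarrow> \<xi> \<in> L2 G \<Longrightarrow> T \<xi> \<in> L2 G"
  and bop_add: "bop T \<Longrightarrow> \<xi> \<in> L2 G \<Longrightarrow> \<eta> \<in> L2 G \<Longrightarrow> T (\<lambda>a. \<xi> a + \<eta> a) = (\<lambda>a. T \<xi> a + T \<eta> a)"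
  and bop_scale: "bop T \<Longrightarrow> \<xi> \<in> L2 G \<Longrightarrow> T (\<lambda>a. c * \<xi> a) = (\<lambda>a. c * T \<xi> a)"
  unfolding bop_def by blast+

lemma bop_diff: "bop T \<Longrightarrow> \<xi> \<in> L2 G \<Longrightarrow> \<eta> \<in> L2 G \<Longrightarrow> T (\<lambda>a. \<xi> a - \<eta> a) = (\<lambda>a. T \<xi> a - T \<eta> a)"
  using bop_add[OF _ _ L2_scale[of \<eta> "-1"], of T \<xi>] bop_scale[of T \<eta> "-1"] by simp

lemma bop_zero: "bop T \<Longrightarrow> T (\<lambda>a. 0) = (\<lambda>a. 0)"
  using bop_scale[OF _ L2_zero, of T 0] by simp

lemma bop_bound:
  assumes "bop T"
  obtains M where "0 \<le> M" "\<And>\<xi>. \<xi> \<in> L2 G \<Longrightarrow> nrm (T \<xi>) \<le> M * nrm \<xi>"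
proof -
  obtain M where M: "\<And>\<xi>. \<xi> \<in> L2 G \<Longrightarrow> nrm (T \<xi>) \<le> M * nrm \<xi>" using assms unfolding bop_def by blast
  have "nrm (T \<xi>) \<le> max M 0 * nrm \<xi>" if "\<xi> \<in> L2 G" for \<xi>
    using order_trans[OF M[OF that] mult_right_mono[of M "max M 0" "nrm \<xi>"]] nrm_nonneg[OF L2_fl2[OF that]] by simp
  then show thesis using that[of "max M 0"] by simp
qed

lemma operator_norm_le:
  assumes "0 \<le> M" "\<And>\<xi>. \<xi> \<in> L2 G \<Longrightarrow> nrm \<xi> \<le> 1 \<Longrightarrow> nrm (T \<xi>) \<le> M"
  shows "operator_norm G T \<le> M"
  unfolding operator_norm_def using assms L2_zero by (intro cSUP_least) (auto intro!: exI[of _ "\<lambda>a. 0"])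

lemma nrm_le_operator_norm:
  assumes "bop T" "\<xi> \<in> L2 G"
  shows "nrm (T \<xi>) \<le> operator_norm G T * nrm \<xi>"
proof -
  obtain M where M: "0 \<le> M" "\<And>\<xi>. \<xi> \<in> L2 G \<Longrightarrow> nrm (T \<xi>) \<le> M * nrm \<xi>" using bop_bound[OF assms(1)] by blast
  have up: "nrm (T \<zeta>) \<le> operator_norm G T" if "\<zeta> \<in> L2 G" "nrm \<zeta> \<le> 1" for \<zeta>
    unfolding operator_norm_def
  proof (rule cSUP_upper)
    \<comment> \<open>A real supremum is meaningful only for a bounded set; this is where
      \<open>bop\<close> enters.\<close>
    show "bdd_above ((\<lambda>\<xi>. nrm (T \<xi>)) ` {\<xi> \<in> L2 G. nrm \<xi> \<le> 1})"
    proof (rule bdd_aboveI2)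
      fix \<xi> assume "\<xi> \<in> {\<xi> \<in> L2 G. nrm \<xi> \<le> 1}"
      then show "nrm (T \<xi>) \<le> M" using M(2)[of \<xi>] mult_left_mono[of "nrm \<xi>" 1 M] M(1) by auto
    qed
  qed (use that in auto)
  show ?thesis
  proof (cases "nrm \<xi> = 0")
    case True
    then show ?thesis using M(2)[OF assms(2)] by simp
  next
    case False
    then have pos: "0 < nrm \<xi>" using nrm_nonneg[OF L2_fl2[OF assms(2)]] by simp
    let ?c = "complex_of_real (inverse (nrm \<xi>))"
    have "nrm (T (\<lambda>a. ?c * \<xi> a)) \<le> operator_norm G T"
      by (rule up[OF L2_scale[OF assms(2)]]) (use pos in \<open>simp add: nrm_scale[OF L2_fl2[OF assms(2)]] norm_inverse\<close>)
    then have "inverse (nrm \<xi>) * nrm (T \<xi>) \<le> operator_norm G T"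
      using pos by (simp add: bop_scale[OF assms] nrm_scale[OF L2_fl2[OF bop_L2[OF assms]]] norm_inverse)
    then show ?thesis using pos by (simp add: field_simps)
  qed
qed

lemma bop_comp:
  assumes "bop S" "bop T"
  shows "bop (S \<circ> T)"
proof -
  obtain M where M: "0 \<le> M" "\<And>\<xi>. \<xi> \<in> L2 G \<Longrightarrow> nrm (S \<xi>) \<le> M * nrm \<xi>" using bop_bound[OF assms(1)] by blast
  obtain N where N: "0 \<le> N" "\<And>\<xi>. \<xi> \<in> L2 G \<Longrightarrow> nrm (T \<xi>) \<le> N * nrm \<xi>" using bop_bound[OF assms(2)] by blast
  have "nrm (S (T \<xi>)) \<le> M * N * nrm \<xi>" if "\<xi> \<in> L2 G" for \<xi>
    using order_trans[OF M(2)[OF bop_L2[OF assms(2) that]] mult_left_mono[OF N(2)[OF that] M(1)]] by simp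
  then show ?thesis using assms unfolding bop_def o_def by auto
qed

lemma bop_minus:
  assumes "bop S" "bop T"
  shows "bop (\<lambda>\<xi> a. S \<xi> a - T \<xi> a)"
proof -
  obtain M where M: "0 \<le> M" "\<And>\<xi>. \<xi> \<in> L2 G \<Longrightarrow> nrm (S \<xi>) \<le> M * nrm \<xi>" using bop_bound[OF assms(1)] by blast
  obtain N where N: "0 \<le> N" "\<And>\<xi>. \<xi> \<in> L2 G \<Longrightarrow> nrm (T \<xi>) \<le> N * nrm \<xi>" using bop_bound[OF assms(2)] by blast
  have "nrm (\<lambda>a. S \<xi> a - T \<xi> a) \<le> (M + N) * nrm \<xi>" if "\<xi> \<in> L2 G" for \<xi>
    using fl2_diff(2)[OF L2_fl2[OF bop_L2[OF assms(1) that]] L2_fl2[OF bop_L2[OF assms(2) that]]]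
      M(2)[OF that] N(2)[OF that] by (simp add: algebra_simps)
  then have "\<exists>M. \<forall>\<xi>\<in>L2 G. nrm (\<lambda>a. S \<xi> a - T \<xi> a) \<le> M * nrm \<xi>" by blast
  then show ?thesis unfolding bop_def
    using assms by (simp add: bop_L2 bop_add bop_scale L2_diff algebra_simps)
qed

text \<open>
  A gliding hump: if \<open>T\<close> were unbounded, a vector \<open>\<eta>\<close> could be built whose inner products with
  \<open>T (\<xi> n)\<close> are unbounded, although they equal those of \<open>\<xi> n\<close> with \<open>S \<eta>\<close>.
\<close>

lemma adjoint_imp_bounded:
  assumes T: "\<And>\<xi>. \<xi> \<in> L2 G \<Longrightarrow> T \<xi> \<in> L2 G" and S: "\<And>\<eta>. \<eta> \<in> L2 G \<Longrightarrow> S \<eta> \<in> L2 G"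
    and adj: "\<And>\<xi> \<eta> x. \<xi> \<in> L2 G \<Longrightarrow> \<eta> \<in> L2 G \<Longrightarrow> x \<in> units G \<Longrightarrow> inn (T \<xi>) \<eta> x = inn \<xi> (S \<eta>) x"
  shows "\<exists>M. \<forall>\<xi>\<in>L2 G. nrm \<xi> \<le> 1 \<longrightarrow> nrm (T \<xi>) \<le> M"
proof (rule ccontr)
  assume "\<nexists>M. \<forall>\<xi>\<in>L2 G. nrm \<xi> \<le> 1 \<longrightarrow> nrm (T \<xi>) \<le> M"
  \<comment> \<open>The growth \<open>8 ^ n\<close> beats perturbations of size
    \<open>(1/4) ^ n\<close> by a factor \<open>2 ^ n\<close>.\<close>
  then have "\<forall>n::nat. \<exists>\<xi>. \<xi> \<in> L2 G \<and> nrm \<xi> \<le> 1 \<and> 8 ^ n < nrm (T \<xi>)" by (meson not_less)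
  then obtain \<xi> where \<xi>: "\<And>n. \<xi> n \<in> L2 G" "\<And>n. nrm (\<xi> n) \<le> 1" "\<And>n::nat. 8 ^ n < nrm (T (\<xi> n))"
    by metis
  define c where "c n = nrm (T (\<xi> n))" for n
  define e where "e n = (\<lambda>a. complex_of_real (inverse (c n)) * T (\<xi> n) a)" for n
  have c: "8 ^ n < c n" "0 < c n" for n
    using \<xi>(3)[of n] unfolding c_def by (auto intro: less_trans[of 0 "8 ^ n"])
  have TL: "T (\<xi> n) \<in> L2 G" "T (\<xi> n) \<in> fibrewise_l2 G" for n using T \<xi>(1) L2_fl2 by auto
  have e: "e n \<in> L2 G" "nrm (e n) = 1" for n
  proof -
    show "e n \<in> L2 G" unfolding e_def by (rule L2_scale[OF TL(1)])
    have "nrm (e n) = inverse (c n) * c n"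
      unfolding e_def nrm_scale[OF TL(2)] using c(2)[of n] by (simp add: c_def norm_inverse)
    then show "nrm (e n) = 1" using c(2)[of n] by simp
  qed
  \<comment> \<open>A unit that sees at least half of the squared norm of
    \<open>T (\<xi> n)\<close>; the supremum need not be attained.\<close>
  have "\<exists>x\<in>units G. c n / 2 \<le> cmod (inn (T (\<xi> n)) (e n) x)" for n
  proof -
    have "(SUP x\<in>units G. cmod (inn (T (\<xi> n)) (T (\<xi> n)) x)) = (c n)\<^sup>2"
      using c(2)[of n] unfolding c_def L2_norm_def by (simp add: sqrt_le_D)
    moreover have "(c n)\<^sup>2 / 2 < (c n)\<^sup>2" using c(2)[of n] by simp
    ultimately obtain x where x: "x \<in> units G" "(c n)\<^sup>2 / 2 < cmod (inn (T (\<xi> n)) (T (\<xi> n)) x)"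
      using less_cSUP_iff[OF units_nonempty] inn_bound[OF TL(2) TL(2)]
      by (smt (verit, best) bdd_aboveI2)
    have "cmod (inn (T (\<xi> n)) (e n) x) = inverse (c n) * cmod (inn (T (\<xi> n)) (T (\<xi> n)) x)"
      unfolding e_def inn_scale_right norm_mult using c(2)[of n] by (simp add: norm_inverse)
    moreover have "inverse (c n) * ((c n)\<^sup>2 / 2) \<le> inverse (c n) * cmod (inn (T (\<xi> n)) (T (\<xi> n)) x)"
      using x(2) c(2)[of n] by (intro mult_left_mono) auto
    moreover have "inverse (c n) * ((c n)\<^sup>2 / 2) = c n / 2" using c(2)[of n] by (simp add: power2_eq_square)
    ultimately show ?thesis using x(1) by (intro bexI[of _ x]) simp_all
  qed
  then obtain x where x: "\<And>n. x n \<in> units G" "\<And>n. c n / 2 \<le> cmod (inn (T (\<xi> n)) (e n) (x n))"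
    by metis
  \<comment> \<open>At stage \<open>n\<close> a multiple of \<open>e n\<close> is added or
    subtracted. The two results have inner products with \<open>T (\<xi> n)\<close> that differ by
    at least \<open>(1/4) ^ n * c n\<close>, so one of them is large whatever \<open>p\<close>
    contributes.\<close>
  have "\<exists>p. \<forall>n. p n \<in> L2 G \<and> (nrm (\<lambda>a. p (Suc n) a - p n a) \<le> (1/4) ^ n \<and>
      (1/4) ^ n * c n / 2 \<le> cmod (inn (T (\<xi> n)) (p (Suc n)) (x n)))"
  proof (rule dependent_nat_choice[where P = "\<lambda>n p. p \<in> L2 G" and
        Q = "\<lambda>n p q. nrm (\<lambda>a. q a - p a) \<le> (1/4) ^ n \<and> (1/4) ^ n * c n / 2 \<le> cmod (inn (T (\<xi> n)) q (x n))"])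
    show "\<exists>p. p \<in> L2 G" using L2_zero by blast
    fix p n assume p: "p \<in> L2 G"
    define r where "r = complex_of_real ((1/4) ^ n)"
    have re: "(\<lambda>a. r * e n a) \<in> L2 G" "(\<lambda>a. - r * e n a) \<in> L2 G" by (rule L2_scale[OF e(1)])+
    define q1 where "q1 = (\<lambda>a. p a + r * e n a)"
    define q2 where "q2 = (\<lambda>a. p a + - r * e n a)"
    have q: "q1 \<in> L2 G" "q2 \<in> L2 G" unfolding q1_def q2_def by (rule L2_add[OF p re(1)], rule L2_add[OF p re(2)])
    have cr: "cmod r = (1/4) ^ n" unfolding r_def by (simp add: norm_power norm_divide)
    have n1: "nrm (\<lambda>a. q1 a - p a) \<le> (1/4) ^ n" and n2: "nrm (\<lambda>a. q2 a - p a) \<le> (1/4) ^ n"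
      unfolding q1_def q2_def using nrm_scale[OF L2_fl2[OF e(1)], of r n] nrm_scale[OF L2_fl2[OF e(1)], of "-r" n]
      by (simp_all add: e(2) cr)
    have i1: "inn (T (\<xi> n)) q1 (x n) = inn (T (\<xi> n)) p (x n) + r * inn (T (\<xi> n)) (e n) (x n)"
      unfolding q1_def by (subst inn_add_right) (use TL p re L2_fl2 inn_scale_right in auto)
    have i2: "inn (T (\<xi> n)) q2 (x n) = inn (T (\<xi> n)) p (x n) + (- r) * inn (T (\<xi> n)) (e n) (x n)"
      unfolding q2_def by (subst inn_add_right) (use TL p re L2_fl2 inn_scale_right[of _ "-r"] in auto)
    have "inn (T (\<xi> n)) q1 (x n) - inn (T (\<xi> n)) q2 (x n) = 2 * (r * inn (T (\<xi> n)) (e n) (x n))"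
      unfolding i1 i2 by simp
    then have "2 * ((1/4) ^ n * cmod (inn (T (\<xi> n)) (e n) (x n))) \<le> cmod (inn (T (\<xi> n)) q1 (x n)) + cmod (inn (T (\<xi> n)) q2 (x n))"
      using norm_triangle_ineq4[of "inn (T (\<xi> n)) q1 (x n)" "inn (T (\<xi> n)) q2 (x n)"] by (simp add: norm_mult cr)
    moreover have "(1/4) ^ n * (c n / 2) \<le> (1/4) ^ n * cmod (inn (T (\<xi> n)) (e n) (x n))"
      using x(2)[of n] by (intro mult_left_mono) auto
    ultimately have "(1/4) ^ n * c n / 2 \<le> cmod (inn (T (\<xi> n)) q1 (x n)) \<or> (1/4) ^ n * c n / 2 \<le> cmod (inn (T (\<xi> n)) q2 (x n))"
      by linarith
    then show "\<exists>q. q \<in> L2 G \<and> nrm (\<lambda>a. q a - p a) \<le> (1/4) ^ n \<and> (1/4) ^ n * c n / 2 \<le> cmod (inn (T (\<xi> n)) q (x n))"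
      using q n1 n2 by blast
  qed
  then obtain p where p: "\<And>n. p n \<in> L2 G" "\<And>n. nrm (\<lambda>a. p (Suc n) a - p n a) \<le> (1/4) ^ n"
      "\<And>n. (1/4) ^ n * c n / 2 \<le> cmod (inn (T (\<xi> n)) (p (Suc n)) (x n))" by blast
  obtain \<eta> where \<eta>: "\<eta> \<in> L2 G" "\<And>n. nrm (\<lambda>a. \<eta> a - p n a) \<le> 4/3 * (1/4) ^ n"
    using L2_complete[OF p(1,2)] by blast
  \<comment> \<open>Later stages move \<open>p (Suc n)\<close> by at most
    \<open>4/3 * (1/4) ^ Suc n\<close>, which is a third of \<open>(1/4) ^ n\<close>. Of the half
    secured at stage \<open>n\<close> a sixth survives, as 1/2 - 1/3 = 1/6.\<close>
  have lower: "2 ^ n / 6 \<le> nrm (S \<eta>)" for n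
  proof -
    have d: "inn (T (\<xi> n)) \<eta> (x n) = inn (T (\<xi> n)) (p (Suc n)) (x n) + inn (T (\<xi> n)) (\<lambda>a. \<eta> a - p (Suc n) a) (x n)"
      using inn_diff_right[OF TL(2) L2_fl2[OF \<eta>(1)] L2_fl2[OF p(1)]] by simp
    have "cmod (inn (T (\<xi> n)) (\<lambda>a. \<eta> a - p (Suc n) a) (x n)) \<le> c n * nrm (\<lambda>a. \<eta> a - p (Suc n) a)"
      using inn_bound[OF TL(2) fl2_diff(1)[OF L2_fl2[OF \<eta>(1)] L2_fl2[OF p(1)]]] unfolding c_def .
    also have "\<dots> \<le> c n * (4/3 * (1/4) ^ Suc n)" using c(2)[of n] by (intro mult_left_mono \<eta>(2)) auto
    also have "\<dots> = (1/4) ^ n * c n / 3"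
    proof -
      have "k * (4/3 * (1/4 * q)) = q * k / 3" for k q :: real by simp
      then show ?thesis unfolding power_Suc .
    qed
    finally have "cmod (inn (T (\<xi> n)) (\<lambda>a. \<eta> a - p (Suc n) a) (x n)) \<le> (1/4) ^ n * c n / 3" .
    then have "(1/4) ^ n * c n / 2 - (1/4) ^ n * c n / 3 \<le> cmod (inn (T (\<xi> n)) \<eta> (x n))"
      unfolding d using p(3)[of n]
        norm_diff_ineq[of "inn (T (\<xi> n)) (p (Suc n)) (x n)" "inn (T (\<xi> n)) (\<lambda>a. \<eta> a - p (Suc n) a) (x n)"]
      by linarith
    moreover have "cmod (inn (T (\<xi> n)) \<eta> (x n)) \<le> 1 * nrm (S \<eta>)"
      unfolding adj[OF \<xi>(1) \<eta>(1) x(1)] 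
      by (rule order_trans[OF inn_bound[OF L2_fl2[OF \<xi>(1)] L2_fl2[OF S[OF \<eta>(1)]]]])
        (intro mult_right_mono \<xi>(2) nrm_nonneg L2_fl2 S \<eta>(1))
    moreover have "(1/4) ^ n * (8::real) ^ n \<le> (1/4) ^ n * c n" using c(1)[of n] by (intro mult_left_mono) auto
    moreover have "(1/4) ^ n * (8::real) ^ n = 2 ^ n" by (simp flip: power_mult_distrib)
    ultimately show ?thesis by linarith
  qed
  obtain n where "6 * nrm (S \<eta>) < 2 ^ n" using real_arch_pow[of 2 "6 * nrm (S \<eta>)"] by auto
  then show False using lower[of n] by linarith
qed

lemma adjointable_bop:
  assumes "T \<in> adjointable_operators G"
  shows "bop T"
proof -
  have T': "T ` L2 G \<subseteq> L2 G" using assms unfolding adjointable_operators_def by simp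
  have "\<exists>S. S ` L2 G \<subseteq> L2 G \<and> (\<forall>\<xi>\<in>L2 G. \<forall>\<eta>\<in>L2 G. \<forall>x\<in>units G. inn (T \<xi>) \<eta> x = inn \<xi> (S \<eta>) x)"
    using assms unfolding adjointable_operators_def by simp
  then obtain S where S': "S ` L2 G \<subseteq> L2 G"
    and adj': "\<forall>\<xi>\<in>L2 G. \<forall>\<eta>\<in>L2 G. \<forall>x\<in>units G. inn (T \<xi>) \<eta> x = inn \<xi> (S \<eta>) x"
    by (elim exE conjE) (rule that)
  have T: "T \<xi> \<in> L2 G" if "\<xi> \<in> L2 G" for \<xi> using T' that by (simp add: image_subset_iff)
  have S: "S \<xi> \<in> L2 G" if "\<xi> \<in> L2 G" for \<xi> using S' that by (simp add: image_subset_iff)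
  have adj: "inn (T \<xi>) \<eta> x = inn \<xi> (S \<eta>) x" if "\<xi> \<in> L2 G" "\<eta> \<in> L2 G" "x \<in> units G" for \<xi> \<eta> x
    using adj' that by simp
  have add: "T (\<lambda>a. \<xi> a + \<eta> a) = (\<lambda>a. T \<xi> a + T \<eta> a)" if "\<xi> \<in> L2 G" "\<eta> \<in> L2 G" for \<xi> \<eta>
    by (rule inn_L2_ext) (use that T S adj L2_add inn_add_left L2_fl2 in auto)
  have scale: "T (\<lambda>a. c * \<xi> a) = (\<lambda>a. c * T \<xi> a)" if "\<xi> \<in> L2 G" for \<xi> c
    by (rule inn_L2_ext) (use that T S adj L2_scale inn_scale_left L2_fl2 in auto)
  have "\<exists>M. \<forall>\<xi>\<in>L2 G. nrm \<xi> \<le> 1 \<longrightarrow> nrm (T \<xi>) \<le> M"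
    by (rule adjoint_imp_bounded[OF T S adj])
  then obtain M where M: "\<And>\<xi>. \<xi> \<in> L2 G \<Longrightarrow> nrm \<xi> \<le> 1 \<Longrightarrow> nrm (T \<xi>) \<le> M"
    by blast
  have "nrm (T \<xi>) \<le> M * nrm \<xi>" if \<xi>: "\<xi> \<in> L2 G" for \<xi>
  proof (cases "nrm \<xi> = 0")
    case True
    then have "\<xi> = (\<lambda>a. 0)" using cmod_le_nrm[OF L2_fl2[OF \<xi>]] by fastforce
    moreover have "T (\<lambda>a. 0) = (\<lambda>a. 0)" using scale[OF L2_zero, of 0] by simp
    ultimately show ?thesis by simp
  next
    case False
    then have pos: "0 < nrm \<xi>" using nrm_nonneg[OF L2_fl2[OF \<xi>]] by simp
    let ?c = "complex_of_real (inverse (nrm \<xi>))"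
    have "nrm (T (\<lambda>a. ?c * \<xi> a)) \<le> M"
      by (rule M[OF L2_scale[OF \<xi>]]) (use pos in \<open>simp add: nrm_scale[OF L2_fl2[OF \<xi>]] norm_inverse\<close>)
    then have "inverse (nrm \<xi>) * nrm (T \<xi>) \<le> M"
      using pos by (simp add: scale[OF \<xi>] nrm_scale[OF L2_fl2[OF T[OF \<xi>]]] norm_inverse)
    then show ?thesis using pos by (simp add: field_simps)
  qed
  then show ?thesis unfolding bop_def by (intro conjI ballI allI exI[of _ M] T add scale)
qed

end

section \<open>Multiplication and convolution operators\<close>

text \<open>The extremal \<open>u\<close> is the conjugate of \<open>w\<close>. Estimates of vectors
  thereby become estimates of forms.\<close>

lemma l2n_dual:
  assumes "0 \<le> C" "\<And>u. cmod (\<Sum>x\<in>A. u x * w x) \<le> C * l2n u A"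
  shows "l2n w A \<le> C"
proof (cases "l2n w A = 0")
  case False
  have "(\<Sum>x\<in>A. cnj (w x) * w x) = of_real ((l2n w A)\<^sup>2)"
    unfolding l2n_sq of_real_sum by (intro sum.cong refl) (metis complex_norm_square mult.commute of_real_power)
  then have "cmod (\<Sum>x\<in>A. cnj (w x) * w x) = (l2n w A)\<^sup>2"
    by (simp only: norm_of_real abs_power2 power2_abs abs_of_nonneg[OF zero_le_power2])
  moreover have "l2n (\<lambda>x. cnj (w x)) A = l2n w A" by (simp add: l2n_def)
  ultimately have "(l2n w A)\<^sup>2 \<le> C * l2n w A" using assms(2)[of "\<lambda>x. cnj (w x)"] by simp
  moreover have "0 < l2n w A" using False l2n_nonneg[of w A] by linarith
  ultimately show ?thesis by (simp add: power2_eq_square)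
qed (use assms in simp)

lemma l2n_sum: "finite I \<Longrightarrow> l2n (\<lambda>x. \<Sum>i\<in>I. c i * w i x) A \<le> (\<Sum>i\<in>I. cmod (c i) * l2n (w i) A)"
proof (induction I rule: finite_induct)
  case (insert i I)
  have "l2n (\<lambda>x. c i * w i x + (\<Sum>i\<in>I. c i * w i x)) A \<le> l2n (\<lambda>x. c i * w i x) A + l2n (\<lambda>x. \<Sum>i\<in>I. c i * w i x) A"
    by (rule l2n_triangle)
  with insert show ?case by (simp add: l2n_scale)
qed (simp add: l2n_def L2_set_def)

lemma Cb_cmod_le_sup_norm: "g \<in> Cb \<Longrightarrow> cmod (g x) \<le> sup_norm g"
  unfolding sup_norm_def Cb_def bounded_iff by (intro cSUP_upper) (auto intro: bdd_aboveI2)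

lemma sup_norm_nonneg: "g \<in> Cb \<Longrightarrow> 0 \<le> sup_norm g"
  using Cb_cmod_le_sup_norm norm_ge_zero order_trans by blast

lemma sup_norm_pos: "g \<in> Cb \<Longrightarrow> g \<noteq> (\<lambda>x. 0) \<Longrightarrow> 0 < sup_norm g"
  using Cb_cmod_le_sup_norm[of g] by (metis less_le_trans zero_less_norm_iff ext)

context etale_groupoid
begin

lemma mult_operator_apply: "\<xi> \<in> L2 G \<Longrightarrow> mult_operator G g \<xi> = (\<lambda>a. g a * \<xi> a)"
  unfolding mult_operator_def operator_on_L2_def by simp

lemma mult_operator_outside: "\<xi> \<notin> L2 G \<Longrightarrow> mult_operator G g \<xi> = (\<lambda>a. 0)"
  unfolding mult_operator_def operator_on_L2_def by simp

lemma mult_operator_bop: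
  assumes "g \<in> Cb"
  shows "bop (mult_operator G g)" "\<xi> \<in> L2 G \<Longrightarrow> nrm (mult_operator G g \<xi>) \<le> sup_norm g * nrm \<xi>"
proof -
  have cont: "continuous_on UNIV g" using assms unfolding Cb_def by simp
  have L: "(\<lambda>a. g a * \<xi> a) \<in> L2 G" "nrm (\<lambda>a. g a * \<xi> a) \<le> sup_norm g * nrm \<xi>" if "\<xi> \<in> L2 G" for \<xi>
    by (rule L2_mult[OF that cont Cb_cmod_le_sup_norm[OF assms]],
        rule fl2_mult(2)[OF L2_fl2[OF that] Cb_cmod_le_sup_norm[OF assms]])
  show "\<xi> \<in> L2 G \<Longrightarrow> nrm (mult_operator G g \<xi>) \<le> sup_norm g * nrm \<xi>"
    using L(2) by (simp add: mult_operator_apply)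
  show "bop (mult_operator G g)" unfolding bop_def
    by (intro conjI ballI allI exI[of _ "sup_norm g"])
      (simp_all add: L mult_operator_apply L2_add L2_scale distrib_left mult.left_commute)
qed

text \<open>Meant for convolutions. Boundedness on \<open>fibrewise_l2 G\<close> and invariance of
  \<open>Cc\<close> together give invariance of its closure \<open>L2 G\<close>.\<close>

lemma bop_operator_on_L2:
  assumes add: "\<And>\<xi> \<eta>. T (\<lambda>a. \<xi> a + \<eta> a) = (\<lambda>a. T \<xi> a + T \<eta> a)"
    and scale: "\<And>\<xi> c. T (\<lambda>a. c * \<xi> a) = (\<lambda>a. c * T \<xi> a)"
    and Cc: "\<And>\<xi>. \<xi> \<in> Cc \<Longrightarrow> T \<xi> \<in> Cc"
    and bd: "\<And>\<xi> F x. \<xi> \<in> fibrewise_l2 G \<Longrightarrow> finite F \<Longrightarrow> F \<subseteq> fib x \<Longrightarrow> l2n (T \<xi>) F \<le> M * nrm \<xi>"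
    and M: "0 \<le> M"
  shows "bop (operator_on_L2 G T)" "\<xi> \<in> L2 G \<Longrightarrow> nrm (operator_on_L2 G T \<xi>) \<le> M * nrm \<xi>"
proof -
  have fl: "T \<xi> \<in> fibrewise_l2 G" "nrm (T \<xi>) \<le> M * nrm \<xi>" if "\<xi> \<in> fibrewise_l2 G" for \<xi>
    by (rule nrm_bound(1)[OF bd[OF that]], assumption+) (rule nrm_bound(2)[OF bd[OF that]])
  have L: "T \<xi> \<in> L2 G" if \<xi>: "\<xi> \<in> L2 G" for \<xi>
  proof (rule L2I)
    show "T \<xi> \<in> fibrewise_l2 G" by (rule fl(1)[OF L2_fl2[OF \<xi>]])
    fix e :: real assume e: "0 < e"
    obtain \<eta> where \<eta>: "\<eta> \<in> Cc" "nrm (\<lambda>a. \<xi> a - \<eta> a) < e / (M + 1)"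
      using L2_approx[OF \<xi>, of "e / (M + 1)"] e M by auto
    have "T (\<lambda>a. \<xi> a - \<eta> a) = (\<lambda>a. T \<xi> a - T \<eta> a)"
      using add[of \<xi> "\<lambda>a. -1 * \<eta> a"] scale[of "-1" \<eta>] by simp
    then have "nrm (\<lambda>a. T \<xi> a - T \<eta> a) \<le> M * nrm (\<lambda>a. \<xi> a - \<eta> a)"
      using fl(2)[OF fl2_diff(1)[OF L2_fl2[OF \<xi>] Cc_fl2[OF \<eta>(1)]]] by simp
    also have "\<dots> \<le> M * (e / (M + 1))" using \<eta>(2) M by (intro mult_left_mono) auto
    also have "\<dots> < e" using M e by (simp add: field_simps)
    finally show "\<exists>\<zeta>\<in>L2 G. nrm (\<lambda>a. T \<xi> a - \<zeta> a) < e"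
      by (intro bexI[of _ "T \<eta>"] Cc_L2 Cc \<eta>(1))
  qed
  show "\<xi> \<in> L2 G \<Longrightarrow> nrm (operator_on_L2 G T \<xi>) \<le> M * nrm \<xi>"
    unfolding operator_on_L2_def using fl(2)[OF L2_fl2] by simp
  show "bop (operator_on_L2 G T)" unfolding bop_def
    by (intro conjI ballI allI exI[of _ M])
      (simp_all add: operator_on_L2_def L add scale L2_add L2_scale fl(2)[OF L2_fl2])
qed

text \<open>The convolution product. Fixing its first factor gives \<open>left_regular\<close>,
  fixing its second gives \<open>right_conv\<close>, so that their commutation is
  associativity.\<close>

definition conv :: "('a \<Rightarrow> complex) \<Rightarrow> ('a \<Rightarrow> complex) \<Rightarrow> 'a \<Rightarrow> complex" where
  "conv f \<xi> c = (\<Sum>\<^sub>\<infinity>a\<in>fib (sc c). f (c \<cdot> iv a) * \<xi> a)"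

lemma left_regular_conv: "left_regular G f = operator_on_L2 G (conv f)"
  unfolding left_regular_def conv_def ..

lemma right_conv_conv: "right_conv G g = operator_on_L2 G (\<lambda>\<xi>. conv \<xi> g)"
  unfolding right_conv_def conv_def by (simp add: mult.commute)

lemma operator_on_L2_apply: "\<xi> \<in> L2 G \<Longrightarrow> operator_on_L2 G T \<xi> = T \<xi>"
  unfolding operator_on_L2_def by simp

lemma operator_on_L2_outside: "\<xi> \<notin> L2 G \<Longrightarrow> operator_on_L2 G T \<xi> = (\<lambda>a. 0)"
  unfolding operator_on_L2_def by simp

section \<open>Convolution: finite sums, bounds and associativity\<close>

lemma conv_sum:
  assumes "finite F" "F \<subseteq> fib (sc c)" "\<And>a. sc a = sc c \<Longrightarrow> a \<notin> F \<Longrightarrow> f (c \<cdot> iv a) = 0 \<or> \<xi> a = 0"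
  shows "conv f \<xi> c = (\<Sum>a\<in>F. f (c \<cdot> iv a) * \<xi> a)"
  unfolding conv_def by (rule infsum_fib) (use assms in auto)

text \<open>A nonzero term at \<open>a\<close> factors \<open>c\<close> as the product of
  \<open>c \<cdot> iv a\<close> and \<open>a\<close>, so the support lies in a product of
  supports.\<close>

lemma conv_Cc:
  assumes "f \<in> Cc" "\<xi> \<in> Cc"
  shows "conv f \<xi> \<in> Cc"
proof (rule CcI)
  have "continuous_on {p. sc (fst p) = sc (snd p)} (\<lambda>p. fst p \<cdot> iv (snd p))"
    by (intro cont_mult) (auto intro!: cont_intros)
  then have "continuous_on {p. sc (fst p) = sc (snd p)} (\<lambda>p. f (fst p \<cdot> iv (snd p)) * \<xi> (snd p))"
    by (intro continuous_intros continuous_on_compose2[OF Cc_cont[OF assms(1)] _ subset_UNIV]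
        continuous_on_compose2[OF Cc_cont[OF assms(2)] _ subset_UNIV])
  then have "continuous_on UNIV (\<lambda>c. \<Sum>\<^sub>\<infinity>a\<in>fib (sc c). f (c \<cdot> iv a) * \<xi> a)"
    by (intro cont_fibre_sum[OF Cc_compact[OF assms(2)]]) (simp_all add: supp_outside)
  then show "continuous_on UNIV (conv f \<xi>)" by (simp add: conv_def[abs_def])
  show "compact (set_mult G (supp f) (supp \<xi>))"
    by (rule compact_set_mult[OF Cc_compact[OF assms(1)] Cc_compact[OF assms(2)]])
  fix c assume c: "conv f \<xi> c \<noteq> 0"
  have "\<exists>a\<in>fib (sc c). f (c \<cdot> iv a) * \<xi> a \<noteq> 0"
  proof (rule ccontr)
    assume "\<not> (\<exists>a\<in>fib (sc c). f (c \<cdot> iv a) * \<xi> a \<noteq> 0)"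
    then have "conv f \<xi> c = 0" unfolding conv_def by (intro infsum_0) blast
    with c show False by contradiction
  qed
  then obtain a where a: "sc a = sc c" "f (c \<cdot> iv a) * \<xi> a \<noteq> 0" by auto
  then have "c \<cdot> iv a \<in> supp f" "a \<in> supp \<xi>" using suppI by auto
  then have "c \<cdot> iv a \<cdot> a \<in> set_mult G (supp f) (supp \<xi>)"
    using a(1) by (intro set_multI) auto
  then show "c \<in> set_mult G (supp f) (supp \<xi>)" using a(1) by (simp add: div_mult_cancel)
qed

text \<open>Right division by \<open>c\<close> embeds either set into the part of a single fibre
  inside \<open>C\<close> or its inverse. These are the row and column counts of a matrix supported
  where the quotient lies in \<open>C\<close>.\<close>

lemma card_quotient_fibre:
  assumes "compact C"
  shows "\<exists>N::nat. \<forall>c. finite {a \<in> fib (sc c). c \<cdot> iv a \<in> C} \<and> card {a \<in> fib (sc c). c \<cdot> iv a \<in> C} \<le> N \<and>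
    finite {a \<in> fib (sc c). a \<cdot> iv c \<in> C} \<and> card {a \<in> fib (sc c). a \<cdot> iv c \<in> C} \<le> N"
proof -
  obtain N where N: "\<And>x. finite (fib x \<inter> C)" "\<And>x. card (fib x \<inter> C) \<le> N"
    using compact_fib_card[OF assms] by metis
  obtain N' where N': "\<And>x. finite (fib x \<inter> iv ` C)" "\<And>x. card (fib x \<inter> iv ` C) \<le> N'"
    using compact_fib_card[OF compact_iv[OF assms]] by metis
  have i1: "inj_on (\<lambda>a. a \<cdot> iv c) {a \<in> fib (sc c). c \<cdot> iv a \<in> C}" for c
    by (rule inj_onI) (simp, metis div_inj)
  have s1: "(\<lambda>a. a \<cdot> iv c) ` {a \<in> fib (sc c). c \<cdot> iv a \<in> C} \<subseteq> fib (rg c) \<inter> iv ` C" for c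
  proof (rule image_subsetI)
    fix a assume "a \<in> {a \<in> fib (sc c). c \<cdot> iv a \<in> C}"
    then show "a \<cdot> iv c \<in> fib (rg c) \<inter> iv ` C"
      by (auto intro!: image_eqI[of _ _ "c \<cdot> iv a"])
  qed
  have i2: "inj_on (\<lambda>c. c \<cdot> iv a) {c \<in> fib (sc a). c \<cdot> iv a \<in> C}" for a
    by (rule inj_onI) (simp, metis div_inj)
  have s2: "(\<lambda>c. c \<cdot> iv a) ` {c \<in> fib (sc a). c \<cdot> iv a \<in> C} \<subseteq> fib (rg a) \<inter> C" for a
    by auto
  show ?thesis
  proof (intro exI[of _ "max N N'"] allI conjI)
    show "finite {a \<in> fib (sc c). c \<cdot> iv a \<in> C}" for c
      by (rule inj_on_finite[OF i1 s1 N'(1)])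
    show "card {a \<in> fib (sc c). c \<cdot> iv a \<in> C} \<le> max N N'" for c
      by (rule order_trans[OF card_inj_on_le[OF i1 s1 N'(1)]]) (simp add: N'(2) le_max_iff_disj)
    show "finite {c \<in> fib (sc a). c \<cdot> iv a \<in> C}" for a
      by (rule inj_on_finite[OF i2 s2 N(1)])
    show "card {c \<in> fib (sc a). c \<cdot> iv a \<in> C} \<le> max N N'" for a
      by (rule order_trans[OF card_inj_on_le[OF i2 s2 N(1)]]) (simp add: N(2) le_max_iff_disj)
  qed
qed

lemma conv_quotient_sum:
  assumes "f \<in> Cc"
  shows "conv f \<xi> c = (\<Sum>a\<in>{a \<in> fib (sc c). c \<cdot> iv a \<in> supp f}. f (c \<cdot> iv a) * \<xi> a)"
proof -
  have "finite {a \<in> fib (sc c). c \<cdot> iv a \<in> supp f}"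
    using card_quotient_fibre[OF Cc_compact[OF assms]] by blast
  then show ?thesis by (intro conv_sum) (auto simp: supp_outside)
qed

text \<open>The Schur test in dual form: the matrix \<open>f (c \<cdot> iv a)\<close> has bounded
  entries and boundedly many nonzero ones in each row and column.\<close>

lemma conv_bound:
  assumes f: "f \<in> Cc"
  obtains M where "0 \<le> M" "\<And>\<xi> F x. \<xi> \<in> fibrewise_l2 G \<Longrightarrow> finite F \<Longrightarrow> F \<subseteq> fib x \<Longrightarrow> l2n (conv f \<xi>) F \<le> M * nrm \<xi>"
proof -
  obtain B where B: "0 \<le> B" "\<And>a. cmod (f a) \<le> B" using Cc_bounded[OF f] by metis
  obtain N where N: "\<And>c. finite {a \<in> fib (sc c). c \<cdot> iv a \<in> supp f}" "\<And>c. card {a \<in> fib (sc c). c \<cdot> iv a \<in> supp f} \<le> N"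
    "\<And>a. finite {c \<in> fib (sc a). c \<cdot> iv a \<in> supp f}" "\<And>a. card {c \<in> fib (sc a). c \<cdot> iv a \<in> supp f} \<le> N"
    using card_quotient_fibre[OF Cc_compact[OF f]] by blast
  have "l2n (conv f \<xi>) F \<le> B * N * nrm \<xi>" if \<xi>: "\<xi> \<in> fibrewise_l2 G" and F: "finite F" "F \<subseteq> fib x" for \<xi> F x
  proof (rule l2n_dual)
    show "0 \<le> B * N * nrm \<xi>" using B(1) nrm_nonneg[OF \<xi>] by simp
    fix u
    define D where "D = (\<Union>c\<in>F. {a \<in> fib (sc c). c \<cdot> iv a \<in> supp f})"
    have fD: "finite D" unfolding D_def using F N(1) by simp
    have Dx: "D \<subseteq> fib x" unfolding D_def using F(2) by auto
    have Fx: "sc c = x" if "c \<in> F" for c using F(2) that by auto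
    have "(\<Sum>c\<in>F. u c * conv f \<xi> c) = (\<Sum>c\<in>F. \<Sum>a\<in>D. u c * (f (c \<cdot> iv a) * \<xi> a))"
    proof (rule sum.cong[OF refl])
      fix c assume c: "c \<in> F"
      have "conv f \<xi> c = (\<Sum>a\<in>D. f (c \<cdot> iv a) * \<xi> a)"
        by (rule conv_sum[OF fD]) (use Dx Fx[OF c] c supp_outside[of _ f] in \<open>auto simp: D_def\<close>)
      then show "u c * conv f \<xi> c = (\<Sum>a\<in>D. u c * (f (c \<cdot> iv a) * \<xi> a))" by (simp add: sum_distrib_left)
    qed
    also have "cmod \<dots> \<le> (\<Sum>c\<in>F. \<Sum>a\<in>D. cmod (u c * (f (c \<cdot> iv a) * \<xi> a)))"
      by (intro order_trans[OF norm_sum] sum_mono norm_sum)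
    also have "\<dots> \<le> (\<Sum>c\<in>F. \<Sum>a\<in>D. B * (of_bool (c \<cdot> iv a \<in> supp f) * (cmod (u c) * cmod (\<xi> a))))"
    proof (intro sum_mono)
      fix c a
      have "cmod (f (c \<cdot> iv a)) \<le> B * of_bool (c \<cdot> iv a \<in> supp f)"
        using B(2) supp_outside[of "c \<cdot> iv a" f] by (cases "c \<cdot> iv a \<in> supp f") auto
      then show "cmod (u c * (f (c \<cdot> iv a) * \<xi> a)) \<le> B * (of_bool (c \<cdot> iv a \<in> supp f) * (cmod (u c) * cmod (\<xi> a)))"
        using mult_right_mono[of "cmod (f (c \<cdot> iv a))" "B * of_bool (c \<cdot> iv a \<in> supp f)" "cmod (u c) * cmod (\<xi> a)"]
        by (simp add: norm_mult mult_ac)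
    qed
    also have "\<dots> = B * (\<Sum>c\<in>F. \<Sum>a\<in>D. of_bool (c \<cdot> iv a \<in> supp f) * (cmod (u c) * cmod (\<xi> a)))"
      by (simp add: sum_distrib_left)
    also have "\<dots> \<le> B * (real N * (l2n u F * l2n \<xi> D))"
    proof (intro mult_left_mono schur_bound F fD B)
      fix c assume c: "c \<in> F"
      have "{a \<in> D. c \<cdot> iv a \<in> supp f} \<subseteq> {a \<in> fib (sc c). c \<cdot> iv a \<in> supp f}" using Dx Fx[OF c] by auto
      then show "card {a \<in> D. c \<cdot> iv a \<in> supp f} \<le> N" using card_mono[OF N(1)] N(2) order_trans by blast
    next
      fix a assume a: "a \<in> D"
      have "{c \<in> F. c \<cdot> iv a \<in> supp f} \<subseteq> {c \<in> fib (sc a). c \<cdot> iv a \<in> supp f}" using Dx Fx a by auto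
      then show "card {c \<in> F. c \<cdot> iv a \<in> supp f} \<le> N" using card_mono[OF N(3)] N(4) order_trans by blast
    qed
    also have "\<dots> \<le> B * (real N * (l2n u F * nrm \<xi>))"
      by (intro mult_left_mono l2n_le_nrm[OF \<xi> fD Dx]) (use B in auto)
    finally show "cmod (\<Sum>c\<in>F. u c * conv f \<xi> c) \<le> B * N * nrm \<xi> * l2n u F" by (simp only: mult_ac)
  qed
  then show thesis by (rule that[OF mult_nonneg_nonneg[OF B(1) of_nat_0_le_iff[of N]]])
qed

lemma conv_add_right: "f \<in> Cc \<Longrightarrow> conv f (\<lambda>a. \<xi> a + \<eta> a) = (\<lambda>a. conv f \<xi> a + conv f \<eta> a)"
  and conv_scale_right: "f \<in> Cc \<Longrightarrow> conv f (\<lambda>a. k * \<xi> a) = (\<lambda>a. k * conv f \<xi> a)"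
  by (simp_all add: fun_eq_iff conv_quotient_sum distrib_left sum.distrib sum_distrib_left mult.left_commute)

lemma left_regular_bop: "f \<in> Cc \<Longrightarrow> bop (left_regular G f)"
proof -
  assume f: "f \<in> Cc"
  obtain M where M: "0 \<le> M" "\<And>\<xi> F x. \<xi> \<in> fibrewise_l2 G \<Longrightarrow> finite F \<Longrightarrow> F \<subseteq> fib x \<Longrightarrow> l2n (conv f \<xi>) F \<le> M * nrm \<xi>"
    by (rule conv_bound[OF f]) (rule that)
  show ?thesis unfolding left_regular_conv
    by (rule bop_operator_on_L2(1)[OF conv_add_right[OF f] conv_scale_right[OF f] conv_Cc[OF f] M(2,1)])
qed

lemma conv_fibre_sum:
  assumes "g \<in> Cc" "sc c = x"
  shows "conv \<xi> g c = (\<Sum>b\<in>fib x \<inter> supp g. \<xi> (c \<cdot> iv b) * g b)"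
  by (rule conv_sum) (use assms finite_fib[OF Cc_compact[OF assms(1)]] in \<open>auto simp: supp_outside\<close>)

text \<open>On the fibre over \<open>x\<close>, \<open>conv \<xi> g\<close> combines at most
  \<open>N\<close> translates of \<open>\<xi>\<close>. The translate by \<open>b\<close> reads
  \<open>\<xi>\<close> injectively on the single fibre over \<open>rg b\<close>, so its norm is at
  most \<open>nrm \<xi>\<close>.\<close>

lemma right_conv_bop: "g \<in> Cc \<Longrightarrow> bop (right_conv G g)"
proof -
  assume g: "g \<in> Cc"
  obtain B where B: "0 \<le> B" "\<And>a. cmod (g a) \<le> B" using Cc_bounded[OF g] by metis
  obtain N where N: "\<And>x. finite (fib x \<inter> supp g)" "\<And>x. card (fib x \<inter> supp g) \<le> N"
    using compact_fib_card[OF Cc_compact[OF g]] by metis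
  have add: "conv (\<lambda>a. \<xi> a + \<eta> a) g = (\<lambda>a. conv \<xi> g a + conv \<eta> g a)" for \<xi> \<eta>
    by (simp add: fun_eq_iff conv_fibre_sum[OF g refl] distrib_right sum.distrib)
  have scale: "conv (\<lambda>a. k * \<xi> a) g = (\<lambda>a. k * conv \<xi> g a)" for k \<xi>
    by (simp add: fun_eq_iff conv_fibre_sum[OF g refl] sum_distrib_left mult_ac)
  have bd: "l2n (conv \<xi> g) F \<le> real N * B * nrm \<xi>" if \<xi>: "\<xi> \<in> fibrewise_l2 G" and F: "finite F" "F \<subseteq> fib x" for \<xi> F x
  proof -
    have n0: "0 \<le> nrm \<xi>" by (rule nrm_nonneg[OF \<xi>])
    have tr: "l2n (\<lambda>c. \<xi> (c \<cdot> iv b)) F \<le> nrm \<xi>" if b: "b \<in> fib x" for b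
    proof -
      have inj: "inj_on (\<lambda>c. c \<cdot> iv b) F"
      proof (rule inj_onI)
        fix c d assume "c \<in> F" "d \<in> F" "c \<cdot> iv b = d \<cdot> iv b"
        moreover have "sc c = sc b" "sc d = sc b" using F(2) b \<open>c \<in> F\<close> \<open>d \<in> F\<close> by auto
        ultimately show "c = d" using div_inj[of c b d] by simp
      qed
      have "l2n (\<lambda>c. \<xi> (c \<cdot> iv b)) F = l2n \<xi> ((\<lambda>c. c \<cdot> iv b) ` F)"
        unfolding l2n_def L2_set_def using inj by (simp add: sum.reindex)
      also have "\<dots> \<le> nrm \<xi>"
        by (rule l2n_le_nrm[OF \<xi>, of _ "rg b"]) (use F b in auto)
      finally show ?thesis .
    qed
    have "l2n (conv \<xi> g) F = l2n (\<lambda>c. \<Sum>b\<in>fib x \<inter> supp g. g b * \<xi> (c \<cdot> iv b)) F"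
      using F(2) by (intro l2n_cong) (auto simp: conv_fibre_sum[OF g] mult.commute)
    also have "\<dots> \<le> (\<Sum>b\<in>fib x \<inter> supp g. cmod (g b) * l2n (\<lambda>c. \<xi> (c \<cdot> iv b)) F)"
      by (rule l2n_sum[OF N(1)])
    also have "\<dots> \<le> real (card (fib x \<inter> supp g)) * (B * nrm \<xi>)"
      using B tr by (intro sum_bounded_above mult_mono) auto
    also have "\<dots> \<le> real N * (B * nrm \<xi>)" using N(2) B n0 by (intro mult_right_mono) auto
    finally show ?thesis by simp
  qed
  show ?thesis unfolding right_conv_conv
    by (rule bop_operator_on_L2(1)[OF add scale conv_Cc[OF _ g] bd]) (use B in auto)
qed

text \<open>For arbitrary \<open>\<xi>\<close>, the compact supports of the outer factors make both
  sums finite, so they may be interchanged. The substitution is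
  \<open>a = d \<cdot> b\<close>.\<close>

lemma conv_assoc:
  assumes "f \<in> Cc" "g \<in> Cc"
  shows "conv f (conv \<xi> g) = conv (conv f \<xi>) g"
proof
  fix c
  define D where "D = fib (sc c) \<inter> supp g"
  have fD: "finite D" unfolding D_def by (rule finite_fib[OF Cc_compact[OF assms(2)]])
  define E where "E = {a \<in> fib (sc c). c \<cdot> iv a \<in> supp f}"
  have fE: "finite E" unfolding E_def using card_quotient_fibre[OF Cc_compact[OF assms(1)]] by blast
  have "conv f (conv \<xi> g) c = (\<Sum>a\<in>E. f (c \<cdot> iv a) * conv \<xi> g a)"
    unfolding E_def by (rule conv_quotient_sum[OF assms(1)])
  also have "\<dots> = (\<Sum>a\<in>E. \<Sum>b\<in>D. f (c \<cdot> iv a) * (\<xi> (a \<cdot> iv b) * g b))"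
    unfolding D_def by (intro sum.cong refl) (auto simp: E_def conv_fibre_sum[OF assms(2)] sum_distrib_left)
  also have "\<dots> = (\<Sum>b\<in>D. \<Sum>a\<in>E. f (c \<cdot> iv a) * (\<xi> (a \<cdot> iv b) * g b))" by (rule sum.swap)
  also have "\<dots> = (\<Sum>b\<in>D. conv f \<xi> (c \<cdot> iv b) * g b)"
  proof (rule sum.cong[OF refl])
    fix b assume b: "b \<in> D"
    then have scb: "sc b = sc c" unfolding D_def by simp
    have "(\<Sum>a\<in>E. f (c \<cdot> iv a) * \<xi> (a \<cdot> iv b)) = (\<Sum>\<^sub>\<infinity>a\<in>fib (sc b). f (c \<cdot> iv a) * \<xi> (a \<cdot> iv b))"
      by (rule infsum_fib[symmetric]) (use fE scb supp_outside in \<open>auto simp: E_def\<close>)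
    also have "\<dots> = (\<Sum>\<^sub>\<infinity>d\<in>fib (rg b). f (c \<cdot> iv (d \<cdot> b)) * \<xi> (d \<cdot> b \<cdot> iv b))"
      by (rule infsum_fib_right_mult)
    also have "\<dots> = (\<Sum>\<^sub>\<infinity>d\<in>fib (rg b). f (c \<cdot> iv b \<cdot> iv d) * \<xi> d)"
    proof (rule infsum_cong)
      fix d assume "d \<in> fib (rg b)"
      then have d: "sc d = rg b" by simp
      have "c \<cdot> iv (d \<cdot> b) = c \<cdot> iv b \<cdot> iv d"
        unfolding iv_distrib[OF d] using mult_assoc[of c "iv b" "iv d"] d scb by simp
      then show "f (c \<cdot> iv (d \<cdot> b)) * \<xi> (d \<cdot> b \<cdot> iv b) = f (c \<cdot> iv b \<cdot> iv d) * \<xi> d"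
        by (simp only: mult_iv_cancel[OF d])
    qed
    also have "\<dots> = conv f \<xi> (c \<cdot> iv b)" unfolding conv_def using scb by simp
    finally have "(\<Sum>a\<in>E. f (c \<cdot> iv a) * \<xi> (a \<cdot> iv b)) * g b = conv f \<xi> (c \<cdot> iv b) * g b"
      by simp
    then show "(\<Sum>a\<in>E. f (c \<cdot> iv a) * (\<xi> (a \<cdot> iv b) * g b)) = conv f \<xi> (c \<cdot> iv b) * g b"
      by (simp only: sum_distrib_right mult.assoc)
  qed
  also have "\<dots> = conv (conv f \<xi>) g c" unfolding D_def by (rule conv_fibre_sum[OF assms(2) refl, symmetric])
  finally show "conv f (conv \<xi> g) c = conv (conv f \<xi>) g c" .
qed

section \<open>The left regular representation\<close>

lemma left_regular_apply: "\<xi> \<in> L2 G \<Longrightarrow> left_regular G f \<xi> = conv f \<xi>"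
  unfolding left_regular_conv by (rule operator_on_L2_apply)

lemma right_conv_apply: "\<xi> \<in> L2 G \<Longrightarrow> right_conv G g \<xi> = conv \<xi> g"
  unfolding right_conv_conv by (rule operator_on_L2_apply)

lemma left_regular_commutes:
  assumes "f \<in> Cc" "g \<in> Cc" "\<xi> \<in> L2 G"
  shows "left_regular G f (right_conv G g \<xi>) = right_conv G g (left_regular G f \<xi>)"
  using assms bop_L2[OF right_conv_bop[OF assms(2)] assms(3)] bop_L2[OF left_regular_bop[OF assms(1)] assms(3)]
  by (simp add: left_regular_apply right_conv_apply conv_assoc)

text \<open>With both vectors in \<open>Cc\<close> everything is a finite double sum over
  \<open>B\<close>. Since \<open>f\<close> enters only through the quotient
  \<open>c \<cdot> iv a\<close>, whose inverse is \<open>a \<cdot> iv c\<close>, interchanging the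
  sums produces the involution of \<open>f\<close>.\<close>

lemma inn_conv_Cc:
  assumes f: "f \<in> Cc" and \<xi>: "\<xi> \<in> Cc" and \<eta>: "\<eta> \<in> Cc"
  shows "inn (conv f \<xi>) \<eta> x = inn \<xi> (conv (\<lambda>a. cnj (f (iv a))) \<eta>) x"
proof -
  define B where "B = fib x \<inter> (supp \<xi> \<union> supp \<eta>)"
  have fB: "finite B" unfolding B_def by (intro finite_fib compact_Un Cc_compact \<xi> \<eta>)
  have 1: "conv h \<zeta> c = (\<Sum>a\<in>B. h (c \<cdot> iv a) * \<zeta> a)" if "sc c = x" "\<zeta> = \<xi> \<or> \<zeta> = \<eta>" for h \<zeta> c
    by (rule conv_sum[OF fB]) (use that in \<open>auto simp: B_def supp_outside\<close>)
  have "inn (conv f \<xi>) \<eta> x = (\<Sum>c\<in>B. cnj (conv f \<xi> c) * \<eta> c)"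
    unfolding L2_inner_def by (rule infsum_fib[OF fB]) (auto simp: B_def supp_outside)
  also have "\<dots> = (\<Sum>c\<in>B. \<Sum>a\<in>B. cnj (f (c \<cdot> iv a)) * cnj (\<xi> a) * \<eta> c)"
    by (intro sum.cong refl) (simp add: 1 B_def[THEN eqset_imp_iff] sum_distrib_right)
  also have "\<dots> = (\<Sum>a\<in>B. \<Sum>c\<in>B. cnj (f (c \<cdot> iv a)) * cnj (\<xi> a) * \<eta> c)" by (rule sum.swap)
  also have "\<dots> = (\<Sum>a\<in>B. cnj (\<xi> a) * conv (\<lambda>a. cnj (f (iv a))) \<eta> a)"
    by (intro sum.cong refl) (auto simp: 1 B_def[THEN eqset_imp_iff] sum_distrib_left mult_ac intro!: sum.cong)
  also have "\<dots> = inn \<xi> (conv (\<lambda>a. cnj (f (iv a))) \<eta>) x"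
    unfolding L2_inner_def by (rule infsum_fib[OF fB, symmetric]) (auto simp: B_def supp_outside)
  finally show ?thesis .
qed

lemma Cc_star: "f \<in> Cc \<Longrightarrow> (\<lambda>a. cnj (f (iv a))) \<in> Cc"
proof (rule CcI)
  assume f: "f \<in> Cc"
  show "continuous_on UNIV (\<lambda>a. cnj (f (iv a)))"
    by (intro continuous_intros continuous_on_compose2[OF Cc_cont[OF f] cont_iv subset_UNIV])
  show "compact (iv ` supp f)" by (rule compact_iv[OF Cc_compact[OF f]])
  fix a assume "cnj (f (iv a)) \<noteq> 0"
  then show "a \<in> iv ` supp f" using suppI[of f "iv a"] by (intro image_eqI[of _ _ "iv a"]) auto
qed

lemma adjoint_extend_left:
  assumes A: "bop A" and eq: "\<And>\<xi>. \<xi> \<in> Cc \<Longrightarrow> inn (A \<xi>) \<eta> x = inn \<xi> \<zeta> x"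
    and \<xi>: "\<xi> \<in> L2 G" and \<eta>: "\<eta> \<in> L2 G" and \<zeta>: "\<zeta> \<in> L2 G"
  shows "inn (A \<xi>) \<eta> x = inn \<xi> \<zeta> x"
proof -
  obtain M where M: "0 \<le> M" "\<And>\<xi>. \<xi> \<in> L2 G \<Longrightarrow> nrm (A \<xi>) \<le> M * nrm \<xi>" using bop_bound[OF A] by blast
  \<comment> \<open>Both sides are Lipschitz in \<open>\<xi>\<close>, with total constant
    \<open>k\<close>.\<close>
  define k where "k = M * nrm \<eta> + nrm \<zeta>"
  have n: "0 \<le> nrm \<eta>" "0 \<le> nrm \<zeta>" by (intro nrm_nonneg L2_fl2 \<eta> \<zeta>)+
  then have k: "0 \<le> k" unfolding k_def using M(1) by simp
  have "cmod (inn (A \<xi>) \<eta> x - inn \<xi> \<zeta> x) \<le> e" if e: "0 < e" for e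
  proof -
    have "0 < e / (k + 1)" using e k by simp
    then obtain \<theta> where \<theta>: "\<theta> \<in> Cc" "nrm (\<lambda>a. \<xi> a - \<theta> a) < e / (k + 1)" by (rule L2_approx[OF \<xi>])
    have \<theta>L: "\<theta> \<in> L2 G" by (rule Cc_L2[OF \<theta>(1)])
    have d: "(\<lambda>a. \<xi> a - \<theta> a) \<in> L2 G" by (rule L2_diff[OF \<xi> \<theta>L])
    have "inn (A (\<lambda>a. \<xi> a - \<theta> a)) \<eta> x = inn (A \<xi>) \<eta> x - inn (A \<theta>) \<eta> x"
      unfolding bop_diff[OF A \<xi> \<theta>L]
      by (rule inn_diff_left[OF L2_fl2[OF \<eta>] L2_fl2[OF bop_L2[OF A \<xi>]] L2_fl2[OF bop_L2[OF A \<theta>L]]])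
    moreover have "inn (\<lambda>a. \<xi> a - \<theta> a) \<zeta> x = inn \<xi> \<zeta> x - inn \<theta> \<zeta> x"
      by (rule inn_diff_left[OF L2_fl2[OF \<zeta>] L2_fl2[OF \<xi>] L2_fl2[OF \<theta>L]])
    ultimately have "inn (A \<xi>) \<eta> x - inn \<xi> \<zeta> x = inn (A (\<lambda>a. \<xi> a - \<theta> a)) \<eta> x - inn (\<lambda>a. \<xi> a - \<theta> a) \<zeta> x"
      using eq[OF \<theta>(1)] by simp
    also have "cmod \<dots> \<le> nrm (A (\<lambda>a. \<xi> a - \<theta> a)) * nrm \<eta> + nrm (\<lambda>a. \<xi> a - \<theta> a) * nrm \<zeta>"
      by (rule order_trans[OF norm_triangle_ineq4 add_mono[OF inn_bound[OF L2_fl2[OF bop_L2[OF A d]] L2_fl2[OF \<eta>]]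
          inn_bound[OF L2_fl2[OF d] L2_fl2[OF \<zeta>]]]])
    also have "\<dots> \<le> (M * nrm (\<lambda>a. \<xi> a - \<theta> a)) * nrm \<eta> + nrm (\<lambda>a. \<xi> a - \<theta> a) * nrm \<zeta>"
      by (intro add_right_mono mult_right_mono M(2) d n)
    also have "\<dots> = k * nrm (\<lambda>a. \<xi> a - \<theta> a)" unfolding k_def by (simp add: algebra_simps)
    also have "\<dots> \<le> k * (e / (k + 1))" by (intro mult_left_mono less_imp_le[OF \<theta>(2)] k)
    also have "\<dots> \<le> e" using e k by (simp add: field_simps)
    finally show ?thesis .
  qed
  then have "cmod (inn (A \<xi>) \<eta> x - inn \<xi> \<zeta> x) \<le> 0" by (rule field_le_epsilon[of _ 0, simplified])
  then show ?thesis by simp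
qed

text \<open>Density is used in one variable at a time; conjugation exchanges the roles of
  \<open>A\<close> and \<open>B\<close>.\<close>

lemma adjoint_extend:
  assumes A: "bop A" and B: "bop B"
    and eq: "\<And>\<xi> \<eta>. \<xi> \<in> Cc \<Longrightarrow> \<eta> \<in> Cc \<Longrightarrow> inn (A \<xi>) \<eta> x = inn \<xi> (B \<eta>) x"
    and \<xi>: "\<xi> \<in> L2 G" and \<eta>: "\<eta> \<in> L2 G"
  shows "inn (A \<xi>) \<eta> x = inn \<xi> (B \<eta>) x"
proof -
  have "inn (B \<zeta>) \<xi> x = inn \<zeta> (A \<xi>) x" if \<zeta>: "\<zeta> \<in> Cc" for \<zeta>
    using adjoint_extend_left[OF A eq[OF _ \<zeta>] \<xi> Cc_L2[OF \<zeta>] bop_L2[OF B Cc_L2[OF \<zeta>]]]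
    by (simp add: inn_commute[of "B \<zeta>" \<xi>] inn_commute[of \<zeta> "A \<xi>"])
  then have "inn (B \<eta>) \<xi> x = inn \<eta> (A \<xi>) x"
    by (rule adjoint_extend_left[OF B _ \<eta> \<xi> bop_L2[OF A \<xi>]])
  then show ?thesis
    by (simp add: inn_commute[of "A \<xi>" \<eta>] inn_commute[of \<xi> "B \<eta>"])
qed

lemma left_regular_adjointable:
  assumes f: "f \<in> Cc"
  shows "left_regular G f \<in> adjointable_operators G"
proof -
  let ?S = "left_regular G (\<lambda>a. cnj (f (iv a)))"
  have bT: "bop (left_regular G f)" and bS: "bop ?S"
    using left_regular_bop f Cc_star[OF f] by auto
  have "inn (left_regular G f \<xi>) \<eta> x = inn \<xi> (?S \<eta>) x" if "\<xi> \<in> L2 G" "\<eta> \<in> L2 G" for \<xi> \<eta> x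
    by (rule adjoint_extend[OF bT bS _ that]) (simp add: left_regular_apply Cc_L2 inn_conv_Cc[OF f])
  then have "\<exists>S. S ` L2 G \<subseteq> L2 G \<and> (\<forall>\<xi>\<in>L2 G. \<forall>\<eta>\<in>L2 G. \<forall>x\<in>units G. inn (left_regular G f \<xi>) \<eta> x = inn \<xi> (S \<eta>) x)"
    using bop_L2[OF bS] by (intro exI[of _ ?S]) auto
  then show ?thesis unfolding adjointable_operators_def
    using bop_L2[OF bT] by (auto simp: left_regular_conv operator_on_L2_outside)
qed

text \<open>The compact set is the support of \<open>f\<close>: a nonzero term
  \<open>f (c \<cdot> iv a) * (g a * \<xi> a)\<close> puts \<open>c\<close> into the product of the
  supports of \<open>f\<close> and \<open>g\<close>.\<close>

lemma left_regular_compactly_supported: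
  assumes f: "f \<in> Cc"
  shows "left_regular G f \<in> compactly_supported_operators G"
proof -
  have "mult_operator G h \<circ> left_regular G f \<circ> mult_operator G g = zero_operator"
    if g: "g \<in> Cb" and h: "h \<in> Cb" and sep: "separated G (supp f) g h" for g h
  proof (rule ext)
    fix \<xi>
    have bg: "bop (mult_operator G g)" and bh: "bop (mult_operator G h)"
      using mult_operator_bop g h by auto
    have bf: "bop (left_regular G f)" by (rule left_regular_bop[OF f])
    show "(mult_operator G h \<circ> left_regular G f \<circ> mult_operator G g) \<xi> = zero_operator \<xi>"
    proof (cases "\<xi> \<in> L2 G")
      case False
      then show ?thesis
        by (simp add: mult_operator_outside bop_zero[OF bf] bop_zero[OF bh] zero_operator_def)
    next
      case True
      have L: "mult_operator G g \<xi> \<in> L2 G" by (rule bop_L2[OF bg True])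
      have "h c * conv f (\<lambda>a. g a * \<xi> a) c = 0" for c
      proof (cases "h c = 0")
        case False
        have "conv f (\<lambda>a. g a * \<xi> a) c = 0"
          unfolding conv_def
        proof (rule infsum_0)
          fix a assume "a \<in> fib (sc c)"
          then have a: "sc a = sc c" by simp
          show "f (c \<cdot> iv a) * (g a * \<xi> a) = 0"
          proof (rule ccontr)
            assume "f (c \<cdot> iv a) * (g a * \<xi> a) \<noteq> 0"
            then have "c \<cdot> iv a \<in> supp f" "a \<in> supp g" using suppI by auto
            then have "c \<cdot> iv a \<cdot> a \<in> set_mult G (supp f) (supp g)" using a by (intro set_multI) auto
            then have "c \<in> set_mult G (supp f) (supp g)" using a by (simp add: div_mult_cancel)
            then show False using sep suppI[of h c, OF False] unfolding separated_def by auto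
          qed
        qed
        then show ?thesis by simp
      qed simp
      then show ?thesis using True L bop_L2[OF bf L]
        by (simp add: mult_operator_apply left_regular_apply zero_operator_def fun_eq_iff)
    qed
  qed
  then show ?thesis unfolding compactly_supported_operators_def
    using left_regular_adjointable[OF f] Cc_compact[OF f] by auto
qed

section \<open>Passage to norm limits and the inclusions valid for every etale groupoid\<close>

lemma bop_commute_limit:
  assumes T: "bop T" and R: "bop R"
    and ap: "\<And>e. 0 < e \<Longrightarrow> \<exists>S. bop S \<and> (\<forall>\<xi>\<in>L2 G. S (R \<xi>) = R (S \<xi>)) \<and> operator_norm G (\<lambda>\<xi> a. T \<xi> a - S \<xi> a) < e"
    and \<xi>: "\<xi> \<in> L2 G"
  shows "T (R \<xi>) = R (T \<xi>)"
proof -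
  obtain M where M: "0 \<le> M" "\<And>\<xi>. \<xi> \<in> L2 G \<Longrightarrow> nrm (R \<xi>) \<le> M * nrm \<xi>" using bop_bound[OF R] by blast
  have L: "T \<xi> \<in> L2 G" "R \<xi> \<in> L2 G" "T (R \<xi>) \<in> L2 G" "R (T \<xi>) \<in> L2 G" using bop_L2 T R \<xi> by auto
  have n: "0 \<le> nrm \<xi>" by (rule nrm_nonneg[OF L2_fl2[OF \<xi>]])
  have "nrm (\<lambda>a. T (R \<xi>) a - R (T \<xi>) a) \<le> d" if "0 < d" for d
  proof -
    \<comment> \<open>The commutator with \<open>R\<close> is at most
      \<open>2 * M * e * nrm \<xi>\<close>; adding 1 keeps the denominator positive.\<close>
    define e where "e = d / (2 * M * nrm \<xi> + 1)"
    have e: "0 < e" unfolding e_def using that M n by (simp add: add_nonneg_pos)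
    obtain S where S: "bop S" "S (R \<xi>) = R (S \<xi>)" "operator_norm G (\<lambda>\<xi> a. T \<xi> a - S \<xi> a) < e"
      using ap[OF e] \<xi> by blast
    let ?D = "\<lambda>\<xi> a. T \<xi> a - S \<xi> a"
    have bD: "bop ?D" by (rule bop_minus[OF T S(1)])
    have D: "nrm (?D \<zeta>) \<le> e * nrm \<zeta>" if "\<zeta> \<in> L2 G" for \<zeta>
      using nrm_le_operator_norm[OF bD that] mult_right_mono[OF less_imp_le[OF S(3)] nrm_nonneg[OF L2_fl2[OF that]]] by linarith
    have "R (?D \<xi>) = (\<lambda>a. R (T \<xi>) a - R (S \<xi>) a)" by (rule bop_diff[OF R L(1) bop_L2[OF S(1) \<xi>]])
    then have "(\<lambda>a. T (R \<xi>) a - R (T \<xi>) a) = (\<lambda>a. ?D (R \<xi>) a - R (?D \<xi>) a)"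
      using S(2) by simp
    then have "nrm (\<lambda>a. T (R \<xi>) a - R (T \<xi>) a) \<le> nrm (?D (R \<xi>)) + nrm (R (?D \<xi>))"
      using fl2_diff(2)[OF L2_fl2[OF bop_L2[OF bD L(2)]] L2_fl2[OF bop_L2[OF R bop_L2[OF bD \<xi>]]]] by simp
    also have "\<dots> \<le> e * (M * nrm \<xi>) + M * (e * nrm \<xi>)"
    proof (rule add_mono)
      show "nrm (?D (R \<xi>)) \<le> e * (M * nrm \<xi>)"
        by (rule order_trans[OF D[OF L(2)] mult_left_mono[OF M(2)[OF \<xi>]]]) (use e in simp)
      show "nrm (R (?D \<xi>)) \<le> M * (e * nrm \<xi>)"
        by (rule order_trans[OF M(2)[OF bop_L2[OF bD \<xi>]] mult_left_mono[OF D[OF \<xi>] M(1)]])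
    qed
    also have "\<dots> = e * (2 * M * nrm \<xi>)" by simp
    also have "\<dots> \<le> e * (2 * M * nrm \<xi> + 1)" using e by (intro mult_left_mono) auto
    also have "\<dots> = d"
    proof -
      have "2 * M * nrm \<xi> + 1 \<noteq> 0" using M(1) n by (simp add: add_nonneg_eq_0_iff)
      then show ?thesis unfolding e_def by simp
    qed
    finally show ?thesis .
  qed
  then have "nrm (\<lambda>a. T (R \<xi>) a - R (T \<xi>) a) \<le> 0" by (rule field_le_epsilon[of _ 0, simplified])
  then have "T (R \<xi>) a - R (T \<xi>) a = 0" for a
    using cmod_le_nrm[OF L2_fl2[OF L2_diff[OF L(3,4)]], of a] by (metis norm_le_zero_iff order_trans)
  then show ?thesis by (simp add: fun_eq_iff)
qed

lemma reduced_subset_equivariant_Roe: "reduced_algebra G \<subseteq> equivariant_part G (uniform_Roe_algebra G)"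
proof
  fix T assume "T \<in> reduced_algebra G"
  then have T: "T \<in> adjointable_operators G"
    and ap: "\<And>e. 0 < e \<Longrightarrow> \<exists>f\<in>Cc. operator_norm G (\<lambda>\<xi> a. T \<xi> a - left_regular G f \<xi> a) < e"
    unfolding reduced_algebra_def norm_closure_def by auto
  have bT: "bop T" by (rule adjointable_bop[OF T])
  have "T \<in> uniform_Roe_algebra G"
    unfolding uniform_Roe_algebra_def norm_closure_def
  proof (intro CollectI conjI allI impI T)
    fix e :: real assume "0 < e"
    then obtain f where "f \<in> Cc" "operator_norm G (\<lambda>\<xi> a. T \<xi> a - left_regular G f \<xi> a) < e"
      using ap by blast
    then show "\<exists>S\<in>compactly_supported_operators G. operator_norm G (\<lambda>\<xi> a. T \<xi> a - S \<xi> a) < e"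
      by (intro bexI[of _ "left_regular G f"] left_regular_compactly_supported)
  qed
  moreover have "T \<circ> right_conv G g = right_conv G g \<circ> T" if g: "g \<in> Cc" for g
  proof
    fix \<xi>
    have bR: "bop (right_conv G g)" by (rule right_conv_bop[OF g])
    show "(T \<circ> right_conv G g) \<xi> = (right_conv G g \<circ> T) \<xi>"
    proof (cases "\<xi> \<in> L2 G")
      case True
      have "T (right_conv G g \<xi>) = right_conv G g (T \<xi>)"
      proof (rule bop_commute_limit[OF bT bR _ True])
        fix e :: real assume "0 < e"
        then obtain f where f: "f \<in> Cc" "operator_norm G (\<lambda>\<xi> a. T \<xi> a - left_regular G f \<xi> a) < e"
          using ap by blast
        then show "\<exists>S. bop S \<and> (\<forall>\<xi>\<in>L2 G. S (right_conv G g \<xi>) = right_conv G g (S \<xi>)) \<and>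
            operator_norm G (\<lambda>\<xi> a. T \<xi> a - S \<xi> a) < e"
          by (intro exI[of _ "left_regular G f"] conjI ballI left_regular_bop left_regular_commutes g)
      qed
      then show ?thesis by simp
    next
      \<comment> \<open>Operators are compared as functions, so arguments outside
        \<open>L2 G\<close> count as well; there both sides are zero.\<close>
      case False
      then have "T \<xi> = (\<lambda>a. 0)" using T unfolding adjointable_operators_def by simp
      then show ?thesis using False
        by (simp add: right_conv_conv operator_on_L2_outside bop_zero[OF bT] bop_zero[OF bR, unfolded right_conv_conv])
    qed
  qed
  ultimately show "T \<in> equivariant_part G (uniform_Roe_algebra G)" unfolding equivariant_part_def by simp
qed

text \<open>For separated \<open>f\<close> and \<open>g\<close> a compactly supported
  \<open>S\<close> is annihilated by the two multiplications, so only \<open>T - S\<close> is seen.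
  Approximating within \<open>e / 2\<close> leaves room for the strict inequality.\<close>

lemma Roe_subset_quasi_local: "uniform_Roe_algebra G \<subseteq> uniform_quasi_local_algebra G"
proof
  fix T assume "T \<in> uniform_Roe_algebra G"
  then have T: "T \<in> adjointable_operators G"
    and ap: "\<And>e. 0 < e \<Longrightarrow> \<exists>S\<in>compactly_supported_operators G. operator_norm G (\<lambda>\<xi> a. T \<xi> a - S \<xi> a) < e"
    unfolding uniform_Roe_algebra_def norm_closure_def by auto
  have bT: "bop T" by (rule adjointable_bop[OF T])
  have "\<exists>K. compact K \<and> (\<forall>f\<in>Cb. \<forall>g\<in>Cb. separated G K f g \<longrightarrow>
      operator_norm G (mult_operator G g \<circ> T \<circ> mult_operator G f) \<le> e / 2 * sup_norm g * sup_norm f)" if e: "0 < e" for e :: real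
  proof -
    obtain S where S: "S \<in> compactly_supported_operators G" "operator_norm G (\<lambda>\<xi> a. T \<xi> a - S \<xi> a) < e / 2"
      using ap[of "e / 2"] e by auto
    then have bS: "bop S" unfolding compactly_supported_operators_def using adjointable_bop by simp
    obtain K where K: "compact K" "\<And>f g. f \<in> Cb \<Longrightarrow> g \<in> Cb \<Longrightarrow> separated G K f g \<Longrightarrow>
        mult_operator G g \<circ> S \<circ> mult_operator G f = zero_operator"
      using S(1) unfolding compactly_supported_operators_def by auto
    let ?D = "\<lambda>\<xi> a. T \<xi> a - S \<xi> a"
    have bD: "bop ?D" by (rule bop_minus[OF bT bS])
    have "operator_norm G (mult_operator G g \<circ> T \<circ> mult_operator G f) \<le> e / 2 * sup_norm g * sup_norm f"
      if fg: "f \<in> Cb" "g \<in> Cb" "separated G K f g" for f g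
    proof (rule operator_norm_le)
      have n: "0 \<le> sup_norm f" "0 \<le> sup_norm g" using sup_norm_nonneg fg by auto
      then show "0 \<le> e / 2 * sup_norm g * sup_norm f" using e by simp
      fix \<xi> assume \<xi>: "\<xi> \<in> L2 G" "nrm \<xi> \<le> 1"
      let ?\<eta> = "mult_operator G f \<xi>"
      have L: "?\<eta> \<in> L2 G" by (rule bop_L2[OF mult_operator_bop(1)[OF fg(1)] \<xi>(1)])
      have "(mult_operator G g \<circ> S \<circ> mult_operator G f) \<xi> = (\<lambda>a. 0)"
        using K(2)[OF fg] by (simp add: zero_operator_def)
      then have "mult_operator G g (S ?\<eta>) = (\<lambda>a. 0)" by simp
      then have "mult_operator G g (?D ?\<eta>) = mult_operator G g (T ?\<eta>)"
        using bop_diff[OF mult_operator_bop(1)[OF fg(2)] bop_L2[OF bT L] bop_L2[OF bS L]] by simp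
      then have "nrm ((mult_operator G g \<circ> T \<circ> mult_operator G f) \<xi>) \<le> sup_norm g * nrm (?D ?\<eta>)"
        using mult_operator_bop(2)[OF fg(2) bop_L2[OF bD L]] by simp
      also have "\<dots> \<le> sup_norm g * (e / 2 * (sup_norm f * 1))"
      proof (intro mult_left_mono n)
        have "nrm (?D ?\<eta>) \<le> operator_norm G ?D * nrm ?\<eta>" by (rule nrm_le_operator_norm[OF bD L])
        also have "\<dots> \<le> e / 2 * (sup_norm f * 1)"
        proof (rule mult_mono)
          show "nrm ?\<eta> \<le> sup_norm f * 1"
            by (rule order_trans[OF mult_operator_bop(2)[OF fg(1) \<xi>(1)] mult_left_mono[OF \<xi>(2) n(1)]])
        qed (use S(2) e nrm_nonneg[OF L2_fl2[OF L]] in auto)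
        finally show "nrm (?D ?\<eta>) \<le> e / 2 * (sup_norm f * 1)" .
      qed
      also have "\<dots> = e / 2 * sup_norm g * sup_norm f" by simp
      finally show "nrm ((mult_operator G g \<circ> T \<circ> mult_operator G f) \<xi>) \<le> e / 2 * sup_norm g * sup_norm f" .
    qed
    then show ?thesis using K(1) by blast
  qed
  note key = this
  have "\<exists>K. compact K \<and> (\<forall>f\<in>Cb. \<forall>g\<in>Cb. separated G K f g \<longrightarrow>
           (let N = operator_norm G (mult_operator G g \<circ> T \<circ> mult_operator G f);
                B = e * sup_norm g * sup_norm f
            in if f = (\<lambda>a. 0) \<or> g = (\<lambda>a. 0) then N \<le> B else N < B))" if e: "0 < e" for e :: real
  proof -
    obtain K where K: "compact K" "\<And>f g. f \<in> Cb \<Longrightarrow> g \<in> Cb \<Longrightarrow> separated G K f g \<Longrightarrow>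
      operator_norm G (mult_operator G g \<circ> T \<circ> mult_operator G f) \<le> e / 2 * sup_norm g * sup_norm f"
      using key[OF e] by blast
    have "let N = operator_norm G (mult_operator G g \<circ> T \<circ> mult_operator G f);
                B = e * sup_norm g * sup_norm f
            in if f = (\<lambda>a. 0) \<or> g = (\<lambda>a. 0) then N \<le> B else N < B"
      if fg: "f \<in> Cb" "g \<in> Cb" "separated G K f g" for f g
    proof (cases "f = (\<lambda>a. 0) \<or> g = (\<lambda>a. 0)")
      case True
      have "e / 2 * sup_norm g * sup_norm f \<le> e * sup_norm g * sup_norm f"
        using sup_norm_nonneg fg e by (intro mult_right_mono) auto
      with K(2)[OF fg] have "operator_norm G (mult_operator G g \<circ> T \<circ> mult_operator G f) \<le> e * sup_norm g * sup_norm f"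
        by (rule order_trans)
      then show ?thesis unfolding Let_def using True by (simp only: if_True)
    next
      case False
      then have "0 < sup_norm g * sup_norm f" using sup_norm_pos fg by (intro mult_pos_pos) auto
      then have "e / 2 * sup_norm g * sup_norm f < e * sup_norm g * sup_norm f"
        using mult_strict_right_mono[of "e / 2" e "sup_norm g * sup_norm f"] e by (simp only: mult.assoc)
      with K(2)[OF fg] have "operator_norm G (mult_operator G g \<circ> T \<circ> mult_operator G f) < e * sup_norm g * sup_norm f"
        by (rule le_less_trans)
      then show ?thesis unfolding Let_def using False by (simp only: if_False)
    qed
    then show ?thesis using K(1) by blast
  qed
  then show "T \<in> uniform_quasi_local_algebra G"
    unfolding uniform_quasi_local_algebra_def using T by blast
qed

end

section \<open>The kernel of an equivariant operator\<close>

context etale_groupoid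
begin

text \<open>The matrix, on a source fibre, of convolution by \<open>k\<close> from the left.\<close>

abbreviation qm :: "('a \<Rightarrow> complex) \<Rightarrow> 'a \<Rightarrow> 'a \<Rightarrow> complex" where
  "qm k c a \<equiv> k (c \<cdot> iv a)"

lemma unit_bump:
  assumes "compact C" "C \<subseteq> units G"
  obtains e :: "'a \<Rightarrow> real" where "(\<lambda>a. complex_of_real (e a)) \<in> Cc" "\<And>a. a \<notin> units G \<Longrightarrow> e a = 0"
    "\<And>a. a \<in> C \<Longrightarrow> e a = 1" "\<And>a. 0 \<le> e a" "\<And>a. e a \<le> 1"
proof -
  obtain e :: "'a \<Rightarrow> real" where e: "\<And>x. 0 \<le> e x" "\<And>x. e x \<le> 1" "\<And>x. x \<in> C \<Longrightarrow> e x = 1"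
    "(\<lambda>x. complex_of_real (e x)) \<in> Cc" "supp (\<lambda>x. complex_of_real (e x)) \<subseteq> units G"
    using locally_compact_Urysohn[OF locally_compact assms(1) open_units assms(2)] by metis
  have "e a = 0" if "a \<notin> units G" for a
    using suppI[of "\<lambda>x. complex_of_real (e x)" a] e(5) that by auto
  then show thesis using that[of e] e by simp
qed

text \<open>The only unit in the fibre of \<open>c\<close> is \<open>sc c\<close>.\<close>

lemma conv_unit_right:
  assumes "\<And>a. a \<notin> units G \<Longrightarrow> g a = 0"
  shows "conv \<xi> g c = \<xi> c * g (sc c)"
proof -
  have "conv \<xi> g c = (\<Sum>a\<in>{sc c}. \<xi> (c \<cdot> iv a) * g a)"
  proof (rule conv_sum)
    fix a assume "sc a = sc c" "a \<notin> {sc c}"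
    then have "a \<notin> units G" using unit_iff(2) by auto
    then show "\<xi> (c \<cdot> iv a) = 0 \<or> g a = 0" using assms by simp
  qed auto
  moreover have "c \<cdot> iv (sc c) = c" by (metis mult_iv_cancel mult_sc_self rg_sc)
  ultimately show ?thesis by simp
qed

lemma conv_unit_left:
  assumes "\<And>a. a \<notin> units G \<Longrightarrow> e a = 0"
  shows "conv e g c = e (rg c) * g c"
proof -
  have "conv e g c = (\<Sum>a\<in>{c}. e (c \<cdot> iv a) * g a)"
  proof (rule conv_sum)
    fix a assume "sc a = sc c" "a \<notin> {c}"
    then have "c \<cdot> iv a \<notin> units G" using div_unit[of c a] by auto
    then show "e (c \<cdot> iv a) = 0 \<or> g a = 0" using assms by simp
  qed auto
  then show ?thesis by simp
qed

text \<open>This transfers operator bounds to finite matrices. The bumps \<open>e b\<close> live in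
  disjoint sets on which \<open>sc\<close> is injective. Any other fibre meets each of these at most
  once and \<open>e b\<close> is at most 1, so no fibre carries more mass than
  \<open>v\<close>.\<close>

lemma Cc_extension:
  assumes B: "finite B" "B \<subseteq> fib x"
  obtains \<xi> where "\<xi> \<in> Cc" "\<And>b. b \<in> B \<Longrightarrow> \<xi> b = v b" "\<And>a. sc a = x \<Longrightarrow> a \<notin> B \<Longrightarrow> \<xi> a = 0"
    "nrm \<xi> \<le> l2n v B"
proof -
  have "\<exists>V. \<forall>a\<in>B. open (V a) \<and> a \<in> V a \<and> (\<forall>b\<in>B. a \<noteq> b \<longrightarrow> V a \<inter> V b = {})"
    by (rule finite_disjoint_neighbourhoods[OF B(1)])
  then obtain V where V: "\<forall>a\<in>B. open (V a) \<and> a \<in> V a \<and> (\<forall>b\<in>B. a \<noteq> b \<longrightarrow> V a \<inter> V b = {})"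
    by blast
  obtain U where U: "\<And>a. bisection (U a)" "\<And>a. a \<in> U a" using ex_bisection by metis
  define W where "W a = U a \<inter> V a" for a
  have W: "open (W b)" "b \<in> W b" "inj_on sc (W b)" if "b \<in> B" for b
    using V U(2) that bisection_open[OF U(1)[of b]] inj_on_subset[OF bisection_inj[OF U(1)[of b]], of "U b \<inter> V b"]
    unfolding W_def by auto
  have Wd: "b = b'" if "b \<in> B" "b' \<in> B" "a \<in> W b" "a \<in> W b'" for a b b'
    using V that unfolding W_def by blast
  have "\<exists>e::'a \<Rightarrow> real. (\<lambda>a. complex_of_real (e a)) \<in> Cc \<and> e b = 1 \<and> (\<forall>a. 0 \<le> e a \<and> e a \<le> 1) \<and>
      supp (\<lambda>a. complex_of_real (e a)) \<subseteq> W b" if b: "b \<in> B" for b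
    using locally_compact_Urysohn[OF locally_compact, of "{b}" "W b"] W[OF b] by (auto, metis)
  then obtain e :: "'a \<Rightarrow> 'a \<Rightarrow> real" where e: "\<And>b. b \<in> B \<Longrightarrow> (\<lambda>a. complex_of_real (e b a)) \<in> Cc \<and> e b b = 1 \<and>
      (\<forall>a. 0 \<le> e b a \<and> e b a \<le> 1) \<and> supp (\<lambda>a. complex_of_real (e b a)) \<subseteq> W b"
    by metis
  have e0: "e b a = 0" if "b \<in> B" "a \<notin> W b" for a b
    using suppI[of "\<lambda>a. complex_of_real (e b a)" a] e[OF that(1)] that(2) by auto
  define \<xi> where "\<xi> a = (\<Sum>b\<in>B. v b * complex_of_real (e b a))" for a
  have one: "\<xi> a = v b * complex_of_real (e b a)" if "b \<in> B" "a \<in> W b" for a b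
  proof -
    have "e i a = 0" if "i \<in> B" "i \<noteq> b" for i
      using e0 Wd that \<open>b \<in> B\<close> \<open>a \<in> W b\<close> by blast
    then have "\<xi> a = (\<Sum>b'\<in>{b}. v b' * complex_of_real (e b' a))"
      unfolding \<xi>_def using that(1) B(1) by (intro sum.mono_neutral_right) auto
    then show ?thesis by simp
  qed
  have none: "\<xi> a = 0" if "\<And>b. b \<in> B \<Longrightarrow> a \<notin> W b" for a
    unfolding \<xi>_def using that e0 by (simp add: sum.neutral)
  show thesis
  proof (rule that[of \<xi>])
    have "(\<lambda>a. \<Sum>b\<in>B. v b * complex_of_real (e b a)) \<in> Cc"
      by (rule Cc_sum[OF B(1)], rule Cc_scale) (use e in blast)
    then show "\<xi> \<in> Cc" by (simp add: \<xi>_def[abs_def])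
    show "\<xi> b = v b" if "b \<in> B" for b using one[OF that W(2)[OF that]] e[OF that] by simp
    show "\<xi> a = 0" if a: "sc a = x" "a \<notin> B" for a
    proof (rule none)
      fix b assume b: "b \<in> B"
      then have "sc b = x" using B(2) by auto
      then show "a \<notin> W b" using W(2,3)[OF b] a b by (metis inj_onD)
    qed
    show "nrm \<xi> \<le> l2n v B"
    proof (rule nrm_bound(2))
      fix y F assume F: "finite F" "F \<subseteq> fib y"
      have card1: "card {a\<in>F. a \<in> W b} \<le> 1" if "b \<in> B" for b
      proof -
        have "a = a'" if "a \<in> {a\<in>F. a \<in> W b}" "a' \<in> {a\<in>F. a \<in> W b}" for a a'
        proof -
          have "a \<in> fib y" "a' \<in> fib y" using that F(2) by auto
          then show ?thesis using inj_onD[OF W(3)[OF \<open>b \<in> B\<close>], of a a'] that by simp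
        qed
        then show ?thesis by (metis (no_types, lifting) One_nat_def card_le_Suc0_iff_eq finite_subset F(1) mem_Collect_eq subsetI)
      qed
      have pw: "(cmod (\<xi> a))\<^sup>2 \<le> (\<Sum>b\<in>B. of_bool (a \<in> W b) * (cmod (v b))\<^sup>2)" for a
      proof (cases "\<exists>b\<in>B. a \<in> W b")
        case True
        then obtain b where b: "b \<in> B" "a \<in> W b" by blast
        have "cmod (\<xi> a) \<le> cmod (v b)"
          unfolding one[OF b] using e[OF b(1)] mult_left_mono[of "e b a" 1 "cmod (v b)"] by (simp add: norm_mult)
        then have "(cmod (\<xi> a))\<^sup>2 \<le> (cmod (v b))\<^sup>2" by (intro power_mono) auto
        also have "\<dots> = of_bool (a \<in> W b) * (cmod (v b))\<^sup>2" using b by simp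
        also have "\<dots> \<le> (\<Sum>b\<in>B. of_bool (a \<in> W b) * (cmod (v b))\<^sup>2)"
          by (rule member_le_sum[OF b(1) _ B(1)]) auto
        finally show ?thesis .
      next
        case False
        then have "\<xi> a = 0" using none by blast
        then show ?thesis by (simp add: sum_nonneg)
      qed
      have "(\<Sum>a\<in>F. (cmod (\<xi> a))\<^sup>2) \<le> (\<Sum>a\<in>F. \<Sum>b\<in>B. of_bool (a \<in> W b) * (cmod (v b))\<^sup>2)"
        by (intro sum_mono pw)
      also have "\<dots> = (\<Sum>b\<in>B. \<Sum>a\<in>F. of_bool (a \<in> W b) * (cmod (v b))\<^sup>2)" by (rule sum.swap)
      also have "\<dots> = (\<Sum>b\<in>B. real (card {a\<in>F. a \<in> W b}) * (cmod (v b))\<^sup>2)"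
        using F(1) by (intro sum.cong refl) (simp flip: sum_distrib_right add: Int_def)
      also have "\<dots> \<le> (\<Sum>b\<in>B. 1 * (cmod (v b))\<^sup>2)"
        using card1 by (intro sum_mono mult_right_mono) auto
      also have "\<dots> = (l2n v B)\<^sup>2" by (simp add: l2n_sq)
      finally show "l2n \<xi> F \<le> l2n v B" using l2n_le_sqrt[of \<xi> F "(l2n v B)\<^sup>2"] by simp
    qed
  qed
qed

text \<open>Pairs in a common fibre with quotient in \<open>K\<close> or its inverse form a closed
  set, which misses the compact \<open>A \<times> B\<close>. Wallace's theorem gives a product
  neighbourhood that still misses it, and Urysohn functions supported in the two factors are
  separated.\<close>

lemma separating_functions:
  assumes K: "compact K" and A: "finite A" "A \<subseteq> fib x" and B: "finite B" "B \<subseteq> fib x"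
    and sep: "\<And>c a. c \<in> A \<Longrightarrow> a \<in> B \<Longrightarrow> c \<cdot> iv a \<notin> K \<and> a \<cdot> iv c \<notin> K"
  obtains f g :: "'a \<Rightarrow> real" where "(\<lambda>a. complex_of_real (f a)) \<in> Cc" "(\<lambda>a. complex_of_real (g a)) \<in> Cc"
    "\<And>a. 0 \<le> f a \<and> f a \<le> 1" "\<And>a. 0 \<le> g a \<and> g a \<le> 1" "\<And>a. a \<in> B \<Longrightarrow> f a = 1" "\<And>a. a \<in> A \<Longrightarrow> g a = 1"
    "separated G K (\<lambda>a. complex_of_real (f a)) (\<lambda>a. complex_of_real (g a))"
proof -
  define K' where "K' = K \<union> iv ` K"
  have K': "compact K'" unfolding K'_def by (intro compact_Un K compact_iv)
  define S where "S = {p::'a\<times>'a. sc (fst p) = sc (snd p)}"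
  have "closed S" unfolding S_def by (rule closed_Collect_eq) (auto intro!: cont_intros)
  moreover have "continuous_on S (\<lambda>p. fst p \<cdot> iv (snd p))"
    unfolding S_def by (intro cont_mult) (auto intro!: cont_intros)
  ultimately have cl: "closed (S \<inter> (\<lambda>p. fst p \<cdot> iv (snd p)) -` K')"
    using continuous_closed_preimage compact_imp_closed[OF K'] by blast
  define D where "D = S \<inter> (\<lambda>p. fst p \<cdot> iv (snd p)) -` K'"
  have "A \<times> B \<subseteq> - D"
  proof
    fix p assume "p \<in> A \<times> B"
    then obtain c a where p: "p = (c, a)" "c \<in> A" "a \<in> B" by auto
    have "sc c = sc a" using subsetD[OF A(2) p(2)] subsetD[OF B(2) p(3)] by simp
    have "c \<cdot> iv a \<notin> iv ` K"
    proof
      assume "c \<cdot> iv a \<in> iv ` K"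
      then obtain k where "k \<in> K" "c \<cdot> iv a = iv k" by auto
      then have "a \<cdot> iv c = k" using \<open>sc c = sc a\<close> iv_div[of c a] by simp
      then show False using sep p \<open>k \<in> K\<close> by blast
    qed
    then show "p \<in> - D" unfolding D_def K'_def using p sep by auto
  qed
  moreover have "openin (prod_topology euclidean euclidean) (- D)"
    using open_Compl[OF cl] unfolding D_def prod_topology_euclidean by (simp only: open_openin)
  moreover have "compactin euclidean A" "compactin euclidean B"
    using A B finite_imp_compact by auto
  ultimately obtain U V where UV: "openin euclidean U" "openin euclidean V" "A \<subseteq> U" "B \<subseteq> V" "U \<times> V \<subseteq> - D"
    using Wallace_theorem_prod_topology[of euclidean A euclidean B "- D"] by metis
  obtain f :: "'a \<Rightarrow> real" where f: "\<And>x. 0 \<le> f x" "\<And>x. f x \<le> 1" "\<And>x. x \<in> B \<Longrightarrow> f x = 1"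
    "(\<lambda>x. complex_of_real (f x)) \<in> Cc" "supp (\<lambda>x. complex_of_real (f x)) \<subseteq> V"
    using locally_compact_Urysohn[OF locally_compact, of B V] UV B finite_imp_compact
    by (metis open_openin)
  obtain g :: "'a \<Rightarrow> real" where g: "\<And>x. 0 \<le> g x" "\<And>x. g x \<le> 1" "\<And>x. x \<in> A \<Longrightarrow> g x = 1"
    "(\<lambda>x. complex_of_real (g x)) \<in> Cc" "supp (\<lambda>x. complex_of_real (g x)) \<subseteq> U"
    using locally_compact_Urysohn[OF locally_compact, of A U] UV A finite_imp_compact
    by (metis open_openin)
  have noD: "c \<cdot> iv a \<notin> K'" if "c \<in> U" "a \<in> V" "sc c = sc a" for c a
    using UV(5) that unfolding D_def S_def by auto
  have "separated G K (\<lambda>a. complex_of_real (f a)) (\<lambda>a. complex_of_real (g a))"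
    unfolding separated_def
  proof (intro conjI equals0I)
    fix c assume "c \<in> set_mult G K (supp (\<lambda>a. complex_of_real (f a))) \<inter> supp (\<lambda>a. complex_of_real (g a))"
    then obtain k a where ka: "c = k \<cdot> a" "k \<in> K" "a \<in> V" "sc k = rg a" "c \<in> U"
      unfolding set_mult_def using f(5) g(5) by auto
    then have "c \<cdot> iv a = k" by (simp add: mult_iv_cancel)
    then show False using noD[of c a] ka unfolding K'_def by simp
  next
    fix a assume "a \<in> supp (\<lambda>a. complex_of_real (f a)) \<inter> set_mult G K (supp (\<lambda>a. complex_of_real (g a)))"
    then obtain k c where kc: "a = k \<cdot> c" "k \<in> K" "c \<in> U" "sc k = rg c" "a \<in> V"
      unfolding set_mult_def using f(5) g(5) by auto
    then have "a \<cdot> iv c = k" "sc a = sc c" by (simp_all add: mult_iv_cancel)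
    then have "c \<cdot> iv a = iv k" using iv_div[of a c] by simp
    then show False using noD[of c a] kc \<open>sc a = sc c\<close> unfolding K'_def by simp
  qed
  then show thesis using that[of f g] f g by simp
qed

end

section \<open>Equivariant operators as convolutions\<close>

locale equivariant_operator = etale_groupoid G for G :: "'a::t2_space groupoid_data" +
  fixes T :: "'a operator"
  assumes adj: "T \<in> adjointable_operators G"
    and eqv: "\<And>g. g \<in> Cc \<Longrightarrow> T \<circ> right_conv G g = right_conv G g \<circ> T"
begin

lemma bT: "bop T"
  by (rule adjointable_bop[OF adj])

lemma T_right_conv:
  assumes "g \<in> Cc" "\<xi> \<in> L2 G"
  shows "T (conv \<xi> g) = conv (T \<xi>) g"
  using fun_cong[OF eqv[OF assms(1)], of \<xi>] assms bop_L2[OF bT assms(2)] by (simp add: right_conv_apply)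

text \<open>It depends on \<open>c\<close> only through \<open>sc c\<close>; which function is
  chosen does not affect \<open>kernel\<close>, by \<open>T_unit\<close>.\<close>

definition bump :: "'a \<Rightarrow> 'a \<Rightarrow> complex" where
  "bump c = (SOME e. e \<in> Cc \<and> (\<forall>a. a \<notin> units G \<longrightarrow> e a = 0) \<and> e (sc c) = 1)"

lemma bump: "bump c \<in> Cc" "a \<notin> units G \<Longrightarrow> bump c a = 0" "bump c (sc c) = 1"
proof -
  have "compact {sc c}" "{sc c} \<subseteq> units G" by auto
  then obtain e :: "'a \<Rightarrow> real" where e: "(\<lambda>a. complex_of_real (e a)) \<in> Cc" "\<And>a. a \<notin> units G \<Longrightarrow> e a = 0"
    "\<And>a. a \<in> {sc c} \<Longrightarrow> e a = 1"
    using unit_bump[of "{sc c}"] by metis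
  have "bump c \<in> Cc \<and> (\<forall>a. a \<notin> units G \<longrightarrow> bump c a = 0) \<and> bump c (sc c) = 1"
    unfolding bump_def by (rule someI[of _ "\<lambda>a. complex_of_real (e a)"]) (use e in simp)
  then show "bump c \<in> Cc" "a \<notin> units G \<Longrightarrow> bump c a = 0" "bump c (sc c) = 1" by auto
qed

definition kernel :: "'a \<Rightarrow> complex" where
  "kernel c = T (bump c) c"

text \<open>Functions supported on the units commute under convolution. Applying \<open>T\<close> to
  both products of \<open>e\<close> with \<open>bump c\<close> and using equivariance compares
  \<open>T e\<close> with \<open>T (bump c)\<close> at \<open>c\<close>.\<close>

lemma T_unit:
  assumes "e \<in> Cc" "\<And>a. a \<notin> units G \<Longrightarrow> e a = 0"
  shows "T e c = kernel c * e (sc c)"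
proof -
  have u: "e' a * e'' (sc a) = e' a * e'' a" if "\<And>a. a \<notin> units G \<Longrightarrow> e' a = 0" for e' e'' :: "'a \<Rightarrow> complex" and a
    using that unit_iff(2)[of a] by (cases "a \<in> units G") auto
  have "conv e (bump c) = conv (bump c) e"
  proof
    fix a show "conv e (bump c) a = conv (bump c) e a"
      using conv_unit_right[where g = "bump c" and \<xi> = e and c = a, OF bump(2)]
        conv_unit_right[where g = e and \<xi> = "bump c" and c = a, OF assms(2)]
        u[of e a "bump c", OF assms(2)] u[of "bump c" a e, OF bump(2)] by simp
  qed
  then have "conv (T e) (bump c) c = conv (T (bump c)) e c"
    using T_right_conv[OF bump(1)[of c] Cc_L2[OF assms(1)]] T_right_conv[OF assms(1) Cc_L2[OF bump(1)[of c]]] by simp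
  then show ?thesis
    using conv_unit_right[where g = "bump c" and \<xi> = "T e" and c = c, OF bump(2)]
      conv_unit_right[where g = e and \<xi> = "T (bump c)" and c = c, OF assms(2)]
    by (simp add: bump(3) kernel_def)
qed

text \<open>A function \<open>e\<close> on the units that is 1 on the ranges of
  \<open>supp g\<close> is a left unit for \<open>g\<close>. Equivariance then moves
  \<open>T\<close> onto \<open>e\<close>, and \<open>T_unit\<close> identifies \<open>T e\<close>
  with the kernel wherever \<open>g\<close> sees it.\<close>

lemma T_conv:
  assumes g: "g \<in> Cc"
  shows "T g = conv kernel g"
proof -
  have "compact (rg ` supp g)" using cont_rg Cc_compact[OF g] compact_continuous_image by blast
  moreover have "rg ` supp g \<subseteq> units G" by auto
  ultimately obtain e :: "'a \<Rightarrow> real" where e: "(\<lambda>a. complex_of_real (e a)) \<in> Cc" "\<And>a. a \<notin> units G \<Longrightarrow> e a = 0"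
    "\<And>a. a \<in> rg ` supp g \<Longrightarrow> e a = 1"
    using unit_bump[of "rg ` supp g"] by metis
  let ?e = "\<lambda>a. complex_of_real (e a)"
  have e1: "?e (rg b) * g b = g b" for b using e(3) suppI[of g b] by (cases "g b = 0") auto
  have "conv ?e g = g" by (rule ext) (simp add: conv_unit_left e(2) e1)
  then have "T g = conv (T ?e) g" using T_right_conv[OF g Cc_L2[OF e(1)]] by simp
  also have "\<dots> = conv kernel g"
  proof
    fix c
    show "conv (T ?e) g c = conv kernel g c"
      unfolding conv_def
    proof (rule infsum_cong)
      fix a assume "a \<in> fib (sc c)"
      then have "sc (c \<cdot> iv a) = rg a" by simp
      then show "T ?e (c \<cdot> iv a) * g a = kernel (c \<cdot> iv a) * g a"
        using T_unit[OF e(1), of "c \<cdot> iv a"] e(2) e1[of a] by (simp add: mult.assoc)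
    qed
  qed
  finally show ?thesis .
qed

text \<open>The kernel itself need not belong to \<open>L2 G\<close>. On \<open>supp \<phi>\<close>
  it coincides with \<open>T e\<close> for a suitable \<open>e\<close>, which is continuous as an
  element of \<open>L2 G\<close>.\<close>

lemma Cc_mult_kernel:
  assumes \<phi>: "\<phi> \<in> Cc"
  shows "(\<lambda>a. \<phi> a * kernel a) \<in> Cc"
proof -
  have "compact (sc ` supp \<phi>)" using cont_sc Cc_compact[OF \<phi>] compact_continuous_image by blast
  moreover have "sc ` supp \<phi> \<subseteq> units G" by auto
  ultimately obtain e :: "'a \<Rightarrow> real" where e: "(\<lambda>a. complex_of_real (e a)) \<in> Cc" "\<And>a. a \<notin> units G \<Longrightarrow> e a = 0"
    "\<And>a. a \<in> sc ` supp \<phi> \<Longrightarrow> e a = 1"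
    using unit_bump[of "sc ` supp \<phi>"] by metis
  let ?e = "\<lambda>a. complex_of_real (e a)"
  have "\<phi> a * kernel a = T ?e a * \<phi> a" for a
    using T_unit[OF e(1), of a] e(2) e(3)[of "sc a"] suppI[of \<phi> a] by (cases "\<phi> a = 0") auto
  then show ?thesis
    using Cc_mult[OF \<phi> L2_continuous[OF bop_L2[OF bT Cc_L2[OF e(1)]]]] by (simp only:)
qed

lemma T_extension:
  assumes F: "finite F" "F \<subseteq> fib x" and \<xi>: "\<xi> \<in> Cc" "\<And>a. a \<in> F \<Longrightarrow> \<xi> a = v a" "\<And>a. sc a = x \<Longrightarrow> a \<notin> F \<Longrightarrow> \<xi> a = 0"
    and c: "c \<in> F"
  shows "T \<xi> c = (\<Sum>a\<in>F. kernel (c \<cdot> iv a) * v a)"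
proof -
  have x: "sc c = x" using F(2) c by auto
  have "T \<xi> c = (\<Sum>a\<in>F. kernel (c \<cdot> iv a) * \<xi> a)"
    unfolding T_conv[OF \<xi>(1)] by (rule conv_sum) (use F \<xi>(3) x in auto)
  then show ?thesis using \<xi>(2) by simp
qed

lemma kernel_form_bounded:
  assumes M: "\<And>\<xi>. \<xi> \<in> L2 G \<Longrightarrow> nrm (T \<xi>) \<le> M * nrm \<xi>" "0 \<le> M" and F: "finite F" "F \<subseteq> fib x"
  shows "cmod (bform (qm kernel) F u v) \<le> M * (l2n u F * l2n v F)"
proof -
  obtain \<xi> where \<xi>: "\<xi> \<in> Cc" "\<And>a. a \<in> F \<Longrightarrow> \<xi> a = v a" "\<And>a. sc a = x \<Longrightarrow> a \<notin> F \<Longrightarrow> \<xi> a = 0" "nrm \<xi> \<le> l2n v F"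
    using Cc_extension[OF F] by metis
  have "bform (qm kernel) F u v = (\<Sum>c\<in>F. u c * T \<xi> c)"
    unfolding bform_def using T_extension[OF F \<xi>(1-3)] by (simp add: sum_distrib_left mult.assoc)
  also have "cmod \<dots> \<le> l2n u F * l2n (T \<xi>) F" by (rule l2n_cauchy_schwarz_sum)
  also have "\<dots> \<le> l2n u F * (M * l2n v F)"
  proof (rule mult_left_mono)
    have "l2n (T \<xi>) F \<le> nrm (T \<xi>)" by (rule l2n_le_nrm[OF L2_fl2[OF bop_L2[OF bT Cc_L2[OF \<xi>(1)]]] F])
    also have "\<dots> \<le> M * nrm \<xi>" by (rule M(1)[OF Cc_L2[OF \<xi>(1)]])
    also have "\<dots> \<le> M * l2n v F" by (rule mult_left_mono[OF \<xi>(4) M(2)])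
    finally show "l2n (T \<xi>) F \<le> M * l2n v F" .
  qed simp
  finally show ?thesis by (simp only: mult_ac)
qed

text \<open>Vectors separated on a single fibre are given separating functions on the whole
  groupoid, to which quasi-locality of \<open>T\<close> applies.\<close>

lemma kernel_form_quasi_local:
  assumes ql: "T \<in> uniform_quasi_local_algebra G" and d: "0 < d"
  shows "\<exists>K. compact K \<and> (\<forall>a\<in>K. iv a \<in> K \<and> rg a \<in> K) \<and>
    (\<forall>x F u v. finite F \<longrightarrow> F \<subseteq> fib x \<longrightarrow> (\<forall>c\<in>F. \<forall>a\<in>F. u c \<noteq> 0 \<longrightarrow> v a \<noteq> 0 \<longrightarrow> c \<cdot> iv a \<notin> K) \<longrightarrow>
      cmod (bform (qm kernel) F u v) \<le> d * (l2n u F * l2n v F))"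
proof -
  have "\<exists>K. compact K \<and>
        (\<forall>f\<in>Cb. \<forall>g\<in>Cb. separated G K f g \<longrightarrow>
           (let N = operator_norm G (mult_operator G g \<circ> T \<circ> mult_operator G f);
                B = d * sup_norm g * sup_norm f
            in if f = (\<lambda>\<gamma>. 0) \<or> g = (\<lambda>\<gamma>. 0) then N \<le> B else N < B))"
    using ql d unfolding uniform_quasi_local_algebra_def by blast
  then obtain K where K: "compact K" and Kb: "\<And>f g. f \<in> Cb \<Longrightarrow> g \<in> Cb \<Longrightarrow> separated G K f g \<Longrightarrow>
      operator_norm G (mult_operator G g \<circ> T \<circ> mult_operator G f) \<le> d * sup_norm g * sup_norm f"
    unfolding Let_def by (metis less_imp_le)
  \<comment> \<open>Enlarging \<open>K\<close> keeps the bound. Inverses make the induced relation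
    symmetric; ranges and sources allow the points with range outside the set to be split off
    later.\<close>
  define K1 where "K1 = K \<union> iv ` K \<union> rg ` K \<union> sc ` K"
  have "compact K1" unfolding K1_def
    using K cont_rg cont_sc by (intro compact_Un compact_iv compact_continuous_image) auto
  moreover have ivu: "iv (rg b) = rg b" for b
    by (metis mult_iv rg_iv rg_mult_self rg_rg sc_rg)
  then have "iv (sc b) = sc b" for b using ivu[of "sc b"] by simp
  with ivu have "\<forall>a\<in>K1. iv a \<in> K1 \<and> rg a \<in> K1"
    unfolding K1_def by auto
  moreover have "cmod (bform (qm kernel) F u v) \<le> d * (l2n u F * l2n v F)"
    if F: "finite F" "F \<subseteq> fib x" and sep: "\<forall>c\<in>F. \<forall>a\<in>F. u c \<noteq> 0 \<longrightarrow> v a \<noteq> 0 \<longrightarrow> c \<cdot> iv a \<notin> K1" for x F u v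
  proof -
    define A where "A = {c\<in>F. u c \<noteq> 0}"
    define B where "B = {a\<in>F. v a \<noteq> 0}"
    have AB: "finite A" "A \<subseteq> fib x" "finite B" "B \<subseteq> fib x" unfolding A_def B_def using F by auto
    have sepK: "c \<cdot> iv a \<notin> K \<and> a \<cdot> iv c \<notin> K" if ca: "c \<in> A" "a \<in> B" for c a
    proof -
      have n: "c \<cdot> iv a \<notin> K1" using sep ca unfolding A_def B_def by auto
      have "sc c = sc a" using subsetD[OF AB(2) ca(1)] subsetD[OF AB(4) ca(2)] by simp
      then have "c \<cdot> iv a = iv (a \<cdot> iv c)" by simp
      then show ?thesis using n unfolding K1_def by auto
    qed
    obtain f g :: "'a \<Rightarrow> real" where fg: "(\<lambda>a. complex_of_real (f a)) \<in> Cc" "(\<lambda>a. complex_of_real (g a)) \<in> Cc"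
      "\<And>a. 0 \<le> f a \<and> f a \<le> 1" "\<And>a. 0 \<le> g a \<and> g a \<le> 1" "\<And>a. a \<in> B \<Longrightarrow> f a = 1" "\<And>a. a \<in> A \<Longrightarrow> g a = 1"
      and s: "separated G K (\<lambda>a. complex_of_real (f a)) (\<lambda>a. complex_of_real (g a))"
      by (rule separating_functions[OF K AB sepK]) (assumption+, rule that)
    let ?f = "\<lambda>a. complex_of_real (f a)" and ?g = "\<lambda>a. complex_of_real (g a)"
    have Cb: "?f \<in> Cb" "?g \<in> Cb" by (rule Cc_imp_Cb[OF fg(1)], rule Cc_imp_Cb[OF fg(2)])
    have sn: "sup_norm ?f \<le> 1" "sup_norm ?g \<le> 1"
      unfolding sup_norm_def using fg(3,4) by (auto intro!: cSUP_least)
    obtain \<xi> where \<xi>: "\<xi> \<in> Cc" "\<And>a. a \<in> F \<Longrightarrow> \<xi> a = v a" "\<And>a. sc a = x \<Longrightarrow> a \<notin> F \<Longrightarrow> \<xi> a = 0" "nrm \<xi> \<le> l2n v F"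
      using Cc_extension[OF F] by metis
    have \<xi>L: "\<xi> \<in> L2 G" by (rule Cc_L2[OF \<xi>(1)])
    \<comment> \<open>Multiplication by \<open>f\<close> keeps the values on \<open>F\<close>, as
      \<open>f\<close> is 1 where \<open>v\<close> is nonzero. For the same reason \<open>g\<close>
      may be inserted next to \<open>u\<close>.\<close>
    define \<zeta> where "\<zeta> = (\<lambda>a. ?f a * \<xi> a)"
    have \<zeta>: "\<zeta> \<in> Cc" unfolding \<zeta>_def by (rule Cc_mult[OF \<xi>(1) Cc_cont[OF fg(1)]])
    have \<zeta>v: "\<zeta> a = v a" if "a \<in> F" for a
      using \<xi>(2)[OF that] fg(5)[of a] that unfolding \<zeta>_def B_def by (cases "v a = 0") auto
    have \<zeta>0: "\<zeta> a = 0" if "sc a = x" "a \<notin> F" for a using \<xi>(3)[OF that] unfolding \<zeta>_def by simp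
    let ?O = "mult_operator G ?g \<circ> T \<circ> mult_operator G ?f"
    have bO: "bop ?O" by (intro bop_comp mult_operator_bop(1) Cb bT)
    have O: "?O \<xi> = (\<lambda>a. ?g a * T \<zeta> a)"
      using mult_operator_apply[OF \<xi>L, of ?f] mult_operator_apply[OF bop_L2[OF bT Cc_L2[OF \<zeta>]], of ?g]
      unfolding \<zeta>_def by simp
    have "bform (qm kernel) F u v = (\<Sum>c\<in>F. u c * T \<zeta> c)"
      unfolding bform_def using T_extension[OF F \<zeta> \<zeta>v \<zeta>0] by (simp add: sum_distrib_left mult.assoc)
    also have "\<dots> = (\<Sum>c\<in>F. u c * ?O \<xi> c)"
    proof (rule sum.cong[OF refl])
      fix c assume "c \<in> F"
      then show "u c * T \<zeta> c = u c * ?O \<xi> c"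
        unfolding O using fg(6)[of c] unfolding A_def by (cases "u c = 0") auto
    qed
    also have "cmod \<dots> \<le> l2n u F * l2n (?O \<xi>) F" by (rule l2n_cauchy_schwarz_sum)
    also have "\<dots> \<le> l2n u F * (d * l2n v F)"
    proof (rule mult_left_mono)
      have nn: "0 \<le> nrm \<xi>" by (rule nrm_nonneg[OF L2_fl2[OF \<xi>L]])
      have "l2n (?O \<xi>) F \<le> nrm (?O \<xi>)" by (rule l2n_le_nrm[OF L2_fl2[OF bop_L2[OF bO \<xi>L]] F])
      also have "\<dots> \<le> operator_norm G ?O * nrm \<xi>" by (rule nrm_le_operator_norm[OF bO \<xi>L])
      also have "\<dots> \<le> d * nrm \<xi>"
      proof (rule mult_right_mono[OF _ nn])
        have "operator_norm G ?O \<le> d * sup_norm ?g * sup_norm ?f" by (rule Kb[OF Cb s])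
        also have "\<dots> \<le> d * 1 * 1"
          using d sn sup_norm_nonneg[OF Cb(1)] sup_norm_nonneg[OF Cb(2)] by (intro mult_mono) auto
        finally show "operator_norm G ?O \<le> d" by simp
      qed
      also have "\<dots> \<le> d * l2n v F" using d \<xi>(4) by (intro mult_left_mono) auto
      finally show "l2n (?O \<xi>) F \<le> d * l2n v F" .
    qed simp
    finally show ?thesis by (simp only: mult_ac)
  qed
  ultimately show ?thesis by (intro exI[of _ K1] conjI allI impI)
qed

end

section \<open>Amenability\<close>

text \<open>This is the hypothesis on the level sets of \<open>j\<close>, integrated over all levels \<open>t\<close>.\<close>

lemma coarea_inequality:
  fixes j :: "'a \<Rightarrow> real" and w :: "'a \<Rightarrow> real"
  assumes F: "finite F" and w: "\<And>x. 0 \<le> w x" and j: "\<And>x. 0 \<le> j x"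
    and le: "\<And>t. 0 \<le> t \<Longrightarrow> c * sum w {x\<in>F. t < j x} \<le> sum w {x\<in>F. t < j x \<and> (\<exists>y\<in>F. R x y \<and> j y \<le> t)}"
  shows "c * (\<Sum>x\<in>F. w x * j x) \<le> (\<Sum>x\<in>F. w x * (\<Sum>y\<in>{y\<in>F. R x y}. \<bar>j x - j y\<bar>))"
proof -
  have int: "integrable lborel (\<lambda>t. indicat_real {a..<b} t)" for a b :: real
    by (cases "a \<le> b") (auto intro!: integrable_real_indicator)
  have val: "(LINT t|lborel. indicat_real {a..<b} t) = max 0 (b - a)" for a b :: real
    by (cases "a \<le> b") auto
  \<comment> \<open>A pair contributes for \<open>t\<close> between \<open>j y\<close> and
    \<open>j x\<close>; the half-open intervals match \<open>t < j x\<close> and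
    \<open>j y \<le> t\<close> exactly. For negative \<open>t\<close>, where \<open>le\<close> says
    nothing, \<open>?f\<close> vanishes.\<close>
  let ?f = "\<lambda>t. \<Sum>x\<in>F. (c * w x) * indicat_real {0..<j x} t"
  let ?g = "\<lambda>t. \<Sum>x\<in>F. \<Sum>y\<in>{y\<in>F. R x y}. w x * indicat_real {j y..<j x} t"
  have intf: "integrable lborel ?f" by (intro Bochner_Integration.integrable_sum integrable_mult_right int)
  have intg: "integrable lborel ?g" by (intro Bochner_Integration.integrable_sum integrable_mult_right int)
  have "?f t \<le> ?g t" for t
  proof (cases "0 \<le> t")
    case False
    then have "?f t = 0" by (intro sum.neutral) auto
    moreover have "0 \<le> ?g t" using w by (intro sum_nonneg mult_nonneg_nonneg) auto
    ultimately show ?thesis by simp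
  next
    case True
    have "?f t = (\<Sum>x\<in>{x\<in>F. t < j x}. c * w x)"
      using F True by (intro sum.mono_neutral_cong_right) (auto simp: indicator_def)
    also have "\<dots> = c * sum w {x\<in>F. t < j x}" by (simp add: sum_distrib_left)
    also have "\<dots> \<le> sum w {x\<in>F. t < j x \<and> (\<exists>y\<in>F. R x y \<and> j y \<le> t)}" by (rule le[OF True])
    also have "\<dots> = (\<Sum>x\<in>F. w x * of_bool (t < j x \<and> (\<exists>y\<in>F. R x y \<and> j y \<le> t)))"
      using F by (intro sum.mono_neutral_cong_left) auto
    also have "\<dots> \<le> ?g t"
    proof (rule sum_mono)
      fix x assume "x \<in> F"
      show "w x * of_bool (t < j x \<and> (\<exists>y\<in>F. R x y \<and> j y \<le> t)) \<le> (\<Sum>y\<in>{y\<in>F. R x y}. w x * indicat_real {j y..<j x} t)"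
      proof (cases "t < j x \<and> (\<exists>y\<in>F. R x y \<and> j y \<le> t)")
        case True
        then obtain y where y: "y \<in> {y\<in>F. R x y}" "j y \<le> t" by blast
        have "w x * of_bool (t < j x \<and> (\<exists>y\<in>F. R x y \<and> j y \<le> t)) = w x * indicat_real {j y..<j x} t"
          using True y by simp
        also have "\<dots> \<le> (\<Sum>y\<in>{y\<in>F. R x y}. w x * indicat_real {j y..<j x} t)"
          using F w by (intro member_le_sum[OF y(1)]) auto
        finally show ?thesis .
      next
        case False
        then have "w x * of_bool (t < j x \<and> (\<exists>y\<in>F. R x y \<and> j y \<le> t)) = 0" by simp
        then show ?thesis using w by (metis (no_types, lifting) indicator_pos_le mult_nonneg_nonneg sum_nonneg)
      qed
    qed
    finally show ?thesis .
  qed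
  then have "(LINT t|lborel. ?f t) \<le> (LINT t|lborel. ?g t)" by (intro integral_mono intf intg)
  moreover have "(LINT t|lborel. ?f t) = (\<Sum>x\<in>F. (c * w x) * max 0 (j x - 0))"
    by (subst Bochner_Integration.integral_sum, intro integrable_mult_right int)
      (simp only: integral_mult_right_zero val)
  moreover have "(LINT t|lborel. ?g t) = (\<Sum>x\<in>F. \<Sum>y\<in>{y\<in>F. R x y}. w x * max 0 (j x - j y))"
    by (subst Bochner_Integration.integral_sum, intro Bochner_Integration.integrable_sum integrable_mult_right int,
        subst Bochner_Integration.integral_sum, intro integrable_mult_right int)
      (simp only: integral_mult_right_zero val)
  ultimately have "(\<Sum>x\<in>F. (c * w x) * max 0 (j x - 0)) \<le> (\<Sum>x\<in>F. \<Sum>y\<in>{y\<in>F. R x y}. w x * max 0 (j x - j y))"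
    by simp
  also have "\<dots> \<le> (\<Sum>x\<in>F. \<Sum>y\<in>{y\<in>F. R x y}. w x * \<bar>j x - j y\<bar>)"
    by (intro sum_mono mult_left_mono w) auto
  finally show ?thesis using j by (simp add: sum_distrib_left mult.assoc)
qed

section \<open>Almost invariant densities, their level sets and positive definite
  multipliers\<close>

context etale_groupoid
begin

text \<open>Real finite sums replace complex infinite ones. Arbitrary finite \<open>Y\<close> are
  allowed because the sets that occur later are dictated by other data than the support of
  \<open>p\<close>.\<close>

lemma amenable_function:
  assumes "amenable G" "0 < e" "compact K"
  shows "\<exists>p::'a \<Rightarrow> real. (\<lambda>a. complex_of_real (p a)) \<in> Cc \<and> (\<forall>a. 0 \<le> p a) \<and>
    (\<forall>k\<in>K. 1 - e < sum p (fib (rg k) \<inter> supp (\<lambda>a. complex_of_real (p a))) \<and>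
      (\<forall>Y. finite Y \<and> Y \<subseteq> fib (rg k) \<longrightarrow> sum p Y < 1 + e \<and> (\<Sum>b\<in>Y. \<bar>p b - p (b \<cdot> k)\<bar>) < e))"
proof -
  obtain f where f: "f \<in> Cc" "range f \<subseteq> \<real>\<^sub>\<ge>\<^sub>0" and fK: "\<forall>k\<in>K.
      cmod (1 - (\<Sum>\<^sub>\<infinity>b\<in>fib (rg k). f b)) < e \<and> (\<Sum>\<^sub>\<infinity>b\<in>fib (rg k). cmod (f b - f (b \<cdot> k))) < e"
    using assms unfolding amenable_def by blast
  define p where "p a = Re (f a)" for a
  have "f a \<in> \<real>\<^sub>\<ge>\<^sub>0" for a using f(2) by auto
  then have p: "f a = complex_of_real (p a)" "0 \<le> p a" for a
    unfolding p_def by (auto simp: complex_nonneg_Reals_iff complex_eq_iff)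
  have fp: "f = (\<lambda>a. complex_of_real (p a))" using p by auto
  have out: "p a = 0" if "a \<notin> supp f" for a using supp_outside[OF that] unfolding p_def by simp
  have "1 - e < sum p (fib (rg k) \<inter> supp f) \<and>
      (\<forall>Y. finite Y \<and> Y \<subseteq> fib (rg k) \<longrightarrow> sum p Y < 1 + e \<and> (\<Sum>b\<in>Y. \<bar>p b - p (b \<cdot> k)\<bar>) < e)" if k: "k \<in> K" for k
  proof -
    define Z where "Z = fib (rg k) \<inter> supp f"
    have Z: "finite Z" unfolding Z_def by (rule finite_fib[OF Cc_compact[OF f(1)]])
    have "(\<Sum>\<^sub>\<infinity>b\<in>fib (rg k). f b) = complex_of_real (sum p Z)"
      unfolding Z_def Cc_fib_sum[OF f(1)] by (simp add: p(1))
    with bspec[OF fK k] have "cmod (1 - complex_of_real (sum p Z)) < e" by simp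
    then have "cmod (complex_of_real (1 - sum p Z)) < e" by (simp only: of_real_diff of_real_1)
    then have 1: "\<bar>1 - sum p Z\<bar> < e" by (simp only: norm_of_real)
    \<comment> \<open>\<open>W\<close> contains the supports, within this fibre, of \<open>p\<close>
      and of its translate by \<open>k\<close>.\<close>
    define W where "W = Z \<union> {b \<in> fib (sc (iv k)). b \<cdot> iv (iv k) \<in> supp f}"
    have "finite {b \<in> fib (sc (iv k)). b \<cdot> iv (iv k) \<in> supp f}"
      using card_quotient_fibre[OF Cc_compact[OF f(1)]] by blast
    then have W: "finite W" "W \<subseteq> fib (rg k)" unfolding W_def using Z by (auto simp: Z_def)
    have W0: "p b = 0 \<and> p (b \<cdot> k) = 0" if "sc b = rg k" "b \<notin> W" for b
      using that out unfolding W_def Z_def by auto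
    have "(\<Sum>\<^sub>\<infinity>b\<in>fib (rg k). cmod (f b - f (b \<cdot> k))) = (\<Sum>b\<in>W. cmod (f b - f (b \<cdot> k)))"
      by (rule infsum_fib[OF W]) (simp add: p(1) W0)
    also have "\<dots> = (\<Sum>b\<in>W. \<bar>p b - p (b \<cdot> k)\<bar>)"
      by (intro sum.cong refl) (simp add: p(1) norm_of_real flip: of_real_diff)
    finally have 2: "(\<Sum>b\<in>W. \<bar>p b - p (b \<cdot> k)\<bar>) < e" using bspec[OF fK k] by linarith
    have "sum p Y < 1 + e \<and> (\<Sum>b\<in>Y. \<bar>p b - p (b \<cdot> k)\<bar>) < e" if Y: "finite Y" "Y \<subseteq> fib (rg k)" for Y
    proof
      have "sum p Y = sum p (Y \<inter> Z)" using Y out by (intro sum.mono_neutral_right) (auto simp: Z_def)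
      also have "\<dots> \<le> sum p Z" using Z p(2) by (intro sum_mono2) auto
      finally show "sum p Y < 1 + e" using 1 by linarith
      have "\<bar>p b - p (b \<cdot> k)\<bar> = 0" if "b \<in> Y - W" for b
        using W0[of b] subsetD[OF Y(2), of b] that by simp
      then have "(\<Sum>b\<in>Y. \<bar>p b - p (b \<cdot> k)\<bar>) = (\<Sum>b\<in>Y \<inter> W. \<bar>p b - p (b \<cdot> k)\<bar>)"
        using Y(1) by (intro sum.mono_neutral_right) auto
      also have "\<dots> \<le> (\<Sum>b\<in>W. \<bar>p b - p (b \<cdot> k)\<bar>)" using W by (intro sum_mono2) auto
      finally show "(\<Sum>b\<in>Y. \<bar>p b - p (b \<cdot> k)\<bar>) < e" using 2 by linarith
    qed
    then show ?thesis using 1 unfolding Z_def by auto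
  qed
  then show ?thesis using f(1) p(2) unfolding fp by (intro exI[of _ p]) blast
qed

text \<open>Suppose every level set of \<open>p (d \<cdot> iv c)\<close>, as a function of
  \<open>c\<close>, has a large boundary. The coarea inequality summed over \<open>d\<close> then
  bounds \<open>c0 * (1 - e) * sum w F\<close>, which comes from the mass of \<open>p\<close>, by
  \<open>real N * e * sum w F\<close>, which comes from its almost invariance along
  \<open>L\<close>.\<close>

lemma amenable_level_set:
  assumes p: "\<And>a. 0 \<le> p a" and S: "compact S" "\<And>a. p a \<noteq> 0 \<Longrightarrow> a \<in> S"
    and F: "finite F" "F \<subseteq> fib x" and w: "\<And>c. 0 \<le> w c" "0 < sum w F"
    and h1: "\<And>c. c \<in> F \<Longrightarrow> 1 - e \<le> sum p (fib (rg c) \<inter> S)"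
    and h2: "\<And>c a Y. c \<in> F \<Longrightarrow> a \<in> F \<Longrightarrow> c \<cdot> iv a \<in> L \<Longrightarrow> finite Y \<Longrightarrow> Y \<subseteq> fib (rg c) \<Longrightarrow>
        (\<Sum>b\<in>Y. \<bar>p b - p (b \<cdot> (c \<cdot> iv a))\<bar>) \<le> e"
    and N: "\<And>c. c \<in> F \<Longrightarrow> card {a\<in>F. c \<cdot> iv a \<in> L} \<le> N"
    and c0: "0 \<le> c0" "0 \<le> e" "real N * e < c0 * (1 - e)"
  shows "\<exists>E\<subseteq>F. E \<noteq> {} \<and> (\<forall>c\<in>E. \<forall>a\<in>E. c \<cdot> iv a \<in> set_mult G (iv ` S) S) \<and>
    sum w {c\<in>E. \<exists>a\<in>F-E. c \<cdot> iv a \<in> L} \<le> c0 * sum w E"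
proof (rule ccontr)
  assume neg: "\<not> ?thesis"
  \<comment> \<open>These are all the \<open>d\<close> for which \<open>p (d \<cdot> iv c)\<close>
    can be nonzero for some \<open>c\<close> in \<open>F\<close>.\<close>
  define Y where "Y = (\<Union>c\<in>F. {d \<in> fib (sc c). d \<cdot> iv c \<in> S})"
  have fq: "finite {d \<in> fib (sc c). d \<cdot> iv c \<in> S}" for c
    using card_quotient_fibre[OF S(1)] by blast
  have Y: "finite Y" "Y \<subseteq> fib x" unfolding Y_def using F fq by auto
  have Fx: "sc c = x" if "c \<in> F" for c using F(2) that by auto
  have Yx: "sc d = x" if "d \<in> Y" for d using Y(2) that by auto
  have key: "c0 * (\<Sum>c\<in>F. w c * p (d \<cdot> iv c)) \<le>
      (\<Sum>c\<in>F. w c * (\<Sum>a\<in>{a\<in>F. c \<cdot> iv a \<in> L}. \<bar>p (d \<cdot> iv c) - p (d \<cdot> iv a)\<bar>))" if d: "d \<in> Y" for d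
  proof (rule coarea_inequality[OF F(1) w(1)])
    fix t :: real assume t: "0 \<le> t"
    define E where "E = {c\<in>F. t < p (d \<cdot> iv c)}"
    have dS: "d \<cdot> iv c \<in> S" "sc c = sc d" if "c \<in> E" for c
      using that t S(2)[of "d \<cdot> iv c"] Fx Yx[OF d] unfolding E_def by auto
    \<comment> \<open>The common \<open>d\<close> cancels between two members of a level set; this
      is what bounds the size of a cluster.\<close>
    have q: "c \<cdot> iv a \<in> set_mult G (iv ` S) S" if ca: "c \<in> E" "a \<in> E" for c a
    proof -
      have "iv (d \<cdot> iv c) \<cdot> (d \<cdot> iv a) \<in> set_mult G (iv ` S) S"
        using dS[OF ca(1)] dS[OF ca(2)] by (intro set_multI imageI) auto
      moreover have "iv (d \<cdot> iv c) \<cdot> (d \<cdot> iv a) = c \<cdot> iv a"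
        using dS[OF ca(1)] dS[OF ca(2)] by simp
      ultimately show ?thesis by simp
    qed
    have bd: "{c\<in>E. \<exists>a\<in>F-E. c \<cdot> iv a \<in> L} = {c\<in>F. t < p (d \<cdot> iv c) \<and> (\<exists>a\<in>F. c \<cdot> iv a \<in> L \<and> p (d \<cdot> iv a) \<le> t)}"
      unfolding E_def by auto
    have "c0 * sum w E \<le> sum w {c\<in>E. \<exists>a\<in>F-E. c \<cdot> iv a \<in> L}"
    proof (cases "E = {}")
      case False
      have "\<not> sum w {c\<in>E. \<exists>a\<in>F-E. c \<cdot> iv a \<in> L} \<le> c0 * sum w E"
      proof
        assume le: "sum w {c\<in>E. \<exists>a\<in>F-E. c \<cdot> iv a \<in> L} \<le> c0 * sum w E"
        have "E \<subseteq> F" unfolding E_def by auto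
        then have "\<exists>E\<subseteq>F. E \<noteq> {} \<and> (\<forall>c\<in>E. \<forall>a\<in>E. c \<cdot> iv a \<in> set_mult G (iv ` S) S) \<and>
            sum w {c\<in>E. \<exists>a\<in>F-E. c \<cdot> iv a \<in> L} \<le> c0 * sum w E"
          by (intro exI[of _ E] conjI ballI q le False)
        with neg show False by contradiction
      qed
      then show ?thesis by linarith
    qed simp
    then show "c0 * sum w {c\<in>F. t < p (d \<cdot> iv c)} \<le>
        sum w {c\<in>F. t < p (d \<cdot> iv c) \<and> (\<exists>a\<in>F. c \<cdot> iv a \<in> L \<and> p (d \<cdot> iv a) \<le> t)}"
      unfolding bd by (simp add: E_def)
  qed (rule p)
  have mass: "1 - e \<le> (\<Sum>d\<in>Y. p (d \<cdot> iv c))" if c: "c \<in> F" for c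
  proof -
    have "sum p (fib (rg c) \<inter> S) = (\<Sum>d\<in>(\<lambda>b. b \<cdot> c) ` (fib (rg c) \<inter> S). p (d \<cdot> iv c))"
    proof (subst sum.reindex)
      show "inj_on (\<lambda>b. b \<cdot> c) (fib (rg c) \<inter> S)"
        by (rule inj_onI) (metis IntD1 in_fib mult_iv_cancel)
    qed (auto intro!: sum.cong simp: mult_iv_cancel)
    also have "\<dots> \<le> (\<Sum>d\<in>Y. p (d \<cdot> iv c))"
    proof (rule sum_mono2[OF Y(1)])
      show "(\<lambda>b. b \<cdot> c) ` (fib (rg c) \<inter> S) \<subseteq> Y"
        unfolding Y_def using c by (auto intro!: bexI[of _ c] simp: mult_iv_cancel)
    qed (rule p)
    finally show ?thesis using h1[OF c] by linarith
  qed
  \<comment> \<open>After the substitution \<open>b = d \<cdot> iv c\<close>, right translation by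
    \<open>c \<cdot> iv a\<close> replaces \<open>c\<close> by \<open>a\<close>.\<close>
  have diff: "(\<Sum>d\<in>Y. \<bar>p (d \<cdot> iv c) - p (d \<cdot> iv a)\<bar>) \<le> e" if ca: "c \<in> F" "a \<in> F" "c \<cdot> iv a \<in> L" for c a
  proof -
    have sca: "sc c = sc a" using Fx ca by simp
    have inj: "inj_on (\<lambda>d. d \<cdot> iv c) Y"
    proof (rule inj_onI)
      fix d d' assume "d \<in> Y" "d' \<in> Y" "d \<cdot> iv c = d' \<cdot> iv c"
      then show "d = d'" using div_inj[of d c d'] Yx Fx[OF ca(1)] by simp
    qed
    have "(\<Sum>b\<in>(\<lambda>d. d \<cdot> iv c) ` Y. \<bar>p b - p (b \<cdot> (c \<cdot> iv a))\<bar>) \<le> e"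
      by (rule h2[OF ca]) (use Y(1) Yx Fx[OF ca(1)] in auto)
    then have "(\<Sum>d\<in>Y. \<bar>p (d \<cdot> iv c) - p (d \<cdot> iv c \<cdot> (c \<cdot> iv a))\<bar>) \<le> e"
      by (simp add: sum.reindex[OF inj])
    moreover have "d \<cdot> iv c \<cdot> (c \<cdot> iv a) = d \<cdot> iv a" if "d \<in> Y" for d
      using Yx[OF that] Fx[OF ca(1)] sca by simp
    ultimately show ?thesis by (simp cong: sum.cong)
  qed
  have "c0 * ((1 - e) * sum w F) \<le> c0 * (\<Sum>d\<in>Y. \<Sum>c\<in>F. w c * p (d \<cdot> iv c))"
  proof (rule mult_left_mono[OF _ c0(1)])
    have "(1 - e) * sum w F = (\<Sum>c\<in>F. w c * (1 - e))"
      unfolding sum_distrib_right[symmetric] by (rule mult.commute)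
    also have "\<dots> \<le> (\<Sum>c\<in>F. w c * (\<Sum>d\<in>Y. p (d \<cdot> iv c)))" by (intro sum_mono mult_left_mono mass w(1))
    also have "\<dots> = (\<Sum>d\<in>Y. \<Sum>c\<in>F. w c * p (d \<cdot> iv c))"
      unfolding sum_distrib_left by (rule sum.swap)
    finally show "(1 - e) * sum w F \<le> (\<Sum>d\<in>Y. \<Sum>c\<in>F. w c * p (d \<cdot> iv c))" .
  qed
  also have "\<dots> = (\<Sum>d\<in>Y. c0 * (\<Sum>c\<in>F. w c * p (d \<cdot> iv c)))" by (rule sum_distrib_left)
  also have "\<dots> \<le> (\<Sum>d\<in>Y. \<Sum>c\<in>F. w c * (\<Sum>a\<in>{a\<in>F. c \<cdot> iv a \<in> L}. \<bar>p (d \<cdot> iv c) - p (d \<cdot> iv a)\<bar>))"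
    by (intro sum_mono key)
  also have "\<dots> = (\<Sum>c\<in>F. w c * (\<Sum>d\<in>Y. \<Sum>a\<in>{a\<in>F. c \<cdot> iv a \<in> L}. \<bar>p (d \<cdot> iv c) - p (d \<cdot> iv a)\<bar>))"
    by (subst sum.swap) (simp only: sum_distrib_left)
  also have "\<dots> = (\<Sum>c\<in>F. w c * (\<Sum>a\<in>{a\<in>F. c \<cdot> iv a \<in> L}. \<Sum>d\<in>Y. \<bar>p (d \<cdot> iv c) - p (d \<cdot> iv a)\<bar>))"
    by (intro sum.cong refl arg_cong2[of _ _ _ _ "(*)"] sum.swap)
  also have "\<dots> \<le> (\<Sum>c\<in>F. w c * (real N * e))"
  proof (intro sum_mono mult_left_mono w(1))
    fix c assume c: "c \<in> F"
    have "(\<Sum>a\<in>{a\<in>F. c \<cdot> iv a \<in> L}. \<Sum>d\<in>Y. \<bar>p (d \<cdot> iv c) - p (d \<cdot> iv a)\<bar>) \<le> real (card {a\<in>F. c \<cdot> iv a \<in> L}) * e"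
      using diff[OF c] by (intro sum_bounded_above) auto
    also have "\<dots> \<le> real N * e" using N[OF c] c0(2) by (intro mult_right_mono) auto
    finally show "(\<Sum>a\<in>{a\<in>F. c \<cdot> iv a \<in> L}. \<Sum>d\<in>Y. \<bar>p (d \<cdot> iv c) - p (d \<cdot> iv a)\<bar>) \<le> real N * e" .
  qed
  also have "\<dots> = (real N * e) * sum w F"
    unfolding sum_distrib_right[symmetric] by (rule mult.commute)
  finally have "(c0 * (1 - e)) * sum w F \<le> (real N * e) * sum w F" by (simp add: mult.assoc)
  then have "c0 * (1 - e) \<le> real N * e" using w(2) by simp
  then show False using c0(3) by linarith
qed

text \<open>The involution of the real function \<open>h\<close> convolved with \<open>h\<close>,
  that is, the coefficient pairing \<open>h\<close> with its right translates. Its matrix on a fibre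
  is a Gram matrix.\<close>

definition pos_def :: "('a \<Rightarrow> real) \<Rightarrow> 'a \<Rightarrow> complex" where
  "pos_def h = conv (\<lambda>a. complex_of_real (h (iv a))) (\<lambda>a. complex_of_real (h a))"

lemma pos_def_Cc:
  assumes "(\<lambda>a. complex_of_real (h a)) \<in> Cc"
  shows "pos_def h \<in> Cc"
  unfolding pos_def_def using conv_Cc[OF Cc_star[OF assms] assms] by simp

lemma pos_def_eq: "pos_def h c = (\<Sum>\<^sub>\<infinity>b\<in>fib (rg c). complex_of_real (h b * h (b \<cdot> c)))"
  unfolding pos_def_def conv_def infsum_fib_right_mult
proof (rule infsum_cong)
  fix b assume "b \<in> fib (rg c)"
  then have b: "sc b = rg c" by simp
  then have "iv (c \<cdot> iv (b \<cdot> c)) = b" by (simp add: mult_iv_cancel)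
  then show "complex_of_real (h (iv (c \<cdot> iv (b \<cdot> c)))) * complex_of_real (h (b \<cdot> c)) = complex_of_real (h b * h (b \<cdot> c))"
    by simp
qed

text \<open>\<open>h\<close> is the square root of an almost invariant density. Since
  \<open>(sqrt a - sqrt b)^2\<close> is at most \<open>\<bar>a - b\<bar>\<close>, it is almost
  invariant in l2, so its coefficient is close to 1 on \<open>C\<close>.\<close>

lemma amenable_multiplier:
  assumes am: "amenable G" and e: "0 < e" "e \<le> 1" and C: "compact C"
  shows "\<exists>h::'a \<Rightarrow> real. (\<lambda>a. complex_of_real (h a)) \<in> Cc \<and>
    (\<forall>x Y. finite Y \<and> Y \<subseteq> fib x \<longrightarrow> (\<Sum>b\<in>Y. (h b)\<^sup>2) \<le> 2) \<and>
    (\<forall>c\<in>C. cmod (1 - pos_def h c) \<le> 2 * e)"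
proof -
  have C0: "compact (rg ` C \<union> sc ` C)"
    using C cont_rg cont_sc by (intro compact_Un compact_continuous_image) auto
  moreover have "rg ` C \<union> sc ` C \<subseteq> units G" by auto
  ultimately obtain q :: "'a \<Rightarrow> real" where q: "(\<lambda>a. complex_of_real (q a)) \<in> Cc" "\<And>a. a \<notin> units G \<Longrightarrow> q a = 0"
    "\<And>a. a \<in> rg ` C \<union> sc ` C \<Longrightarrow> q a = 1" "\<And>a. 0 \<le> q a" "\<And>a. q a \<le> 1"
    using unit_bump[of "rg ` C \<union> sc ` C"] by metis
  let ?L = "supp (\<lambda>a. complex_of_real (q a))"
  have "compact (C \<union> ?L)" by (intro compact_Un C Cc_compact q(1))
  from amenable_function[OF am e(1) this] obtain p :: "'a \<Rightarrow> real" where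
    p: "(\<lambda>a. complex_of_real (p a)) \<in> Cc" "\<forall>a. 0 \<le> p a" and
    pK: "\<forall>k\<in>C \<union> ?L. 1 - e < sum p (fib (rg k) \<inter> supp (\<lambda>a. complex_of_real (p a))) \<and>
      (\<forall>Y. finite Y \<and> Y \<subseteq> fib (rg k) \<longrightarrow> sum p Y < 1 + e \<and> (\<Sum>b\<in>Y. \<bar>p b - p (b \<cdot> k)\<bar>) < e)"
    by (elim exE conjE) (rule that)
  let ?S = "supp (\<lambda>a. complex_of_real (p a))"
  have out: "p a = 0" if "a \<notin> ?S" for a using supp_outside[OF that] by simp
  \<comment> \<open>Amenability controls \<open>p\<close> only over a compact set of units, while
    the bound 2 is wanted over all of them. The factor \<open>q\<close> is 1 over the ranges and
    sources of \<open>C\<close> and cuts \<open>h\<close> off outside the controlled set.\<close>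
  define h where "h a = sqrt (p a) * q (sc a)" for a
  have "(\<lambda>a. complex_of_real (h a)) \<in> Cc"
  proof (rule CcI[OF _ Cc_compact[OF p(1)]])
    have "continuous_on UNIV (\<lambda>a. Re (complex_of_real (p a)))" "continuous_on UNIV (\<lambda>a. Re (complex_of_real (q a)))"
      by (intro continuous_on_Re Cc_cont p(1) q(1))+
    then have "continuous_on UNIV p" "continuous_on UNIV q" by simp_all
    then show "continuous_on UNIV (\<lambda>a. complex_of_real (h a))"
      unfolding h_def
      by (intro continuous_intros continuous_on_compose2[of UNIV q UNIV sc] cont_sc) auto
    show "a \<in> ?S" if "complex_of_real (h a) \<noteq> 0" for a
      using that out[of a] unfolding h_def by auto
  qed
  moreover have "(\<Sum>b\<in>Y. (h b)\<^sup>2) \<le> 2" if Y: "finite Y" "Y \<subseteq> fib x" for x Y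
  proof (cases "q x = 0")
    case True
    then have "h b = 0" if "b \<in> Y" for b using Y(2) that unfolding h_def by auto
    then show ?thesis by simp
  next
    case False
    then have x: "x \<in> ?L" "x \<in> units G" using suppI[of "\<lambda>a. complex_of_real (q a)" x] q(2) by auto
    then have "rg x = x" by (simp add: unit_iff(1))
    then have "sum p Y < 1 + e" using pK x(1) Y by (metis UnI2)
    moreover have "(\<Sum>b\<in>Y. (h b)\<^sup>2) \<le> sum p Y"
    proof (rule sum_mono)
      fix b
      have "(q (sc b))\<^sup>2 \<le> 1" using q(4,5) by (intro power_le_one) auto
      then have "p b * (q (sc b))\<^sup>2 \<le> p b * 1" using p(2) by (intro mult_left_mono) auto
      then show "(h b)\<^sup>2 \<le> p b" unfolding h_def using p(2) by (simp add: power_mult_distrib)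
    qed
    ultimately show ?thesis using e(2) by linarith
  qed
  moreover have "cmod (1 - pos_def h c) \<le> 2 * e" if c: "c \<in> C" for c
  proof -
    have one: "q (rg c) = 1" "q (sc c) = 1" using q(3) c by auto
    define W where "W = fib (rg c) \<inter> ?S \<union> {b \<in> fib (sc (iv c)). b \<cdot> iv (iv c) \<in> ?S}"
    have "finite {b \<in> fib (sc (iv c)). b \<cdot> iv (iv c) \<in> ?S}"
      using card_quotient_fibre[OF Cc_compact[OF p(1)]] by blast
    then have W: "finite W" "W \<subseteq> fib (rg c)" unfolding W_def using finite_fib[OF Cc_compact[OF p(1)]] by auto
    have hb: "(h b)\<^sup>2 = p b" "(h (b \<cdot> c))\<^sup>2 = p (b \<cdot> c)" "0 \<le> h b" "0 \<le> h (b \<cdot> c)" if "b \<in> W" for b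
    proof -
      have "sc b = rg c" using W(2) that by auto
      then show "(h b)\<^sup>2 = p b" "(h (b \<cdot> c))\<^sup>2 = p (b \<cdot> c)" "0 \<le> h b" "0 \<le> h (b \<cdot> c)"
        unfolding h_def using one p(2) by auto
    qed
    have "pos_def h c = (\<Sum>b\<in>W. complex_of_real (h b * h (b \<cdot> c)))"
      unfolding pos_def_eq
    proof (rule infsum_fib[OF W])
      fix b assume "sc b = rg c" "b \<notin> W"
      then have "p b = 0" using out unfolding W_def by auto
      then show "complex_of_real (h b * h (b \<cdot> c)) = 0" unfolding h_def by simp
    qed
    then have "1 - pos_def h c = complex_of_real (1 - (\<Sum>b\<in>W. h b * h (b \<cdot> c)))" by simp
    then have eq: "cmod (1 - pos_def h c) = \<bar>1 - (\<Sum>b\<in>W. h b * h (b \<cdot> c))\<bar>" by (simp only: norm_of_real)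
    have a: "1 - e < sum p (fib (rg c) \<inter> ?S)" "sum p W < 1 + e" "(\<Sum>b\<in>W. \<bar>p b - p (b \<cdot> c)\<bar>) < e"
      using pK c W by blast+
    have b: "sum p (fib (rg c) \<inter> ?S) \<le> sum p W"
      by (rule sum_mono2[OF W(1)]) (use p(2) in \<open>auto simp: W_def\<close>)
    have "(\<Sum>b\<in>W. (h b - h (b \<cdot> c))\<^sup>2) \<le> (\<Sum>b\<in>W. \<bar>p b - p (b \<cdot> c)\<bar>)"
    proof (rule sum_mono)
      fix b assume b: "b \<in> W"
      have "(h b - h (b \<cdot> c))\<^sup>2 = \<bar>h b - h (b \<cdot> c)\<bar> * \<bar>h b - h (b \<cdot> c)\<bar>" by (simp add: power2_eq_square flip: abs_mult)
      also have "\<dots> \<le> \<bar>h b - h (b \<cdot> c)\<bar> * (h b + h (b \<cdot> c))"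
        using hb(3,4)[OF b] by (intro mult_left_mono) auto
      also have "\<dots> = \<bar>h b - h (b \<cdot> c)\<bar> * \<bar>h b + h (b \<cdot> c)\<bar>" using hb(3,4)[OF b] by simp
      also have "\<dots> = \<bar>(h b)\<^sup>2 - (h (b \<cdot> c))\<^sup>2\<bar>"
        by (simp add: power2_eq_square algebra_simps flip: abs_mult)
      finally show "(h b - h (b \<cdot> c))\<^sup>2 \<le> \<bar>p b - p (b \<cdot> c)\<bar>" using hb(1,2)[OF b] by simp
    qed
    moreover have "(\<Sum>b\<in>W. (h b - h (b \<cdot> c))\<^sup>2) = sum p W + (\<Sum>b\<in>W. p (b \<cdot> c)) - 2 * (\<Sum>b\<in>W. h b * h (b \<cdot> c))"
    proof -
      have "(\<Sum>b\<in>W. (h b - h (b \<cdot> c))\<^sup>2) = (\<Sum>b\<in>W. p b + p (b \<cdot> c) - 2 * (h b * h (b \<cdot> c)))"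
        by (intro sum.cong refl) (simp add: hb(1,2)[symmetric] power2_diff)
      then show ?thesis by (simp add: sum.distrib sum_subtractf sum_distrib_left)
    qed
    moreover have "\<bar>sum p W - (\<Sum>b\<in>W. p (b \<cdot> c))\<bar> \<le> (\<Sum>b\<in>W. \<bar>p b - p (b \<cdot> c)\<bar>)"
      unfolding sum_subtractf[symmetric] by (rule sum_abs)
    moreover have "0 \<le> (\<Sum>b\<in>W. (h b - h (b \<cdot> c))\<^sup>2)" by (simp add: sum_nonneg)
    \<comment> \<open>The coefficient is half of the two masses minus the squared distance. These
      three differ from 1, 1 and 0 by at most \<open>e\<close>, \<open>2 * e\<close> and
      \<open>e\<close>.\<close>
    ultimately show ?thesis unfolding eq using a b by linarith
  qed
  ultimately show ?thesis by (intro exI[of _ h] conjI allI impI ballI) auto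
qed

text \<open>
  Pointwise multiplication by \<open>pos_def h\<close> is the compression of \<open>k \<otimes> 1\<close> by the operator with
  entries \<open>h (z \<cdot> iv c)\<close>. It does not enlarge supports, so bounds that hold for separated vectors
  persist with the same separating set.
\<close>

lemma multiplier_form:
  assumes h: "(\<lambda>a. complex_of_real (h a)) \<in> Cc" and h2: "\<And>x Y. finite Y \<Longrightarrow> Y \<subseteq> fib x \<Longrightarrow> (\<Sum>b\<in>Y. (h b)\<^sup>2) \<le> 2"
    and F: "finite F" "F \<subseteq> fib x" and d: "0 \<le> d"
    and bd: "\<And>z. cmod (bform (qm k) F (\<lambda>c. complex_of_real (h (z \<cdot> iv c)) * u c) (\<lambda>a. complex_of_real (h (z \<cdot> iv a)) * v a)) \<le>
      d * (l2n (\<lambda>c. complex_of_real (h (z \<cdot> iv c)) * u c) F * l2n (\<lambda>a. complex_of_real (h (z \<cdot> iv a)) * v a) F)"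
  shows "cmod (bform (qm (\<lambda>c. pos_def h c * k c)) F u v) \<le> 2 * d * (l2n u F * l2n v F)"
proof -
  let ?S = "supp (\<lambda>a. complex_of_real (h a))"
  have out: "h a = 0" if "a \<notin> ?S" for a using supp_outside[OF that] by simp
  define D where "D = (\<Union>c\<in>F. {z \<in> fib (sc c). z \<cdot> iv c \<in> ?S})"
  have "finite {z \<in> fib (sc c). z \<cdot> iv c \<in> ?S}" for c
    using card_quotient_fibre[OF Cc_compact[OF h]] by blast
  then have D: "finite D" "D \<subseteq> fib x" unfolding D_def using F by auto
  have Fx: "sc c = x" if "c \<in> F" for c using F(2) that by auto
  have Dx: "sc z = x" if "z \<in> D" for z using D(2) that by auto
  let ?h = "\<lambda>z c. complex_of_real (h (z \<cdot> iv c))"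
  \<comment> \<open>With \<open>z = b \<cdot> a\<close>, the coefficient at
    \<open>c \<cdot> iv a\<close> is the inner product of the columns \<open>c\<close> and
    \<open>a\<close> of the matrix \<open>h (z \<cdot> iv c)\<close>. The multiplied form thus
    splits into a sum over \<open>z\<close> of forms of \<open>k\<close>.\<close>
  have pd: "pos_def h (c \<cdot> iv a) = (\<Sum>z\<in>D. ?h z c * ?h z a)" if ca: "c \<in> F" "a \<in> F" for c a
  proof -
    have s: "sc c = sc a" "sc a = x" using Fx ca by auto
    have "pos_def h (c \<cdot> iv a) = (\<Sum>\<^sub>\<infinity>b\<in>fib (sc (c \<cdot> iv a)). complex_of_real (h (iv (c \<cdot> iv a \<cdot> iv b))) * complex_of_real (h b))"
      unfolding pos_def_def conv_def ..
    also have "sc (c \<cdot> iv a) = rg a" using s(1) by simp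
    also have "(\<Sum>\<^sub>\<infinity>b\<in>fib (rg a). complex_of_real (h (iv (c \<cdot> iv a \<cdot> iv b))) * complex_of_real (h b)) =
        (\<Sum>\<^sub>\<infinity>b\<in>fib (rg a). ?h (b \<cdot> a) c * ?h (b \<cdot> a) a)"
    proof (rule infsum_cong)
      fix b assume "b \<in> fib (rg a)"
      then have b: "sc b = rg a" by simp
      have 1: "b \<cdot> a \<cdot> iv a = b" by (rule mult_iv_cancel[OF b])
      have "iv (c \<cdot> iv a \<cdot> iv b) = b \<cdot> iv (c \<cdot> iv a)" using s b by simp
      also have "\<dots> = b \<cdot> (a \<cdot> iv c)" using s by simp
      also have "\<dots> = b \<cdot> a \<cdot> iv c" using s b by (simp add: mult_assoc)
      finally show "complex_of_real (h (iv (c \<cdot> iv a \<cdot> iv b))) * complex_of_real (h b) = ?h (b \<cdot> a) c * ?h (b \<cdot> a) a"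
        using 1 by simp
    qed
    also have "\<dots> = (\<Sum>\<^sub>\<infinity>z\<in>fib (sc a). ?h z c * ?h z a)" by (rule infsum_fib_right_mult[symmetric])
    also have "\<dots> = (\<Sum>z\<in>D. ?h z c * ?h z a)"
    proof (rule infsum_fib[OF D(1)])
      show "D \<subseteq> fib (sc a)" using D(2) s by simp
      fix z assume "sc z = sc a" "z \<notin> D"
      then have "z \<cdot> iv a \<notin> ?S" unfolding D_def using ca(2) by auto
      then show "?h z c * ?h z a = 0" using out by simp
    qed
    finally show ?thesis .
  qed
  have "bform (qm (\<lambda>c. pos_def h c * k c)) F u v = (\<Sum>c\<in>F. \<Sum>a\<in>F. \<Sum>z\<in>D. (?h z c * u c) * k (c \<cdot> iv a) * (?h z a * v a))"
    unfolding bform_def by (intro sum.cong refl) (simp add: pd sum_distrib_left sum_distrib_right mult_ac)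
  also have "\<dots> = (\<Sum>c\<in>F. \<Sum>z\<in>D. \<Sum>a\<in>F. (?h z c * u c) * k (c \<cdot> iv a) * (?h z a * v a))"
    by (intro sum.cong refl sum.swap)
  also have "\<dots> = (\<Sum>z\<in>D. bform (qm k) F (\<lambda>c. ?h z c * u c) (\<lambda>a. ?h z a * v a))"
    unfolding bform_def by (rule sum.swap)
  also have "cmod \<dots> \<le> (\<Sum>z\<in>D. d * (l2n (\<lambda>c. ?h z c * u c) F * l2n (\<lambda>a. ?h z a * v a) F))"
    by (rule order_trans[OF norm_sum sum_mono[OF bd]])
  also have "\<dots> = d * (\<Sum>z\<in>D. l2n (\<lambda>c. ?h z c * u c) F * l2n (\<lambda>a. ?h z a * v a) F)"
    by (simp add: sum_distrib_left)
  also have "\<dots> \<le> d * ((sqrt 2 * l2n u F) * (sqrt 2 * l2n v F))"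
  proof (rule mult_left_mono[OF _ d])
    \<comment> \<open>Each column of that matrix has squared norm at most 2 by \<open>h2\<close>.
      Both vectors pay \<open>sqrt 2\<close>, hence the factor 2 in the claim.\<close>
    have sq: "L2_set (\<lambda>z. l2n (\<lambda>c. ?h z c * y c) F) D \<le> sqrt 2 * l2n y F" for y :: "'a \<Rightarrow> complex"
    proof -
      have "(\<Sum>z\<in>D. (l2n (\<lambda>c. ?h z c * y c) F)\<^sup>2) = (\<Sum>z\<in>D. \<Sum>c\<in>F. (h (z \<cdot> iv c))\<^sup>2 * (cmod (y c))\<^sup>2)"
        by (simp add: l2n_sq norm_mult power_mult_distrib)
      also have "\<dots> = (\<Sum>c\<in>F. (\<Sum>z\<in>D. (h (z \<cdot> iv c))\<^sup>2) * (cmod (y c))\<^sup>2)"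
        unfolding sum_distrib_right by (rule sum.swap)
      also have "\<dots> \<le> (\<Sum>c\<in>F. 2 * (cmod (y c))\<^sup>2)"
      proof (intro sum_mono mult_right_mono)
        fix c assume c: "c \<in> F"
        have inj: "inj_on (\<lambda>z. z \<cdot> iv c) D"
        proof (rule inj_onI)
          fix z z' assume "z \<in> D" "z' \<in> D" "z \<cdot> iv c = z' \<cdot> iv c"
          then show "z = z'" using div_inj[of z c z'] Dx Fx[OF c] by simp
        qed
        have "(\<Sum>b\<in>(\<lambda>z. z \<cdot> iv c) ` D. (h b)\<^sup>2) \<le> 2"
          by (rule h2[of _ "rg c"]) (use D(1) Dx Fx[OF c] in auto)
        then show "(\<Sum>z\<in>D. (h (z \<cdot> iv c))\<^sup>2) \<le> 2" by (simp add: sum.reindex[OF inj])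
      qed simp
      also have "\<dots> = 2 * (l2n y F)\<^sup>2" by (simp add: l2n_sq sum_distrib_left)
      finally have "L2_set (\<lambda>z. l2n (\<lambda>c. ?h z c * y c) F) D \<le> sqrt (2 * (l2n y F)\<^sup>2)"
        unfolding L2_set_def by (rule real_sqrt_le_mono)
      then show ?thesis by (simp add: real_sqrt_mult)
    qed
    have "(\<Sum>z\<in>D. l2n (\<lambda>c. ?h z c * u c) F * l2n (\<lambda>a. ?h z a * v a) F) \<le>
        L2_set (\<lambda>z. l2n (\<lambda>c. ?h z c * u c) F) D * L2_set (\<lambda>z. l2n (\<lambda>a. ?h z a * v a) F) D"
      using L2_set_mult_ineq[of "\<lambda>z. l2n (\<lambda>c. ?h z c * u c) F" "\<lambda>z. l2n (\<lambda>a. ?h z a * v a) F" D] by simp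
    also have "\<dots> \<le> (sqrt 2 * l2n u F) * (sqrt 2 * l2n v F)"
      by (intro mult_mono sq) auto
    finally show "(\<Sum>z\<in>D. l2n (\<lambda>c. ?h z c * u c) F * l2n (\<lambda>a. ?h z a * v a) F) \<le> (sqrt 2 * l2n u F) * (sqrt 2 * l2n v F)" .
  qed
  also have "\<dots> = d * ((sqrt 2 * sqrt 2) * (l2n u F * l2n v F))" by (simp only: mult_ac)
  finally show ?thesis by simp
qed

end

section \<open>Quasi-local equivariant operators\<close>

lemma bform_entry_bound:
  assumes "finite F" "x \<in> F" "y \<in> F" and bd: "\<And>u v. cmod (bform a F u v) \<le> M * (l2n u F * l2n v F)"
  shows "cmod (a x y) \<le> M"
proof -
  let ?\<delta> = "\<lambda>x z. complex_of_real (of_bool (z = x))"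
  have one: "l2n (?\<delta> z) F = 1" if "z \<in> F" for z
  proof -
    have "(\<Sum>i\<in>F. (cmod (?\<delta> z i))\<^sup>2) = (\<Sum>i\<in>F. if i = z then 1 else 0)"
      by (intro sum.cong) auto
    then show ?thesis using assms(1) that unfolding l2n_def L2_set_def by simp
  qed
  have "bform a F (?\<delta> x) (?\<delta> y) = (\<Sum>i\<in>F. \<Sum>j\<in>F. if j = y then (if i = x then a i j else 0) else 0)"
    unfolding bform_def by (intro sum.cong) auto
  also have "\<dots> = a x y" using assms(1-3) by simp
  finally show ?thesis using bd[of "?\<delta> x" "?\<delta> y"] one[OF assms(2)] one[OF assms(3)] by simp
qed

lemma bform_restrict:
  assumes "finite F"
  shows "bform a F (\<lambda>x. of_bool (P x) * u x) (\<lambda>x. of_bool (P x) * v x) = bform a {x\<in>F. P x} u v"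
proof -
  have "bform a F (\<lambda>x. of_bool (P x) * u x) (\<lambda>x. of_bool (P x) * v x) =
      (\<Sum>x\<in>F. if P x then (\<Sum>y\<in>F. if P y then u x * a x y * v y else 0) else 0)"
    unfolding bform_def by (intro sum.cong refl) (auto intro!: sum.cong sum.neutral)
  also have "\<dots> = bform a {x\<in>F. P x} u v"
    unfolding bform_def using assms by (simp add: sum.inter_filter)
  finally show ?thesis .
qed

section \<open>Approximation of the kernel and the remaining inclusion\<close>

context equivariant_operator
begin

text \<open>
  The order of choices matters. Quasi-locality fixes \<open>K\<close>, then amenability for \<open>K\<close> fixes the size
  of the clusters, and only then is the multiplier chosen, close to 1 on the clusters. This is
  possible because the multiplied kernel is quasi-local for the same \<open>K\<close>, whatever the multiplier.
\<close>

lemma kernel_approximation: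
  assumes ql: "T \<in> uniform_quasi_local_algebra G" and am: "amenable G" and e: "0 < e"
  shows "\<exists>\<phi>\<in>Cc. \<forall>x F u v. finite F \<longrightarrow> F \<subseteq> fib x \<longrightarrow>
    cmod (bform (qm (\<lambda>c. kernel c - \<phi> c * kernel c)) F u v) \<le> e * (l2n u F * l2n v F)"
proof -
  obtain M where M: "0 \<le> M" "\<And>\<xi>. \<xi> \<in> L2 G \<Longrightarrow> nrm (T \<xi>) \<le> M * nrm \<xi>" using bop_bound[OF bT] by blast
  have kb: "cmod (bform (qm kernel) F u v) \<le> M * (l2n u F * l2n v F)" if "finite F" "F \<subseteq> fib x" for F x u v
    by (rule kernel_form_bounded[OF M(2,1) that])
  \<comment> \<open>Quasi-locality of the difference costs \<open>3 * d\<close> and is used seven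
    times: for two corners outside \<open>K\<close>, and with weight 5 in
    \<open>localised_bound\<close>. The total \<open>21 * d\<close> is a quarter of
    \<open>e\<close>.\<close>
  define d where "d = e / 84"
  have d: "0 < d" unfolding d_def using e by simp
  obtain K where K: "compact K" "\<forall>a\<in>K. iv a \<in> K \<and> rg a \<in> K" and
    Kq: "\<forall>x F u v. finite F \<longrightarrow> F \<subseteq> fib x \<longrightarrow> (\<forall>c\<in>F. \<forall>a\<in>F. u c \<noteq> 0 \<longrightarrow> v a \<noteq> 0 \<longrightarrow> c \<cdot> iv a \<notin> K) \<longrightarrow>
      cmod (bform (qm kernel) F u v) \<le> d * (l2n u F * l2n v F)"
    using kernel_form_quasi_local[OF ql d] by (elim exE conjE) (rule that)
  \<comment> \<open>Two points with a common neighbour for \<open>K\<close> have their quotient in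
    \<open>L\<close>, so clusters separated for \<open>L\<close> have disjoint neighbourhoods for
    \<open>K\<close>.\<close>
  define L where "L = set_mult G K K"
  have L: "compact L" unfolding L_def by (rule compact_set_mult[OF K(1) K(1)])
  obtain N1 :: nat where N1: "\<forall>c. finite {a \<in> fib (sc c). c \<cdot> iv a \<in> L} \<and> card {a \<in> fib (sc c). c \<cdot> iv a \<in> L} \<le> N1 \<and>
    finite {a \<in> fib (sc c). a \<cdot> iv c \<in> L} \<and> card {a \<in> fib (sc c). a \<cdot> iv c \<in> L} \<le> N1"
    using card_quotient_fibre[OF L] by blast
  \<comment> \<open>The mass lost by sparsification enters as \<open>3 * M * sqrt c0\<close>, which
    becomes at most \<open>e / 4\<close>; \<open>M + 1\<close> avoids division by 0.\<close>
  define c0 where "c0 = (e / (12 * (M + 1)))\<^sup>2"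
  have c0: "0 < c0" "sqrt c0 = e / (12 * (M + 1))" unfolding c0_def using e M(1) by auto
  have c0M: "3 * M * sqrt c0 \<le> e / 4"
    unfolding c0(2) using e M(1) by (simp add: field_simps)
  \<comment> \<open>The level set argument needs \<open>(real N1 + c0) * e1 < c0\<close>; this
    choice gives \<open>c0 / 2\<close> on the left.\<close>
  define e1 where "e1 = c0 / (2 * (real N1 + c0))"
  have e1: "0 < e1" unfolding e1_def using c0(1) by (simp add: add_nonneg_pos)
  have "(real N1 + c0) * e1 = c0 / 2" unfolding e1_def using c0(1) add_nonneg_pos[of "real N1" c0] by (simp add: field_simps)
  then have e1c: "real N1 * e1 < c0 * (1 - e1)" using c0(1) by (simp add: algebra_simps)
  from amenable_function[OF am e1 L] obtain p :: "'a \<Rightarrow> real" where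
    p: "(\<lambda>a. complex_of_real (p a)) \<in> Cc" "\<forall>a. 0 \<le> p a" and
    pL: "\<forall>k\<in>L. 1 - e1 < sum p (fib (rg k) \<inter> supp (\<lambda>a. complex_of_real (p a))) \<and>
      (\<forall>Y. finite Y \<and> Y \<subseteq> fib (rg k) \<longrightarrow> sum p Y < 1 + e1 \<and> (\<Sum>b\<in>Y. \<bar>p b - p (b \<cdot> k)\<bar>) < e1)"
    by (elim exE conjE) (rule that)
  define S where "S = supp (\<lambda>a. complex_of_real (p a))"
  have S: "compact S" "\<And>a. p a \<noteq> 0 \<Longrightarrow> a \<in> S"
    unfolding S_def using Cc_compact[OF p(1)] suppI[of "\<lambda>a. complex_of_real (p a)"] by auto
  \<comment> \<open>Quotients within a cluster lie in \<open>S1\<close>, those between a cluster and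
    its neighbourhood in \<open>S2\<close>. The multiplier has to be close to 1 on the
    latter.\<close>
  define S1 where "S1 = set_mult G (iv ` S) S"
  define S2 where "S2 = set_mult G S1 K"
  have S2: "compact S2" unfolding S2_def S1_def by (intro compact_set_mult compact_iv S(1) K(1))
  obtain N2 :: nat where N2: "\<forall>c. finite {a \<in> fib (sc c). c \<cdot> iv a \<in> S2} \<and> card {a \<in> fib (sc c). c \<cdot> iv a \<in> S2} \<le> N2 \<and>
    finite {a \<in> fib (sc c). a \<cdot> iv c \<in> S2} \<and> card {a \<in> fib (sc c). a \<cdot> iv c \<in> S2} \<le> N2"
    using card_quotient_fibre[OF S2] by blast
  \<comment> \<open>The diagonal blocks have entries at most \<open>2 * e2 * M\<close> and at most
    \<open>N2\<close> relevant ones per row and column; the denominator brings their contribution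
    down to \<open>e / 4\<close>.\<close>
  define e2 where "e2 = min 1 (e / (8 * (M + 1) * (real N2 + 1)))"
  have e2: "0 < e2" "e2 \<le> 1" unfolding e2_def using e M(1) by auto
  define t where "t = 2 * e2 * M"
  have t: "0 \<le> t" unfolding t_def using e2 M(1) by simp
  have tN: "t * real N2 \<le> e / 4"
  proof -
    have "2 * e2 * (M * real N2) \<le> 2 * (e / (8 * (M + 1) * (real N2 + 1))) * ((M + 1) * (real N2 + 1))"
      using e2 M(1) e by (intro mult_mono) (auto simp: e2_def)
    also have "\<dots> = e / 4"
    proof -
      have "2 * (e / (8 * X)) * X = e / 4" if "X \<noteq> 0" for X :: real using that by simp
      moreover have "(M + 1) * (real N2 + 1) \<noteq> 0" using M(1) by (simp add: add_nonneg_eq_0_iff)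
      ultimately show ?thesis unfolding mult.assoc[of 8] by blast
    qed
    finally show ?thesis unfolding t_def by (simp add: mult.assoc)
  qed
  obtain h :: "'a \<Rightarrow> real" where h: "(\<lambda>a. complex_of_real (h a)) \<in> Cc"
    "\<forall>x Y. finite Y \<and> Y \<subseteq> fib x \<longrightarrow> (\<Sum>b\<in>Y. (h b)\<^sup>2) \<le> 2" "\<forall>c\<in>S2. cmod (1 - pos_def h c) \<le> 2 * e2"
    using amenable_multiplier[OF am e2 S2] by (elim exE conjE) (rule that)
  have h2: "(\<Sum>b\<in>Y. (h b)\<^sup>2) \<le> 2" if "finite Y" "Y \<subseteq> fib x" for x Y using h(2) that by blast
  let ?k = "\<lambda>c. kernel c - pos_def h c * kernel c"
  have split: "bform (qm ?k) F u v = bform (qm kernel) F u v - bform (qm (\<lambda>c. pos_def h c * kernel c)) F u v" for F u v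
    unfolding bform_def by (simp add: algebra_simps flip: sum_subtractf)
  have ab: "cmod (bform (qm ?k) F u v) \<le> 3 * M * (l2n u F * l2n v F)" if F: "finite F" "F \<subseteq> fib x" for F x u v
  proof -
    have "cmod (bform (qm (\<lambda>c. pos_def h c * kernel c)) F u v) \<le> 2 * M * (l2n u F * l2n v F)"
      by (rule multiplier_form[OF h(1) h2 F M(1) kb[OF F]])
    then show ?thesis unfolding split
      using kb[OF F, of u v] norm_triangle_ineq4[of "bform (qm kernel) F u v" "bform (qm (\<lambda>c. pos_def h c * kernel c)) F u v"]
      by (simp add: algebra_simps)
  qed
  \<comment> \<open>Weights in front of \<open>u\<close> and \<open>v\<close> do not enlarge
    supports, so the same \<open>K\<close> serves for the multiplied kernel. The kernel costs
    \<open>d\<close>, its multiple \<open>2 * d\<close>.\<close>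
  have aq: "cmod (bform (qm ?k) F u v) \<le> 3 * d * (l2n u F * l2n v F)"
    if F: "finite F" "F \<subseteq> fib x" and sep: "\<And>c a. c \<in> F \<Longrightarrow> a \<in> F \<Longrightarrow> u c \<noteq> 0 \<Longrightarrow> v a \<noteq> 0 \<Longrightarrow> c \<cdot> iv a \<notin> K" for F x u v
  proof -
    have q: "cmod (bform (qm kernel) F (\<lambda>c. r c * u c) (\<lambda>c. s c * v c)) \<le> d * (l2n (\<lambda>c. r c * u c) F * l2n (\<lambda>c. s c * v c) F)" for r s
      by (rule Kq[rule_format, OF F]) (use sep in auto)
    have "cmod (bform (qm (\<lambda>c. pos_def h c * kernel c)) F u v) \<le> 2 * d * (l2n u F * l2n v F)"
      by (rule multiplier_form[OF h(1) h2 F less_imp_le[OF d] q])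
    then show ?thesis unfolding split
      using q[of "\<lambda>_. 1" "\<lambda>_. 1"] norm_triangle_ineq4[of "bform (qm kernel) F u v" "bform (qm (\<lambda>c. pos_def h c * kernel c)) F u v"]
      by (simp add: algebra_simps)
  qed
  have main: "cmod (bform (qm ?k) F u v) \<le> (3 * M * sqrt c0 + 5 * (3 * d) + t * real N2) * (l2n u F * l2n v F)"
    if F: "finite F" "F \<subseteq> fib x" and FK: "\<And>c. c \<in> F \<Longrightarrow> rg c \<in> K" for F x u v
  proof -
    have Fx: "sc c = x" if "c \<in> F" for c using F(2) that by auto
    define R where "R c a \<longleftrightarrow> sc c = sc a \<and> c \<cdot> iv a \<in> K" for c a
    define R' where "R' c a \<longleftrightarrow> sc c = sc a \<and> c \<cdot> iv a \<in> L" for c a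
    have symR: "R a c" if "R c a" for c a
    proof -
      have "iv (c \<cdot> iv a) = a \<cdot> iv c" using that unfolding R_def by simp
      then show ?thesis using that K(2) unfolding R_def by metis
    qed
    have RR: "R' c b" if "R c a" "R a b" for a b c
    proof -
      have "c \<cdot> iv a \<cdot> (a \<cdot> iv b) \<in> L" unfolding L_def using that unfolding R_def by (intro set_multI) auto
      then show ?thesis using that unfolding R'_def R_def by simp
    qed
    have symR': "R' a c" if ca: "R' c a" for c a
    proof -
      obtain k1 k2 where k: "c \<cdot> iv a = k1 \<cdot> k2" "k1 \<in> K" "k2 \<in> K" "sc k1 = rg k2"
        using ca unfolding R'_def L_def set_mult_def by blast
      have "a \<cdot> iv c = iv (k1 \<cdot> k2)" using ca iv_div[of c a] k(1) unfolding R'_def by simp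
      also have "\<dots> = iv k2 \<cdot> iv k1" by (rule iv_distrib[OF k(4)])
      also have "\<dots> \<in> L" unfolding L_def using k K(2) by (intro set_multI) auto
      finally show ?thesis using ca unfolding R'_def by simp
    qed
    define w where "w c = (cmod (u c))\<^sup>2" for c
    have ex: "\<exists>E\<subseteq>F'. E \<noteq> {} \<and> (\<forall>c\<in>E. \<forall>a\<in>E. c \<cdot> iv a \<in> S1) \<and> sum w {c\<in>E. \<exists>a\<in>F'-E. R' c a} \<le> c0 * sum w E"
      if F': "F' \<subseteq> F" "0 < sum w F'" for F'
    proof -
      have fF': "finite F'" "F' \<subseteq> fib x" using F F' finite_subset by auto
      \<comment> \<open>A unit is its own square, so units of \<open>K\<close> lie in
        \<open>L\<close>, and the mass estimate for \<open>p\<close> is available over them.\<close>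
      have rgL: "rg c \<in> L" if "c \<in> F'" for c
      proof -
        have "rg c \<cdot> rg c \<in> L" unfolding L_def using FK[of c] that F'(1) by (intro set_multI) auto
        then show ?thesis using rg_mult_self[of "rg c"] by simp
      qed
      have "\<exists>E\<subseteq>F'. E \<noteq> {} \<and> (\<forall>c\<in>E. \<forall>a\<in>E. c \<cdot> iv a \<in> set_mult G (iv ` S) S) \<and>
          sum w {c\<in>E. \<exists>a\<in>F'-E. c \<cdot> iv a \<in> L} \<le> c0 * sum w E"
      proof (rule amenable_level_set[where p = p and e = e1 and N = N1, OF _ S fF'])
        show "1 - e1 \<le> sum p (fib (rg c) \<inter> S)" if "c \<in> F'" for c
          using bspec[OF pL rgL[OF that]] unfolding S_def by simp
        show "(\<Sum>b\<in>Y. \<bar>p b - p (b \<cdot> (c \<cdot> iv a))\<bar>) \<le> e1"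
          if ca: "c \<in> F'" "a \<in> F'" "c \<cdot> iv a \<in> L" and Y: "finite Y" "Y \<subseteq> fib (rg c)" for c a Y
        proof -
          have "sc c = sc a" using subsetD[OF fF'(2) ca(1)] subsetD[OF fF'(2) ca(2)] by simp
          then have "rg (c \<cdot> iv a) = rg c" by simp
          then show ?thesis using bspec[OF pL ca(3)] Y by (simp add: less_imp_le)
        qed
        show "card {a\<in>F'. c \<cdot> iv a \<in> L} \<le> N1" if "c \<in> F'" for c
        proof -
          have "{a\<in>F'. c \<cdot> iv a \<in> L} \<subseteq> {a \<in> fib (sc c). c \<cdot> iv a \<in> L}"
            using fF'(2) subsetD[OF fF'(2) that] by auto
          then show ?thesis using N1 card_mono order_trans by meson
        qed
      qed (use p(2) F'(2) c0(1) e1 e1c in \<open>auto simp: w_def\<close>)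
      then obtain E where E: "E \<subseteq> F'" "E \<noteq> {}" "\<forall>c\<in>E. \<forall>a\<in>E. c \<cdot> iv a \<in> set_mult G (iv ` S) S"
          "sum w {c\<in>E. \<exists>a\<in>F'-E. c \<cdot> iv a \<in> L} \<le> c0 * sum w E" by blast
      have scE: "sc c = sc a" if "c \<in> F'" "a \<in> F'" for c a
        using subsetD[OF fF'(2) that(1)] subsetD[OF fF'(2) that(2)] by simp
      have "{c\<in>E. \<exists>a\<in>F'-E. R' c a} = {c\<in>E. \<exists>a\<in>F'-E. c \<cdot> iv a \<in> L}"
        unfolding R'_def using E(1) scE by blast
      then have "sum w {c\<in>E. \<exists>a\<in>F'-E. R' c a} \<le> c0 * sum w E" using E(4) by simp
      then show ?thesis using E unfolding S1_def by (intro exI[of _ E] conjI)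
    qed
    have "\<exists>O' l. O' \<subseteq> F \<and> (\<forall>c\<in>O'. \<forall>a\<in>O'. R' c a \<longrightarrow> l c = (l a::nat)) \<and>
        (\<forall>c\<in>O'. \<forall>a\<in>O'. l c = l a \<longrightarrow> c \<cdot> iv a \<in> S1) \<and> sum w (F - O') \<le> c0 * sum w F"
      by (rule sparsification[OF F(1) less_imp_le[OF c0(1)] _ symR' ex]) (simp add: w_def)
    then obtain O' l where O': "O' \<subseteq> F" "\<forall>c\<in>O'. \<forall>a\<in>O'. R' c a \<longrightarrow> l c = (l a::nat)"
        "\<forall>c\<in>O'. \<forall>a\<in>O'. l c = l a \<longrightarrow> c \<cdot> iv a \<in> S1" "sum w (F - O') \<le> c0 * sum w F"
      by (elim exE conjE) (rule that)
    show ?thesis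
    proof (rule localised_bound[where R = R and Q = "\<lambda>c a. c \<cdot> iv a \<in> S1" and S = "\<lambda>c a. sc c = sc a \<and> c \<cdot> iv a \<in> S2"
          and O' = O' and l = l, OF F(1) _ _ t ab[OF F]])
      show "0 \<le> 3 * M" "0 \<le> 3 * d" using M(1) d by auto
      show "cmod (bform (qm ?k) F u v) \<le> 3 * d * (l2n u F * l2n v F)"
        if "\<And>c a. c \<in> F \<Longrightarrow> a \<in> F \<Longrightarrow> u c \<noteq> 0 \<Longrightarrow> v a \<noteq> 0 \<Longrightarrow> \<not> R c a" for u v
        by (rule aq[OF F]) (use that Fx in \<open>auto simp: R_def\<close>)
      show "R a c" if "R c a" for c a by (rule symR[OF that])
      show "O' \<subseteq> F" by (rule O')
      show "l c = l a" if "c \<in> O'" "a \<in> O'" "b \<in> F" "R c b" "R b a" for c a b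
        using O'(2) that RR by blast
      show "c \<cdot> iv a \<in> S1" if "c \<in> O'" "a \<in> O'" "l c = l a" for c a using O'(3) that by blast
      show "(\<Sum>c\<in>F - O'. (cmod (u c))\<^sup>2) \<le> c0 * (\<Sum>c\<in>F. (cmod (u c))\<^sup>2)" using O'(4) by (simp add: w_def)
      show "sc c = sc a \<and> c \<cdot> iv a \<in> S2" if "c \<in> F" "a \<in> F" "b \<in> F" "c \<cdot> iv b \<in> S1" "R b a" for c a b
      proof
        show s: "sc c = sc a" using Fx that by simp
        have "c \<cdot> iv b \<cdot> (b \<cdot> iv a) \<in> S2"
          unfolding S2_def using that Fx unfolding R_def by (intro set_multI) auto
        then show "c \<cdot> iv a \<in> S2" using Fx that by simp
      qed
      show "cmod (?k (c \<cdot> iv a)) \<le> t" if ca: "c \<in> F" "a \<in> F" and s: "sc c = sc a \<and> c \<cdot> iv a \<in> S2" for c a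
      proof -
        have 1: "cmod (kernel (c \<cdot> iv a)) \<le> M"
          using bform_entry_bound[where a = "qm kernel", OF F(1) ca kb[OF F]] .
        have 2: "cmod (1 - pos_def h (c \<cdot> iv a)) \<le> 2 * e2" using h(3) s by blast
        have "?k (c \<cdot> iv a) = (1 - pos_def h (c \<cdot> iv a)) * kernel (c \<cdot> iv a)" by (simp add: algebra_simps)
        then have "cmod (?k (c \<cdot> iv a)) = cmod (1 - pos_def h (c \<cdot> iv a)) * cmod (kernel (c \<cdot> iv a))"
          by (simp only: norm_mult)
        also have "\<dots> \<le> 2 * e2 * M" using e2 by (intro mult_mono 1 2) auto
        finally show ?thesis unfolding t_def .
      qed
      show "card {a\<in>F. sc c = sc a \<and> c \<cdot> iv a \<in> S2} \<le> N2" if "c \<in> F" for c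
      proof -
        have "{a\<in>F. sc c = sc a \<and> c \<cdot> iv a \<in> S2} \<subseteq> {a \<in> fib (sc c). c \<cdot> iv a \<in> S2}" by auto
        then show ?thesis using N2 card_mono order_trans by meson
      qed
      show "card {c\<in>F. sc c = sc a \<and> c \<cdot> iv a \<in> S2} \<le> N2" if "a \<in> F" for a
      proof -
        have "{c\<in>F. sc c = sc a \<and> c \<cdot> iv a \<in> S2} \<subseteq> {c \<in> fib (sc a). c \<cdot> iv a \<in> S2}" by auto
        then show ?thesis using N2 card_mono order_trans by meson
      qed
    qed
  qed
  have "cmod (bform (qm ?k) F u v) \<le> e * (l2n u F * l2n v F)" if F: "finite F" "F \<subseteq> fib x" for x F u v
  proof -
    define B where "B = l2n u F * l2n v F"
    have B0: "0 \<le> B" unfolding B_def by simp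
    have Fx: "sc c = x" if "c \<in> F" for c using F(2) that by auto
    define u1 where "u1 c = of_bool (rg c \<in> K) * u c" for c
    define u2 where "u2 c = of_bool (rg c \<notin> K) * u c" for c
    define v1 where "v1 c = of_bool (rg c \<in> K) * v c" for c
    define v2 where "v2 c = of_bool (rg c \<notin> K) * v c" for c
    have le: "l2n u1 F \<le> l2n u F" "l2n u2 F \<le> l2n u F" "l2n v1 F \<le> l2n v F" "l2n v2 F \<le> l2n v F"
      unfolding u1_def u2_def v1_def v2_def by (rule l2n_mono, simp add: norm_mult)+
    \<comment> \<open>As \<open>K\<close> is closed under ranges and inverses, a quotient in
      \<open>K\<close> forces both ranges into \<open>K\<close>. A vector carried by points with
      range outside \<open>K\<close> is therefore separated from every other vector.\<close>
    have K1: "rg c \<in> K" "rg a \<in> K" if "c \<in> F" "a \<in> F" "c \<cdot> iv a \<in> K" for c a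
    proof -
      have s: "sc c = sc a" using Fx that by simp
      have "rg (c \<cdot> iv a) \<in> K" "rg (iv (c \<cdot> iv a)) \<in> K" using K(2) that(3) by blast+
      then show "rg c \<in> K" "rg a \<in> K" using s by simp_all
    qed
    have "u = (\<lambda>c. u2 c + u1 c)" "v = (\<lambda>c. v2 c + v1 c)"
      unfolding u1_def u2_def v1_def v2_def by auto
    then have "bform (qm ?k) F u v = bform (qm ?k) F u2 v + bform (qm ?k) F u1 v"
      "bform (qm ?k) F u1 v = bform (qm ?k) F u1 v2 + bform (qm ?k) F u1 v1"
      by (metis bform_add_left, metis bform_add_right)
    then have sp: "bform (qm ?k) F u v = bform (qm ?k) F u2 v + bform (qm ?k) F u1 v2 + bform (qm ?k) F u1 v1" by simp
    have b1: "cmod (bform (qm ?k) F u2 v) \<le> 3 * d * B"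
    proof -
      have "cmod (bform (qm ?k) F u2 v) \<le> 3 * d * (l2n u2 F * l2n v F)"
      proof (rule aq[OF F])
        fix c a assume ca: "c \<in> F" "a \<in> F" "u2 c \<noteq> 0"
        then have "rg c \<notin> K" unfolding u2_def by simp
        then show "c \<cdot> iv a \<notin> K" using K1(1)[OF ca(1,2)] by blast
      qed
      also have "\<dots> \<le> 3 * d * B" unfolding B_def using d le by (intro mult_left_mono mult_mono) auto
      finally show ?thesis .
    qed
    have b2: "cmod (bform (qm ?k) F u1 v2) \<le> 3 * d * B"
    proof -
      have "cmod (bform (qm ?k) F u1 v2) \<le> 3 * d * (l2n u1 F * l2n v2 F)"
      proof (rule aq[OF F])
        fix c a assume ca: "c \<in> F" "a \<in> F" "v2 a \<noteq> 0"
        then have "rg a \<notin> K" unfolding v2_def by simp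
        then show "c \<cdot> iv a \<notin> K" using K1(2)[OF ca(1,2)] by blast
      qed
      also have "\<dots> \<le> 3 * d * B" unfolding B_def using d le by (intro mult_left_mono mult_mono) auto
      finally show ?thesis .
    qed
    let ?C = "3 * M * sqrt c0 + 5 * (3 * d) + t * real N2"
    have C0: "0 \<le> ?C" using M(1) c0(1) d t by simp
    define P where "P = {c\<in>F. rg c \<in> K}"
    have P: "finite P" "P \<subseteq> fib x" "P \<subseteq> F" unfolding P_def using F by auto
    have "bform (qm ?k) F u1 v1 = bform (qm ?k) P u v"
      unfolding u1_def v1_def P_def by (rule bform_restrict[OF F(1)])
    also have "cmod \<dots> \<le> ?C * (l2n u P * l2n v P)"
      by (rule main[OF P(1,2)]) (simp add: P_def)
    also have "\<dots> \<le> ?C * B" unfolding B_def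
      using C0 l2n_subset[OF F(1) P(3)] by (intro mult_left_mono mult_mono) auto
    finally have b3: "cmod (bform (qm ?k) F u1 v1) \<le> ?C * B" .
    have "cmod (bform (qm ?k) F u v) \<le> 3 * d * B + 3 * d * B + ?C * B"
      unfolding sp by (intro norm_triangle_le add_mono b1 b2 b3)
    also have "\<dots> = (21 * d + 3 * M * sqrt c0 + t * real N2) * B" by (simp add: algebra_simps)
    also have "\<dots> \<le> e * B"
      using c0M tN e by (intro mult_right_mono B0) (simp add: d_def)
    finally show ?thesis unfolding B_def .
  qed
  then show ?thesis by (intro bexI[of _ "pos_def h"] pos_def_Cc h(1)) blast
qed

text \<open>The approximant is convolution by the cut-off kernel \<open>f\<close>, which lies in
  \<open>Cc\<close>. Duality turns the matrix bound into a norm bound on \<open>Cc\<close>, and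
  density extends it to \<open>L2 G\<close>.\<close>

lemma quasi_local_in_reduced:
  assumes ql: "T \<in> uniform_quasi_local_algebra G" and am: "amenable G"
  shows "T \<in> reduced_algebra G"
proof -
  have "\<exists>S\<in>left_regular G ` Cc. operator_norm G (\<lambda>\<xi> a. T \<xi> a - S \<xi> a) < e" if e: "0 < e" for e
  proof -
    have "0 < e / 2" using e by simp
    from kernel_approximation[OF ql am this] obtain \<phi> where \<phi>: "\<phi> \<in> Cc" and
      bd: "\<forall>x F u v. finite F \<longrightarrow> F \<subseteq> fib x \<longrightarrow>
        cmod (bform (qm (\<lambda>c. kernel c - \<phi> c * kernel c)) F u v) \<le> e / 2 * (l2n u F * l2n v F)"
      by (elim bexE) (rule that)
    define f where "f c = \<phi> c * kernel c" for c
    have f: "f \<in> Cc" unfolding f_def[abs_def] by (rule Cc_mult_kernel[OF \<phi>])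
    let ?D = "\<lambda>\<xi> a. T \<xi> a - left_regular G f \<xi> a"
    have bD: "bop ?D" by (rule bop_minus[OF bT left_regular_bop[OF f]])
    have Cc: "nrm (?D \<xi>) \<le> e / 2 * nrm \<xi>" if \<xi>: "\<xi> \<in> Cc" for \<xi>
    proof (rule nrm_bound(2))
      fix x A assume A: "finite A" "A \<subseteq> fib x"
      have n: "0 \<le> nrm \<xi>" by (rule nrm_nonneg[OF Cc_fl2[OF \<xi>]])
      show "l2n (?D \<xi>) A \<le> e / 2 * nrm \<xi>"
      proof (rule l2n_dual)
        show "0 \<le> e / 2 * nrm \<xi>" using e n by simp
        fix u :: "'a \<Rightarrow> complex"
        \<comment> \<open>A square matrix is wanted: rows come from \<open>A\<close>, columns from
          the support of \<open>\<xi>\<close>, and \<open>u'\<close> is \<open>u\<close> padded with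
          zeros.\<close>
        define F where "F = A \<union> (fib x \<inter> supp \<xi>)"
        have F: "finite F" "F \<subseteq> fib x" unfolding F_def using A finite_fib[OF Cc_compact[OF \<xi>]] by auto
        define u' where "u' c = of_bool (c \<in> A) * u c" for c
        have D: "?D \<xi> c = (\<Sum>a\<in>F. (kernel (c \<cdot> iv a) - f (c \<cdot> iv a)) * \<xi> a)" if "c \<in> A" for c
        proof -
          have c: "sc c = x" using subsetD[OF A(2) that] by simp
          have "conv k \<xi> c = (\<Sum>a\<in>F. k (c \<cdot> iv a) * \<xi> a)" for k
            by (rule conv_sum[OF F(1)]) (use F(2) c in \<open>auto simp: F_def supp_outside\<close>)
          then show ?thesis
            by (simp add: T_conv[OF \<xi>] left_regular_apply[OF Cc_L2[OF \<xi>]] left_diff_distrib sum_subtractf)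
        qed
        have "(\<Sum>c\<in>A. u c * ?D \<xi> c) = (\<Sum>c\<in>F. \<Sum>a\<in>F. u' c * (kernel (c \<cdot> iv a) - f (c \<cdot> iv a)) * \<xi> a)"
        proof (rule sum.mono_neutral_cong_left[OF F(1)])
          show "A \<subseteq> F" unfolding F_def by simp
          show "\<forall>c\<in>F - A. (\<Sum>a\<in>F. u' c * (kernel (c \<cdot> iv a) - f (c \<cdot> iv a)) * \<xi> a) = 0"
            by (simp add: u'_def)
          show "u c * ?D \<xi> c = (\<Sum>a\<in>F. u' c * (kernel (c \<cdot> iv a) - f (c \<cdot> iv a)) * \<xi> a)" if "c \<in> A" for c
            unfolding D[OF that] using that by (simp add: u'_def sum_distrib_left mult.assoc)
        qed
        also have "\<dots> = bform (qm (\<lambda>c. kernel c - \<phi> c * kernel c)) F u' \<xi>"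
          unfolding bform_def f_def ..
        also have "cmod \<dots> \<le> e / 2 * (l2n u' F * l2n \<xi> F)" using bd F by blast
        also have "\<dots> \<le> e / 2 * (l2n u A * nrm \<xi>)"
        proof (intro mult_left_mono mult_mono)
          have "(\<Sum>c\<in>F. (cmod (u' c))\<^sup>2) = (\<Sum>c\<in>A. (cmod (u c))\<^sup>2)"
            using F(1) by (intro sum.mono_neutral_cong_right) (auto simp: F_def u'_def)
          then show "l2n u' F \<le> l2n u A" unfolding l2n_def L2_set_def by simp
          show "l2n \<xi> F \<le> nrm \<xi>" by (rule l2n_le_nrm[OF Cc_fl2[OF \<xi>] F])
        qed (use e in auto)
        finally show "cmod (\<Sum>c\<in>A. u c * ?D \<xi> c) \<le> e / 2 * nrm \<xi> * l2n u A" by (simp only: mult_ac)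
      qed
    qed
    obtain M where M: "0 \<le> M" "\<And>\<xi>. \<xi> \<in> L2 G \<Longrightarrow> nrm (?D \<xi>) \<le> M * nrm \<xi>" using bop_bound[OF bD] by blast
    have "operator_norm G ?D \<le> e / 2"
    proof (rule operator_norm_le)
      fix \<xi> assume \<xi>: "\<xi> \<in> L2 G" "nrm \<xi> \<le> 1"
      show "nrm (?D \<xi>) \<le> e / 2"
      proof (rule field_le_epsilon)
        fix r :: real assume r: "0 < r"
        \<comment> \<open>Replacing \<open>\<xi>\<close> by an approximant within \<open>s\<close>
          costs at most \<open>(M + e / 2) * s\<close>, which is \<open>r\<close>.\<close>
        define s where "s = r / (M + e / 2)"
        have s: "0 < s" unfolding s_def using r M(1) e by (simp add: add_nonneg_pos)
        have Ms: "M + e / 2 \<noteq> 0" using M(1) e by (simp add: add_nonneg_eq_0_iff)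
        obtain \<eta> where \<eta>: "\<eta> \<in> Cc" "nrm (\<lambda>a. \<xi> a - \<eta> a) < s" using L2_approx[OF \<xi>(1) s] .
        have dL: "(\<lambda>a. \<xi> a - \<eta> a) \<in> L2 G" by (rule L2_diff[OF \<xi>(1) Cc_L2[OF \<eta>(1)]])
        have "?D (\<lambda>a. \<xi> a - \<eta> a) = (\<lambda>a. ?D \<xi> a - ?D \<eta> a)" by (rule bop_diff[OF bD \<xi>(1) Cc_L2[OF \<eta>(1)]])
        then have eq: "?D \<xi> = (\<lambda>a. ?D (\<lambda>a. \<xi> a - \<eta> a) a + ?D \<eta> a)" by (simp add: fun_eq_iff)
        have "nrm (?D \<xi>) \<le> nrm (?D (\<lambda>a. \<xi> a - \<eta> a)) + nrm (?D \<eta>)"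
          using fl2_add(2)[OF L2_fl2[OF bop_L2[OF bD dL]] L2_fl2[OF bop_L2[OF bD Cc_L2[OF \<eta>(1)]]]]
          unfolding eq[symmetric] .
        also have "\<dots> \<le> M * s + e / 2 * (1 + s)"
        proof (rule add_mono)
          show "nrm (?D (\<lambda>a. \<xi> a - \<eta> a)) \<le> M * s"
            using M(2)[OF dL] mult_left_mono[OF less_imp_le[OF \<eta>(2)] M(1)] by linarith
          have "nrm \<eta> \<le> nrm (\<lambda>a. \<xi> a - (\<xi> a - \<eta> a))" by simp
          also have "\<dots> \<le> nrm \<xi> + nrm (\<lambda>a. \<xi> a - \<eta> a)" by (rule fl2_diff(2)[OF L2_fl2[OF \<xi>(1)] L2_fl2[OF dL]])
          also have "\<dots> \<le> 1 + s" using \<xi>(2) \<eta>(2) by simp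
          finally have "e / 2 * nrm \<eta> \<le> e / 2 * (1 + s)" using e by (intro mult_left_mono) auto
          then show "nrm (?D \<eta>) \<le> e / 2 * (1 + s)" using Cc[OF \<eta>(1)] by linarith
        qed
        also have "\<dots> = e / 2 + (M + e / 2) * s" by (simp add: algebra_simps)
        also have "(M + e / 2) * s = r" unfolding s_def using Ms by simp
        finally show "nrm (?D \<xi>) \<le> e / 2 + r" .
      qed
    qed (use e in simp)
    then have "operator_norm G ?D < e" using e by simp
    then show ?thesis using f by (intro bexI[of _ "left_regular G f"] imageI)
  qed
  then show ?thesis unfolding reduced_algebra_def norm_closure_def using adj by blast
qed

end

theorem theoremE:
  fixes G :: "'a::t2_space groupoid_data"
  assumes "locally_compact_etale_groupoid G"
    and "sigma_compact (UNIV :: 'a set)"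
    and "amenable G"
  shows "reduced_algebra G = equivariant_part G (uniform_Roe_algebra G) \<and>
         equivariant_part G (uniform_Roe_algebra G) =
           equivariant_part G (uniform_quasi_local_algebra G)"
proof -
  interpret etale_groupoid G by unfold_locales (rule assms(1))
  have "equivariant_part G (uniform_Roe_algebra G) \<subseteq> equivariant_part G (uniform_quasi_local_algebra G)"
    using Roe_subset_quasi_local unfolding equivariant_part_def by blast
  moreover have "equivariant_part G (uniform_quasi_local_algebra G) \<subseteq> reduced_algebra G"
  proof
    fix T assume "T \<in> equivariant_part G (uniform_quasi_local_algebra G)"
    then have T: "T \<in> uniform_quasi_local_algebra G"
      and eqv: "\<And>g. g \<in> Cc \<Longrightarrow> T \<circ> right_conv G g = right_conv G g \<circ> T"
      unfolding equivariant_part_def by auto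
    have adj: "T \<in> adjointable_operators G" using T unfolding uniform_quasi_local_algebra_def by simp
    interpret equivariant_operator G T by unfold_locales (rule adj, rule eqv)
    show "T \<in> reduced_algebra G" by (rule quasi_local_in_reduced[OF T assms(3)])
  qed
  ultimately show ?thesis using reduced_subset_equivariant_Roe by blast
qed

end
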